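(* Let $\tau_1,\tau_2\in\mathbb{H}$ and let $n\ge 3$ be an integer. Then $n_{\tau_1}\sim n_{\tau_2}$ in $(\mathrm{End}(\mathbb{P}^1),\circ)$ if and only if $\Gamma_0(n)\tau_2=\Gamma_0(n)\tau_1$, where $\Gamma_0(n)=\left\{\begin{pmatrix}a&b\\c&d\end{pmatrix}\in\mathrm{SL}_2(\mathbb{Z}): c\equiv 0 \pmod n\right\}$ acts on $\mathbb{H}$ by Möbius transformations.
   Context: $\mathbb{H}$ is the upper half plane. For $\tau\in\mathbb{H}$ let $E_\tau=\mathbb{C}/(\mathbb{Z}+\tau\mathbb{Z})$ and let $\wp_\tau$ be the Weierstrass $\wp$-function of the lattice $\mathbb{Z}+\tau\mathbb{Z}$, viewed as a degree-2 map $E_\tau\to\mathbb{P}^1$. The map $z\mapsto nz$ induces a cyclic isogeny $[n]:E_\tau\to E_{n\tau}$, and $n_\tau$ denotes the unique rational function of degree $n$ with $n_\tau\circ\wp_\tau=\wp_{n\tau}\circ[n]$. For rational functions $f,g$, $f\sim g$ in $(\mathrm{End}(\mathbb{P}^1),\circ)$ means $g=\epsilon\circ f\circ\varepsilon$ for some Möbius transformations $\epsilon,\varepsilon\in\mathrm{Aut}(\mathbb{P}^1)$. *)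

theory Defs
  imports
    "HOL-Analysis.Analysis"
    "HOL-Computational_Algebra.Computational_Algebra"
begin

definition upper_half_plane :: "complex set" where
  "upper_half_plane = {\<tau>. Im \<tau> > 0}"

text \<open>The Riemann sphere is \<^typ>\<open>complex option\<close>, with \<^const>\<open>None\<close> as the point at infinity.\<close>

type_synonym P1 = "complex option"

text \<open>The self-map of the sphere given by \<open>p / q\<close>, for coprime \<open>p\<close> and \<open>q\<close>. With
  \<open>d = max (degree p) (degree q)\<close>, its value at infinity is that of the degree-\<open>d\<close>
  homogenisations of \<open>p\<close> and \<open>q\<close> at \<open>[1 : 0]\<close>, i.e. the quotient of the
  coefficients of index \<open>d\<close>.\<close>

definition rat_map :: "complex poly \<Rightarrow> complex poly \<Rightarrow> P1 \<Rightarrow> P1" where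
  "rat_map p q x =
     (case x of
        Some z \<Rightarrow> if poly q z = 0 then None else Some (poly p z / poly q z)
      | None \<Rightarrow> let d = max (degree p) (degree q) in
          if coeff q d = 0 then None else Some (coeff p d / coeff q d))"

definition rational_function_of_degree :: "nat \<Rightarrow> (P1 \<Rightarrow> P1) \<Rightarrow> bool" where
  "rational_function_of_degree d f \<longleftrightarrow>
     (\<exists>p q. coprime p q \<and> max (degree p) (degree q) = d \<and> f = rat_map p q)"

definition mobius_map :: "complex \<Rightarrow> complex \<Rightarrow> complex \<Rightarrow> complex \<Rightarrow> P1 \<Rightarrow> P1" where
  "mobius_map a b c d x =
     (case x of
        Some z \<Rightarrow> if c * z + d = 0 then None else Some ((a * z + b) / (c * z + d))
      | None \<Rightarrow> if c = 0 then None else Some (a / c))"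

definition mobius_transformations :: "(P1 \<Rightarrow> P1) set" where
  "mobius_transformations = {mobius_map a b c d | a b c d. a * d - b * c \<noteq> 0}"

definition mobius_equivalent :: "(P1 \<Rightarrow> P1) \<Rightarrow> (P1 \<Rightarrow> P1) \<Rightarrow> bool" where
  "mobius_equivalent f g \<longleftrightarrow>
     (\<exists>\<epsilon>\<in>mobius_transformations. \<exists>\<epsilon>'\<in>mobius_transformations. g = \<epsilon> \<circ> f \<circ> \<epsilon>')"

definition lattice_of :: "complex \<Rightarrow> complex set" where
  "lattice_of \<tau> = {of_int k + of_int l * \<tau> | k l. True}"

definition lattice_rel :: "complex \<Rightarrow> (complex \<times> complex) set" where
  "lattice_rel \<tau> = {(z, w). z - w \<in> lattice_of \<tau>}"

definition elliptic_curve :: "complex \<Rightarrow> complex set set" where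
  "elliptic_curve \<tau> = UNIV // lattice_rel \<tau>"

definition weierstrass_p :: "complex \<Rightarrow> complex \<Rightarrow> P1" where
  "weierstrass_p \<tau> z =
     (if z \<in> lattice_of \<tau> then None
      else Some (1 / z\<^sup>2 + (\<Sum>\<^sub>\<infinity>\<omega>\<in>lattice_of \<tau> - {0}. 1 / (z - \<omega>)\<^sup>2 - 1 / \<omega>\<^sup>2)))"

text \<open>The induced maps on quotients. Both are independent of representatives for \<open>\<tau>\<close> in the
  upper half plane: the first by periodicity of \<open>\<wp>\<close> (so that the image of a coset
  is a singleton), the second because \<open>n (k + l \<tau>) = n k + l (n \<tau>)\<close>.\<close>

definition wp_curve :: "complex \<Rightarrow> complex set \<Rightarrow> P1" where
  "wp_curve \<tau> X = the_elem (weierstrass_p \<tau> ` X)"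

definition isogeny :: "nat \<Rightarrow> complex \<Rightarrow> complex set \<Rightarrow> complex set" where
  "isogeny n \<tau> X = (\<Union>z\<in>X. lattice_rel (of_nat n * \<tau>) `` {of_nat n * z})"

definition n_map :: "nat \<Rightarrow> complex \<Rightarrow> P1 \<Rightarrow> P1" where
  "n_map n \<tau> =
     (THE f. rational_function_of_degree n f \<and>
        (\<forall>X\<in>elliptic_curve \<tau>. f (wp_curve \<tau> X) = wp_curve (of_nat n * \<tau>) (isogeny n \<tau> X)))"

definition Gamma0 :: "nat \<Rightarrow> (int^2^2) set" where
  "Gamma0 n = {A. det A = 1 \<and> int n dvd A $ 2 $ 1}"

definition modular_action :: "int^2^2 \<Rightarrow> complex \<Rightarrow> complex" where
  "modular_action A \<tau> =
     (of_int (A $ 1 $ 1) * \<tau> + of_int (A $ 1 $ 2)) / (of_int (A $ 2 $ 1) * \<tau> + of_int (A $ 2 $ 2))"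

definition Gamma0_orbit :: "nat \<Rightarrow> complex \<Rightarrow> complex set" where
  "Gamma0_orbit n \<tau> = (\<lambda>A. modular_action A \<tau>) ` Gamma0 n"

end

theory Submission
  imports Defs "HOL-Complex_Analysis.Complex_Analysis"
begin

text \<open>
  Everything is detected on lattices. The fibre of \<open>n\<^sub>\<tau>\<close> over \<open>\<wp>\<^bsub>n\<tau>\<^esub>(n z)\<close> is
  \<open>{\<wp>\<^sub>\<tau>(z + k/n) | 0 \<le> k < n}\<close>, and for \<open>n \<ge> 3\<close> it has fewer than \<open>n\<close> points exactly over
  the four values of \<open>\<wp>\<^bsub>n\<tau>\<^esub>\<close> at half periods. If \<open>n\<^bsub>\<tau>\<^sub>2\<^esub> = \<epsilon> \<circ> n\<^bsub>\<tau>\<^sub>1\<^esub> \<circ> \<epsilon>'\<close>, then \<open>\<epsilon>\<close> respects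
  these two quadruples; after a translation by a half period \<open>\<epsilon>\<close> fixes infinity, hence is affine
  and matches the differential equations of the two \<open>\<wp>\<close>-functions, so by uniqueness of the solution
  with a double pole it lifts to an affine map \<open>z \<mapsto> \<alpha> z + \<beta>\<close> of the plane. Since \<open>\<epsilon>' \<circ> \<wp>\<^bsub>\<tau>\<^sub>2\<^esub>\<close>
  takes values in the fibres of \<open>n\<^bsub>\<tau>\<^sub>1\<^esub>\<close>, the identity theorem shows that \<open>\<epsilon>'\<close> lifts to the inverse of
  the same affine map up to a translation. Comparing periods, \<open>\<alpha>\<close> maps \<open>\<int> + \<tau>\<^sub>1\<int>\<close> onto
  \<open>\<int> + \<tau>\<^sub>2\<int>\<close> and \<open>\<int> + n\<tau>\<^sub>1\<int>\<close> onto \<open>\<int> + n\<tau>\<^sub>2\<int>\<close>, which is an element of \<open>\<Gamma>\<^sub>0(n)\<close>.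

  The needed facts on \<open>\<wp>\<close> come from Liouville's theorem alone: for a half period \<open>h\<close> the function
  \<open>(\<wp>(z + h) - \<wp>(h))(\<wp>(z) - \<wp>(h))\<close> is constant, even elliptic functions with poles only in the
  lattice are polynomials in \<open>\<wp>\<close>, and uniqueness for the resulting differential equation shows
  that \<open>\<wp>(z) = \<wp>(w)\<close> only if \<open>z \<equiv> \<plusminus>w\<close>.
\<close>

section \<open>Sums over the lattice\<close>

text \<open>The exponent is half of -3: up to a constant, the product of two such terms, one per
  lattice coordinate, will dominate \<open>1 / norm \<omega> ^ 3\<close>, and -3/2 still lies below
  -1.\<close>

lemma summable_on_int_powr: "(\<lambda>k::int. (1 + real_of_int \<bar>k\<bar>) powr (-3/2)) summable_on UNIV"
proof -
  have "summable (\<lambda>n. real (Suc n) powr (-3/2))"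
    by (subst summable_Suc_iff) (simp add: summable_real_powr_iff)
  hence nat: "(\<lambda>n. (1 + real n) powr (-3/2)) summable_on UNIV"
    by (simp add: summable_on_UNIV_nonneg_real_iff)
  have 1: "(\<lambda>k::int. (1 + real_of_int \<bar>k\<bar>) powr (-3/2)) summable_on (range int)"
    by (subst summable_on_reindex) (use nat in \<open>simp_all add: o_def\<close>)
  have 2: "(\<lambda>k::int. (1 + real_of_int \<bar>k\<bar>) powr (-3/2)) summable_on (range (\<lambda>n. - int n))"
    by (subst summable_on_reindex) (use nat in \<open>simp_all add: o_def inj_on_def\<close>)
  have "UNIV = range int \<union> range (\<lambda>n. - int n)"
    by (auto simp: image_iff) (metis int_cases2)
  thus ?thesis using summable_on_union[OF 1 2] by simp
qed

section \<open>Arithmetic and discreteness of the lattice\<close>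

locale half_plane =
  fixes \<tau> :: complex
  assumes Im_pos: "Im \<tau> > 0"
begin

abbreviation "\<Lambda> \<equiv> lattice_of \<tau>"

text \<open>The imaginary part sees only \<open>l\<close> and bounds it; subtracting
  \<open>of_int l * \<tau>\<close> then bounds \<open>k\<close>. Discreteness and the convergence of
  the lattice sums both rest on this.\<close>

lemma lattice_coeff_bound:
  "real_of_int \<bar>k\<bar> + real_of_int \<bar>l\<bar> \<le> (1 + (norm \<tau> + 1) / Im \<tau>) * norm (of_int k + of_int l * \<tau>)"
proof -
  let ?w = "of_int k + of_int l * \<tau>"
  have "\<bar>of_int l * Im \<tau>\<bar> \<le> norm ?w"
    using abs_Im_le_cmod[of ?w] by simp
  hence l: "real_of_int \<bar>l\<bar> \<le> norm ?w / Im \<tau>"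
    using Im_pos by (simp add: abs_mult field_simps)
  have "real_of_int \<bar>k\<bar> = norm (?w - of_int l * \<tau>)" by simp
  also have "\<dots> \<le> norm ?w + real_of_int \<bar>l\<bar> * norm \<tau>"
    by (rule order.trans[OF norm_triangle_ineq4]) (simp add: norm_mult)
  also have "\<dots> \<le> norm ?w + norm ?w / Im \<tau> * norm \<tau>"
    using l by (intro add_left_mono mult_right_mono) auto
  finally show ?thesis using l by (simp add: field_simps add_divide_distrib)
qed

lemma lattice_repr_unique:
  assumes "of_int k + of_int l * \<tau> = of_int k' + of_int l' * \<tau>"
  shows "k = k' \<and> l = l'"
proof -
  have "of_int l * Im \<tau> = of_int l' * Im \<tau>"
    using arg_cong[OF assms, of Im] by simp
  hence "l = l'" using Im_pos by simp
  thus ?thesis using assms by simp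
qed

lemma lattice_memI: "of_int k + of_int l * \<tau> \<in> \<Lambda>"
  by (auto simp: lattice_of_def)

lemma lattice_0 [simp]: "0 \<in> \<Lambda>"
  using lattice_memI[of 0 0] by simp

lemma lattice_1 [simp]: "1 \<in> \<Lambda>"
  using lattice_memI[of 1 0] by simp

lemma lattice_tau [simp]: "\<tau> \<in> \<Lambda>"
  using lattice_memI[of 0 1] by simp

lemma lattice_add: "x \<in> \<Lambda> \<Longrightarrow> y \<in> \<Lambda> \<Longrightarrow> x + y \<in> \<Lambda>"
proof -
  assume "x \<in> \<Lambda>" "y \<in> \<Lambda>"
  then obtain k l k' l' where "x = of_int k + of_int l * \<tau>" "y = of_int k' + of_int l' * \<tau>"
    by (auto simp: lattice_of_def)
  thus ?thesis using lattice_memI[of "k + k'" "l + l'"] by (simp add: algebra_simps)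
qed

lemma lattice_uminus: "x \<in> \<Lambda> \<Longrightarrow> -x \<in> \<Lambda>"
proof -
  assume "x \<in> \<Lambda>"
  then obtain k l where "x = of_int k + of_int l * \<tau>"
    by (auto simp: lattice_of_def)
  thus ?thesis using lattice_memI[of "- k" "- l"] by simp
qed

lemma lattice_uminus_iff [simp]: "-x \<in> \<Lambda> \<longleftrightarrow> x \<in> \<Lambda>"
  using lattice_uminus[of x] lattice_uminus[of "-x"] by auto

lemma lattice_diff: "x \<in> \<Lambda> \<Longrightarrow> y \<in> \<Lambda> \<Longrightarrow> x - y \<in> \<Lambda>"
  using lattice_add[of x "-y"] by simp

lemma lattice_add_iff: "y \<in> \<Lambda> \<Longrightarrow> x + y \<in> \<Lambda> \<longleftrightarrow> x \<in> \<Lambda>"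
  using lattice_add[of x y] lattice_diff[of "x + y" y] by auto

lemma lattice_half_1: "1 / 2 \<notin> \<Lambda>"
proof
  assume "1 / 2 \<in> \<Lambda>"
  then obtain k l where "1 / 2 = of_int k + of_int l * \<tau>" by (auto simp: lattice_of_def)
  hence "of_int (2 * k) + of_int (2 * l) * \<tau> = of_int 1 + of_int 0 * \<tau>" by (simp add: field_simps)
  from lattice_repr_unique[OF this] show False by presburger
qed

lemma lattice_half_tau: "\<tau> / 2 \<notin> \<Lambda>"
proof
  assume "\<tau> / 2 \<in> \<Lambda>"
  then obtain k l where "\<tau> / 2 = of_int k + of_int l * \<tau>" by (auto simp: lattice_of_def)
  hence "of_int (2 * k) + of_int (2 * l) * \<tau> = of_int 0 + of_int 1 * \<tau>" by (simp add: field_simps)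
  from lattice_repr_unique[OF this] show False by presburger
qed

lemma lattice_half_1_tau: "(1 + \<tau>) / 2 \<notin> \<Lambda>"
proof
  assume "(1 + \<tau>) / 2 \<in> \<Lambda>"
  then obtain k l where "(1 + \<tau>) / 2 = of_int k + of_int l * \<tau>" by (auto simp: lattice_of_def)
  hence "of_int (2 * k) + of_int (2 * l) * \<tau> = of_int 1 + of_int 1 * \<tau>" by (simp add: field_simps)
  from lattice_repr_unique[OF this] show False by presburger
qed

lemma lattice_discrete: "\<exists>\<delta>>0. \<forall>\<omega>\<in>\<Lambda> - {0}. \<delta> \<le> norm \<omega>"
proof -
  define C where "C = 1 + (norm \<tau> + 1) / Im \<tau>"
  have C: "C > 0" using Im_pos by (auto simp: C_def intro!: add_pos_nonneg)
  have "1 / C \<le> norm \<omega>" if \<omega>: "\<omega> \<in> \<Lambda> - {0}" for \<omega>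
  proof -
    obtain k l where kl: "\<omega> = of_int k + of_int l * \<tau>" using \<omega> by (auto simp: lattice_of_def)
    have "k \<noteq> 0 \<or> l \<noteq> 0" using \<omega> kl by auto
    hence "1 \<le> real_of_int \<bar>k\<bar> + real_of_int \<bar>l\<bar>" by linarith
    also have "\<dots> \<le> C * norm \<omega>"
      unfolding C_def kl by (rule lattice_coeff_bound)
    finally show ?thesis using C by (simp add: divide_le_eq mult.commute)
  qed
  thus ?thesis using C by (intro exI[of _ "1 / C"]) auto
qed

text \<open>Arbitrary subsets are allowed because the lattice with one point removed has to be
  closed too, when a neighbourhood of that point is examined.\<close>

lemma closed_subset_lattice:
  assumes "A \<subseteq> \<Lambda>"
  shows "closed A"
proof -
  obtain \<delta> where \<delta>: "\<delta> > 0" "\<And>\<omega>. \<omega> \<in> \<Lambda> - {0} \<Longrightarrow> \<delta> \<le> norm \<omega>"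
    using lattice_discrete by auto
  show ?thesis
  proof (rule discrete_imp_closed[OF \<delta>(1)], safe)
    fix x y assume xy: "x \<in> A" "y \<in> A" "dist y x < \<delta>"
    show "y = x"
    proof (rule ccontr)
      assume "y \<noteq> x"
      hence "y - x \<in> \<Lambda> - {0}" using xy assms lattice_diff by auto
      from \<delta>(2)[OF this] xy show False by (simp add: dist_norm)
    qed
  qed
qed

lemma open_compl_lattice: "open (- \<Lambda>)"
  using closed_subset_lattice[of \<Lambda>] by auto

lemma countable_lattice: "countable \<Lambda>"
proof -
  have "\<Lambda> = (\<lambda>(k,l). of_int k + of_int l * \<tau>) ` (UNIV :: (int \<times> int) set)"
    by (auto simp: lattice_of_def)
  thus ?thesis by simp
qed

text \<open>Lets a function with vanishing derivative off the lattice be recognised as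
  constant.\<close>

lemma connected_compl_lattice: "connected (- \<Lambda>)"
  by (intro path_connected_imp_connected path_connected_complement_countable countable_lattice) simp

section \<open>Convergence of the Weierstrass series\<close>

lemma summable_lattice: "(\<lambda>\<omega>. 1 / norm \<omega> ^ 3) summable_on (\<Lambda> - {0})"
proof -
  define C where "C = 1 + (norm \<tau> + 1) / Im \<tau>"
  have C: "C > 0" using Im_pos by (auto simp: C_def intro!: add_pos_nonneg)
  define g where "g = (\<lambda>k::int. (1 + real_of_int \<bar>k\<bar>) powr (-3/2))"
  have g0: "g k \<ge> 0" for k by (simp add: g_def)
  have gs: "g summable_on UNIV" unfolding g_def by (rule summable_on_int_powr)
  have gg: "(\<lambda>(k,l). g k * g l) summable_on (UNIV \<times> UNIV)"
  proof (rule summable_on_SigmaI)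
    show "((\<lambda>l. case (k, l) of (k, l) \<Rightarrow> g k * g l) has_sum (g k * infsum g UNIV)) UNIV" for k
      using has_sum_cmult_right[OF has_sum_infsum[OF gs], of "g k"] by simp
    show "(\<lambda>k. g k * infsum g UNIV) summable_on UNIV"
      by (intro summable_on_cmult_left gs)
  qed (use g0 in auto)
  define e where "e = (\<lambda>(k::int,l::int). of_int k + of_int l * \<tau>)"
  have img: "\<Lambda> - {0} = e ` (UNIV - {(0,0)})"
    using lattice_repr_unique[of _ _ 0 0] by (auto simp: e_def lattice_of_def)
  have inj: "inj_on e (UNIV - {(0,0)})"
    by (auto simp: inj_on_def e_def dest: lattice_repr_unique)
  show ?thesis unfolding img
  proof (subst summable_on_reindex[OF inj], rule summable_on_comparison_test)
    show "(\<lambda>x. (8 * C ^ 3) * (case x of (k,l) \<Rightarrow> g k * g l)) summable_on UNIV - {(0,0)}"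
      by (intro summable_on_cmult_right summable_on_subset_banach[OF gg]) auto
    fix x :: "int \<times> int" assume x: "x \<in> UNIV - {(0,0)}"
    obtain k l where kl: "x = (k,l)" by force
    define s where "s = real_of_int \<bar>k\<bar> + real_of_int \<bar>l\<bar>"
    have "k \<noteq> 0 \<or> l \<noteq> 0" using x kl by auto
    hence s1: "s \<ge> 1" unfolding s_def by linarith
    have sb: "s \<le> C * norm (e x)"
      using lattice_coeff_bound[of k l] by (simp add: s_def C_def e_def kl)
    hence s3: "s ^ 3 \<le> C ^ 3 * norm (e x) ^ 3"
      using s1 by (simp flip: power_mult_distrib add: power_mono)
    have "e x \<noteq> 0" using sb s1 by auto
    have "1 / (8 * s ^ 3) = (2 * s) powr (-3)"
      using s1 by (simp add: powr_minus powr_numeral power_mult_distrib divide_simps)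
    also have "\<dots> = ((2 * s) powr 2) powr (-3/2)"
      by (simp add: powr_powr)
    \<comment> \<open>Both factors are at most \<open>2 * s\<close> since \<open>s \<ge> 1\<close>,
      so the double sum is compared with a product of two single sums.\<close>
    also have "\<dots> \<le> ((1 + real_of_int \<bar>k\<bar>) * (1 + real_of_int \<bar>l\<bar>)) powr (-3/2)"
    proof (rule powr_mono2')
      have "(1 + real_of_int \<bar>k\<bar>) * (1 + real_of_int \<bar>l\<bar>) \<le> (2 * s) * (2 * s)"
        using s1 by (intro mult_mono) (auto simp: s_def)
      thus "(1 + real_of_int \<bar>k\<bar>) * (1 + real_of_int \<bar>l\<bar>) \<le> (2 * s) powr 2"
        using s1 by (simp add: powr_numeral power2_eq_square)
    qed auto
    also have "\<dots> = g k * g l" by (simp add: g_def powr_mult)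
    finally have gk: "1 \<le> 8 * s ^ 3 * (g k * g l)"
      using s1 by (simp add: divide_le_eq mult_ac)
    also have "\<dots> \<le> 8 * (C ^ 3 * norm (e x) ^ 3) * (g k * g l)"
      using s3 g0 by (intro mult_right_mono mult_left_mono) auto
    finally show "((\<lambda>\<omega>. 1 / norm \<omega> ^ 3) \<circ> e) x \<le> (8 * C ^ 3) * (case x of (k,l) \<Rightarrow> g k * g l)"
      using \<open>e x \<noteq> 0\<close> by (simp add: divide_le_eq kl mult_ac)
  qed auto
qed

text \<open>The part of \<wp> that stays analytic at the origin: the term
  \<open>1 / z\<^sup>2\<close> is left out, and the remaining poles are the nonzero lattice
  points.\<close>

definition wp0 :: "complex \<Rightarrow> complex" where
  "wp0 z = (\<Sum>\<^sub>\<infinity>\<omega>\<in>\<Lambda> - {0}. 1 / (z - \<omega>)\<^sup>2 - 1 / \<omega>\<^sup>2)"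

text \<open>Over a common denominator the numerator is \<open>z * (2 * \<omega> - z)\<close>, of
  first order in \<omega> only. The terms thus decay like the inverse cube of the norm, uniformly
  for \<open>z\<close> near \<open>z0\<close>.\<close>

lemma wp_term_bound:
  fixes z0 :: complex
  assumes z0: "z0 \<notin> \<Lambda> - {0}"
  obtains r K where "r > 0" "ball z0 r \<subseteq> - (\<Lambda> - {0})"
    "\<And>z \<omega>. z \<in> ball z0 r \<Longrightarrow> \<omega> \<in> \<Lambda> - {0} \<Longrightarrow> norm (1 / (z - \<omega>)\<^sup>2 - 1 / \<omega>\<^sup>2) \<le> K * (1 / norm \<omega> ^ 3)"
proof -
  have "open (- (\<Lambda> - {0}))"
    by (intro open_Compl closed_subset_lattice) auto
  \<comment> \<open>With twice the radius free of nonzero lattice points, points of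
    \<open>ball z0 r\<close> keep distance at least \<open>r\<close> from all of them.\<close>
  then obtain r where r: "r > 0" "ball z0 (2 * r) \<subseteq> - (\<Lambda> - {0})"
    using z0 by (metis ComplI field_sum_of_halves mult_2 half_gt_zero open_contains_ball)
  define R where "R = norm z0 + r"
  define K where "K = 1 + R / r"
  have R: "R \<ge> 0" and K: "K \<ge> 1" using r by (auto simp: R_def K_def)
  show ?thesis
  proof
    show "r > 0" by fact
    show "ball z0 r \<subseteq> - (\<Lambda> - {0})" using r(2) subset_ball[of r "2 * r" z0] r(1) by auto
    fix z \<omega> assume z: "z \<in> ball z0 r" and w: "\<omega> \<in> \<Lambda> - {0}"
    have zR: "norm z \<le> R"
      using z norm_triangle_sub[of z z0] by (auto simp: R_def dist_norm norm_minus_commute)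
    have "\<omega> \<notin> ball z0 (2 * r)" using r w by auto
    hence d: "norm (z - \<omega>) \<ge> r"
      using z dist_triangle[of z0 \<omega> z] by (auto simp: dist_norm)
    have "norm \<omega> \<le> norm (z - \<omega>) + norm z" 
      by (metis norm_minus_commute norm_triangle_sub add.commute)
    also have "\<dots> \<le> norm (z - \<omega>) + R / r * norm (z - \<omega>)"
    proof -
      have "R * r \<le> R * norm (z - \<omega>)" using d R by (intro mult_left_mono) auto
      moreover have "norm z * r \<le> R * r" using zR r by (intro mult_right_mono) auto
      ultimately have "norm z * r \<le> R * norm (z - \<omega>)" by linarith
      thus ?thesis using r by (simp add: field_simps)
    qed
    finally have wK: "norm \<omega> \<le> K * norm (z - \<omega>)" by (simp add: K_def algebra_simps)
    have nz: "norm \<omega> > 0" "norm (z - \<omega>) > 0" using w d r by auto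
    have "norm (2 * \<omega> - z) = norm (\<omega> - (z - \<omega>))" by (simp add: algebra_simps)
    also have "\<dots> \<le> norm \<omega> + norm (z - \<omega>)" by (rule norm_triangle_ineq4)
    also have "\<dots> \<le> (K + 1) * norm (z - \<omega>)" using wK by (simp add: algebra_simps)
    finally have t: "norm (2 * \<omega> - z) \<le> (K + 1) * norm (z - \<omega>)" .
    have "1 / (z - \<omega>)\<^sup>2 - 1 / \<omega>\<^sup>2 = z * (2 * \<omega> - z) / (\<omega>\<^sup>2 * (z - \<omega>)\<^sup>2)"
    proof -
      have nz': "\<omega>\<^sup>2 \<noteq> 0" "(z - \<omega>)\<^sup>2 \<noteq> 0" using nz by auto
      have "1 / (z - \<omega>)\<^sup>2 - 1 / \<omega>\<^sup>2 = (\<omega>\<^sup>2 - (z - \<omega>)\<^sup>2) / (\<omega>\<^sup>2 * (z - \<omega>)\<^sup>2)"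
        using diff_frac_eq[OF nz'(2,1), of 1 1] by (simp add: mult.commute)
      also have "\<omega>\<^sup>2 - (z - \<omega>)\<^sup>2 = z * (2 * \<omega> - z)"
        by (simp add: power2_eq_square algebra_simps)
      finally show ?thesis .
    qed
    hence "norm (1 / (z - \<omega>)\<^sup>2 - 1 / \<omega>\<^sup>2) = norm z * norm (2 * \<omega> - z) / (norm \<omega> ^ 2 * norm (z - \<omega>) ^ 2)"
      by (simp add: norm_mult norm_divide norm_power)
    also have "\<dots> \<le> R * ((K + 1) * norm (z - \<omega>)) / (norm \<omega> ^ 2 * norm (z - \<omega>) ^ 2)"
      using zR t R by (intro divide_right_mono mult_mono) auto
    also have "\<dots> = R * (K + 1) / (norm \<omega> ^ 2 * norm (z - \<omega>))"
      using nz by (simp add: field_simps power2_eq_square)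
    also have "\<dots> \<le> R * (K + 1) / (norm \<omega> ^ 2 * (norm \<omega> / K))"
      using nz wK R K by (intro divide_left_mono mult_left_mono mult_pos_pos) (auto simp: field_simps)
    also have "\<dots> = (R * (K + 1) * K) * (1 / norm \<omega> ^ 3)"
      by (simp add: power2_eq_square power3_eq_cube)
    finally show "norm (1 / (z - \<omega>)\<^sup>2 - 1 / \<omega>\<^sup>2) \<le> (R * (K + 1) * K) * (1 / norm \<omega> ^ 3)" .
  qed
qed

text \<open>The Weierstrass M-test, along the net of finite subsets that defines the unordered sum;
  holomorphy and derivatives then pass to the limit.\<close>

lemma wp0_uniform_limit:
  assumes "z0 \<notin> \<Lambda> - {0}"
  obtains r where "r > 0" "ball z0 r \<subseteq> - (\<Lambda> - {0})"
    "uniform_limit (ball z0 r) (\<lambda>X z. \<Sum>\<omega>\<in>X. 1 / (z - \<omega>)\<^sup>2 - 1 / \<omega>\<^sup>2) wp0 (finite_subsets_at_top (\<Lambda> - {0}))"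
proof -
  obtain r K where r: "r > 0" "ball z0 r \<subseteq> - (\<Lambda> - {0})"
    "\<And>z \<omega>. z \<in> ball z0 r \<Longrightarrow> \<omega> \<in> \<Lambda> - {0} \<Longrightarrow> norm (1 / (z - \<omega>)\<^sup>2 - 1 / \<omega>\<^sup>2) \<le> K * (1 / norm \<omega> ^ 3)"
    using wp_term_bound[OF assms] by blast
  have "uniform_limit (ball z0 r) (\<lambda>X z. \<Sum>\<omega>\<in>X. 1 / (z - \<omega>)\<^sup>2 - 1 / \<omega>\<^sup>2) 
      (\<lambda>z. \<Sum>\<^sub>\<infinity>\<omega>\<in>\<Lambda> - {0}. 1 / (z - \<omega>)\<^sup>2 - 1 / \<omega>\<^sup>2) (finite_subsets_at_top (\<Lambda> - {0}))"
    by (rule Weierstrass_m_test_general[where M = "\<lambda>\<omega>. K * (1 / norm \<omega> ^ 3)"])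
       (use r(3) summable_on_cmult_right[OF summable_lattice] in auto)
  thus ?thesis using that[of r] r by (simp add: wp0_def[abs_def])
qed

lemma wp0_partial_holo:
  assumes "ball z0 r \<subseteq> - (\<Lambda> - {0})"
  shows "eventually (\<lambda>X. (\<lambda>z. \<Sum>\<omega>\<in>X. 1 / (z - \<omega>)\<^sup>2 - 1 / \<omega>\<^sup>2) holomorphic_on ball z0 r)
           (finite_subsets_at_top (\<Lambda> - {0}))"
  by (rule eventually_finite_subsets_at_top_weakI)
     (use assms in \<open>force intro!: holomorphic_intros\<close>)

lemma wp0_analytic:
  assumes "z0 \<notin> \<Lambda> - {0}"
  shows "wp0 analytic_on {z0}"
proof -
  obtain r where r: "r > 0" "ball z0 r \<subseteq> - (\<Lambda> - {0})"
    "uniform_limit (ball z0 r) (\<lambda>X z. \<Sum>\<omega>\<in>X. 1 / (z - \<omega>)\<^sup>2 - 1 / \<omega>\<^sup>2) wp0 (finite_subsets_at_top (\<Lambda> - {0}))"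
    using wp0_uniform_limit[OF assms] by blast
  \<comment> \<open>The limit theorem wants the partial sums continuous on a closed ball, hence the
    half radius.\<close>
  have sub: "ball z0 (r/2) \<subseteq> cball z0 (r/2)" "cball z0 (r/2) \<subseteq> ball z0 r" using r(1) by auto
  have "wp0 holomorphic_on ball z0 (r / 2)"
  proof (rule holomorphic_uniform_limit[OF _ uniform_limit_on_subset[OF r(3) sub(2)]])
    show "eventually (\<lambda>X. continuous_on (cball z0 (r/2)) (\<lambda>z. \<Sum>\<omega>\<in>X. 1 / (z - \<omega>)\<^sup>2 - 1 / \<omega>\<^sup>2)
            \<and> (\<lambda>z. \<Sum>\<omega>\<in>X. 1 / (z - \<omega>)\<^sup>2 - 1 / \<omega>\<^sup>2) holomorphic_on ball z0 (r/2)) (finite_subsets_at_top (\<Lambda> - {0}))"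
      using wp0_partial_holo[OF r(2)]
      by eventually_elim (use sub in \<open>blast intro: holomorphic_on_subset holomorphic_on_imp_continuous_on continuous_on_subset\<close>)
  qed auto
  thus ?thesis using r(1) unfolding analytic_at_ball by (meson half_gt_zero)
qed

lemma wp0_deriv_has_sum:
  assumes "z \<notin> \<Lambda> - {0}"
  shows "((\<lambda>\<omega>. - 2 / (z - \<omega>) ^ 3) has_sum deriv wp0 z) (\<Lambda> - {0})"
proof -
  obtain r where r: "r > 0" "ball z r \<subseteq> - (\<Lambda> - {0})"
    "uniform_limit (ball z r) (\<lambda>X z. \<Sum>\<omega>\<in>X. 1 / (z - \<omega>)\<^sup>2 - 1 / \<omega>\<^sup>2) wp0 (finite_subsets_at_top (\<Lambda> - {0}))"
    using wp0_uniform_limit[OF assms] by blast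
  \<comment> \<open>The first derivative is written as an iterate to fit the limit theorem for
    higher derivatives.\<close>
  have "((\<lambda>X. (deriv ^^ 1) (\<lambda>z. \<Sum>\<omega>\<in>X. 1 / (z - \<omega>)\<^sup>2 - 1 / \<omega>\<^sup>2) z) \<longlongrightarrow> (deriv ^^ 1) wp0 z) (finite_subsets_at_top (\<Lambda> - {0}))"
    by (rule higher_deriv_complex_uniform_limit[OF r(3) wp0_partial_holo[OF r(2)]]) (use r(1) in auto)
  moreover have "eventually (\<lambda>X. (deriv ^^ 1) (\<lambda>z. \<Sum>\<omega>\<in>X. 1 / (z - \<omega>)\<^sup>2 - 1 / \<omega>\<^sup>2) z = (\<Sum>\<omega>\<in>X. - 2 / (z - \<omega>) ^ 3)) 
     (finite_subsets_at_top (\<Lambda> - {0}))"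
  proof (rule eventually_finite_subsets_at_top_weakI)
    fix X assume X: "finite X" "X \<subseteq> \<Lambda> - {0}"
    have "((\<lambda>z. \<Sum>\<omega>\<in>X. 1 / (z - \<omega>)\<^sup>2 - 1 / \<omega>\<^sup>2) has_field_derivative (\<Sum>\<omega>\<in>X. - 2 / (z - \<omega>) ^ 3)) (at z)"
    proof (rule DERIV_sum)
      fix \<omega> assume "\<omega> \<in> X"
      hence "z - \<omega> \<noteq> 0" using assms X by auto
      hence "((\<lambda>z. inverse ((z - \<omega>)\<^sup>2) - 1 / \<omega>\<^sup>2) has_field_derivative
          - (inverse ((z - \<omega>)\<^sup>2) * (2 * (z - \<omega>)) * inverse ((z - \<omega>)\<^sup>2))) (at z)"
        by (auto intro!: derivative_eq_intros)
      also have "- (inverse ((z - \<omega>)\<^sup>2) * (2 * (z - \<omega>)) * inverse ((z - \<omega>)\<^sup>2)) = - 2 / (z - \<omega>) ^ 3"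
        using \<open>z - \<omega> \<noteq> 0\<close> by (simp add: power2_eq_square power3_eq_cube divide_simps)
      finally show "((\<lambda>z. 1 / (z - \<omega>)\<^sup>2 - 1 / \<omega>\<^sup>2) has_field_derivative - 2 / (z - \<omega>) ^ 3) (at z)"
        by (simp add: divide_inverse)
    qed
    thus "(deriv ^^ 1) (\<lambda>z. \<Sum>\<omega>\<in>X. 1 / (z - \<omega>)\<^sup>2 - 1 / \<omega>\<^sup>2) z = (\<Sum>\<omega>\<in>X. - 2 / (z - \<omega>) ^ 3)"
      by (simp add: DERIV_imp_deriv)
  qed
  ultimately show ?thesis unfolding has_sum_def by (simp add: tendsto_cong)
qed

end

section \<open>Even elliptic functions\<close>

lemma filterlim_affine_at:
  "\<alpha> \<noteq> 0 \<Longrightarrow> filterlim (\<lambda>z. \<alpha> * z + \<beta>) (at (\<alpha> * x + \<beta>)) (at (x :: complex))"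
  unfolding filterlim_at by (auto intro!: tendsto_eq_intros simp: eventually_at_filter)

text \<open>\<open>cosparse UNIV\<close> describes what holds off a set without accumulation points.
  This can be checked on punctured neighbourhoods, which affine bijections preserve.\<close>

lemma ae_affine:
  assumes "eventually P (cosparse (UNIV :: complex set))" "\<alpha> \<noteq> 0"
  shows "eventually (\<lambda>z. P (\<alpha> * z + \<beta>)) (cosparse UNIV)"
proof -
  have "eventually (\<lambda>z. P (\<alpha> * z + \<beta>)) (at x)" for x
  proof -
    have "eventually P (at (\<alpha> * x + \<beta>))"
      using assms(1) by (simp add: eventually_cosparse_open_eq)
    thus ?thesis
      by (rule eventually_compose_filterlim) (rule filterlim_affine_at[OF assms(2)])
  qed
  thus ?thesis by (simp add: eventually_cosparse_open_eq)
qed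

lemma ae_imp_ex: "eventually P (cosparse (UNIV :: complex set)) \<Longrightarrow> \<exists>z. P z"
  using eventually_happens[of P "cosparse UNIV"] by auto

text \<open>A meromorphic difference either vanishes off a sparse set or is nonzero off one, so it
  is enough that equality is not excluded off a sparse set.\<close>

lemma meromorphic_identity:
  assumes "f meromorphic_on UNIV" "g meromorphic_on UNIV" "frequently (\<lambda>z. f z = g z) (cosparse UNIV)"
  shows "eventually (\<lambda>z. f z = g z) (cosparse UNIV)"
proof -
  have "(\<lambda>z. f z - g z) meromorphic_on UNIV" by (intro meromorphic_intros assms)
  from meromorphic_imp_constant_or_avoid[OF this, of 0] assms(3) show ?thesis
    by (auto simp: frequently_def)
qed

text \<open>Dividing out \<open>z - a\<close> once leaves an analytic function with value
  \<open>deriv f a = 0\<close> at \<open>a\<close>; the second division is its difference quotient.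
  This is how double poles get cancelled later.\<close>

lemma double_zero_limit:
  assumes "f analytic_on {a}" "deriv f a = 0"
  shows "\<exists>L. (\<lambda>z. (f z - f a) / (z - a)\<^sup>2) \<midarrow>a\<rightarrow> L"
proof -
  obtain r where r: "r > 0" "f holomorphic_on ball a r"
    using assms(1) by (auto simp: analytic_at_ball)
  define g where "g = (\<lambda>z. if z = a then deriv f a else (f z - f a) / (z - a))"
  have "g holomorphic_on ball a r"
    unfolding g_def by (rule pole_lemma[OF r(2)]) (use r in auto)
  hence "(g has_field_derivative deriv g a) (at a)"
    using r(1) by (intro holomorphic_derivI[of _ "ball a r"]) auto
  hence "(\<lambda>z. (g z - g a) / (z - a)) \<midarrow>a\<rightarrow> deriv g a"
    by (simp add: has_field_derivative_iff)
  also have "?this \<longleftrightarrow> (\<lambda>z. (f z - f a) / (z - a)\<^sup>2) \<midarrow>a\<rightarrow> deriv g a"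
    by (intro tendsto_cong) (auto simp: eventually_at_filter g_def assms power2_eq_square)
  finally show ?thesis by blast
qed

lemma deriv_zero_if_even:
  assumes "g analytic_on {0 :: complex}" "eventually (\<lambda>z. g (-z) = g z) (nhds 0)"
  shows "deriv g 0 = 0"
proof -
  have d: "(g has_field_derivative deriv g 0) (at 0)"
    using assms(1) analytic_on_imp_differentiable_at DERIV_deriv_iff_field_differentiable by blast
  have "((\<lambda>z. g (-z)) has_field_derivative deriv g 0 * (-1)) (at 0)"
    by (rule DERIV_chain'[of uminus _ _ _ g]) (use d in \<open>auto intro!: derivative_eq_intros\<close>)
  hence "(g has_field_derivative deriv g 0 * (-1)) (at 0)"
    using DERIV_cong_ev[OF refl assms(2) refl] by blast
  from DERIV_unique[OF d this] show ?thesis by simp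
qed

section \<open>Periodicity and poles of \<wp>\<close>

context half_plane
begin

lemma eventually_not_lattice_at: "eventually (\<lambda>z. z \<notin> \<Lambda>) (at x)"
proof -
  have "open (- (\<Lambda> - {x}))" by (intro open_Compl closed_subset_lattice) auto
  hence "eventually (\<lambda>z. z \<in> - (\<Lambda> - {x}) - {x}) (at x)" by (intro eventually_at_in_open) auto
  thus ?thesis by eventually_elim auto
qed

lemma ae_not_lattice: "eventually (\<lambda>z. z \<notin> \<Lambda>) (cosparse UNIV)"
  by (simp add: eventually_cosparse_open_eq eventually_not_lattice_at)

text \<open>The value \<open>0\<close> at lattice points makes evenness and periodicity hold everywhere.\<close>

definition wp :: "complex \<Rightarrow> complex" where
  "wp z = (if z \<in> \<Lambda> then 0 else 1 / z\<^sup>2 + wp0 z)"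

lemma weierstrass_p_eq: "weierstrass_p \<tau> z = (if z \<in> \<Lambda> then None else Some (wp z))"
  by (simp add: weierstrass_p_def wp_def wp0_def)

lemma wp_nhds:
  assumes "z \<notin> \<Lambda>"
  shows "eventually (\<lambda>w. wp w = 1 / w\<^sup>2 + wp0 w) (nhds z)"
proof -
  have "eventually (\<lambda>w. w \<in> - \<Lambda>) (nhds z)"
    using assms by (intro eventually_nhds_in_open open_compl_lattice) auto
  thus ?thesis by eventually_elim (auto simp: wp_def)
qed

lemma wp_at_0: "eventually (\<lambda>w. wp w = 1 / w\<^sup>2 + wp0 w) (at 0)"
  using eventually_not_lattice_at by eventually_elim (auto simp: wp_def)

lemma wp0_analytic': "z \<notin> \<Lambda> \<Longrightarrow> wp0 analytic_on {z}" "wp0 analytic_on {0}"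
  by (auto intro: wp0_analytic)

lemma wp_analytic: 
  assumes "z \<notin> \<Lambda>"
  shows "wp analytic_on {z}"
proof -
  have "z \<noteq> 0" using assms by auto
  hence "(\<lambda>w. 1 / w\<^sup>2 + wp0 w) analytic_on {z}"
    using assms by (auto intro!: analytic_intros wp0_analytic')
  thus ?thesis using analytic_at_cong[OF wp_nhds[OF assms] refl] by simp
qed

lemma wp_has_deriv: "z \<notin> \<Lambda> \<Longrightarrow> (wp has_field_derivative deriv wp z) (at z)"
  using wp_analytic analytic_on_imp_differentiable_at DERIV_deriv_iff_field_differentiable by blast

lemma deriv_wp_eq:
  assumes "z \<noteq> 0" "wp0 analytic_on {z}" "eventually (\<lambda>w. wp w = 1 / w\<^sup>2 + wp0 w) (nhds z)"
  shows "deriv wp z = - 2 / z ^ 3 + deriv wp0 z"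
proof -
  have d: "(wp0 has_field_derivative deriv wp0 z) (at z)"
    using assms(2) analytic_on_imp_differentiable_at DERIV_deriv_iff_field_differentiable by blast
  have "((\<lambda>w. inverse (w\<^sup>2) + wp0 w) has_field_derivative 
     - (inverse (z\<^sup>2) * (2 * z) * inverse (z\<^sup>2)) + deriv wp0 z) (at z)"
    using assms(1) by (auto intro!: derivative_eq_intros d)
  also have "- (inverse (z\<^sup>2) * (2 * z) * inverse (z\<^sup>2)) = - 2 / z ^ 3"
    using assms(1) by (simp add: power2_eq_square power3_eq_cube divide_simps)
  finally have "((\<lambda>w. 1 / w\<^sup>2 + wp0 w) has_field_derivative - 2 / z ^ 3 + deriv wp0 z) (at z)"
    by (simp add: divide_inverse)
  hence "(wp has_field_derivative - 2 / z ^ 3 + deriv wp0 z) (at z)"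
    using DERIV_cong_ev[OF refl assms(3) refl] by blast
  thus ?thesis by (rule DERIV_imp_deriv)
qed

lemma deriv_wp: "z \<notin> \<Lambda> \<Longrightarrow> deriv wp z = - 2 / z ^ 3 + deriv wp0 z"
  by (rule deriv_wp_eq) (auto intro: wp0_analytic' wp_nhds)

text \<open>The derivative of \<open>1 / z\<^sup>2\<close> supplies the missing term at 0, so the
  sum runs over the whole lattice. A lattice translation then only permutes the terms, which makes
  the derivative periodic.\<close>

lemma wp_deriv_has_sum:
  assumes "z \<notin> \<Lambda>"
  shows "((\<lambda>\<omega>. - 2 / (z - \<omega>) ^ 3) has_sum deriv wp z) \<Lambda>"
proof -
  have "((\<lambda>\<omega>. - 2 / (z - \<omega>) ^ 3) has_sum (- 2 / (z - 0) ^ 3 + deriv wp0 z)) (insert 0 (\<Lambda> - {0}))"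
    by (rule has_sum_insert) (use wp0_deriv_has_sum[of z] assms in auto)
  moreover have "insert 0 (\<Lambda> - {0}) = \<Lambda>" by auto
  ultimately show ?thesis using assms by (simp add: deriv_wp)
qed

lemma deriv_wp_periodic:
  assumes "z \<notin> \<Lambda>" "\<omega> \<in> \<Lambda>"
  shows "deriv wp (z + \<omega>) = deriv wp z"
proof -
  have "z + \<omega> \<notin> \<Lambda>" using assms lattice_add_iff by auto
  from wp_deriv_has_sum[OF this]
  have "((\<lambda>w. - 2 / (z + \<omega> - w) ^ 3) has_sum deriv wp (z + \<omega>)) \<Lambda>" .
  also have "?this \<longleftrightarrow> ((\<lambda>w. - 2 / (z - w) ^ 3) has_sum deriv wp (z + \<omega>)) \<Lambda>"
    by (rule has_sum_reindex_bij_witness[of _ "\<lambda>w. w + \<omega>" "\<lambda>w. w - \<omega>"])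
       (use assms in \<open>auto simp: lattice_add lattice_diff algebra_simps\<close>)
  finally show ?thesis using has_sum_unique wp_deriv_has_sum[OF assms(1)] by blast
qed

lemma wp0_even: "wp0 (-z) = wp0 z"
  unfolding wp0_def
  by (rule infsum_reindex_bij_witness[of _ uminus uminus])
     (auto simp: power2_eq_square algebra_simps)

lemma wp_even [simp]: "wp (-z) = wp z"
  by (simp add: wp_def wp0_even)

lemma wp_periodic_diff:
  assumes "\<omega> \<in> \<Lambda>"
  shows "\<exists>c. \<forall>z. z \<notin> \<Lambda> \<longrightarrow> wp (z + \<omega>) = wp z + c"
proof -
  have sh: "z + \<omega> \<notin> \<Lambda>" if "z \<notin> \<Lambda>" for z using that assms lattice_add_iff by auto
  have D: "((\<lambda>z. wp (z + \<omega>) - wp z) has_field_derivative 0) (at z)" if "z \<in> -\<Lambda>" for z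
  proof -
    have z: "z \<notin> \<Lambda>" using that by auto
    have "((\<lambda>z. wp (z + \<omega>)) has_field_derivative deriv wp (z + \<omega>)) (at z)"
      using wp_has_deriv[OF sh[OF z]] by (simp add: DERIV_shift)
    from DERIV_diff[OF this wp_has_deriv[OF z]] show ?thesis
      using deriv_wp_periodic[OF z assms] by simp
  qed
  obtain c where "\<And>z. z \<in> -\<Lambda> \<Longrightarrow> wp (z + \<omega>) - wp z = c"
  proof (rule DERIV_zero_connected_constant[OF connected_compl_lattice open_compl_lattice, of "{}"])
    show "continuous_on (-\<Lambda>) (\<lambda>z. wp (z + \<omega>) - wp z)"
      using D by (meson DERIV_continuous continuous_at_imp_continuous_on)
  qed (use D in auto)
  thus ?thesis by (intro exI[of _ c]) (auto simp: algebra_simps)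
qed

text \<open>Evenness removes the constant left by integrating the periodic derivative: the shift
  relation at \<open>- z - \<omega>\<close> is the one at \<open>z\<close> with the two values
  exchanged, so \<open>c = - c\<close>.\<close>

lemma wp_periodic:
  assumes "\<omega> \<in> \<Lambda>"
  shows "wp (z + \<omega>) = wp z"
proof (cases "z \<in> \<Lambda>")
  case True
  thus ?thesis using assms by (simp add: wp_def lattice_add)
next
  case False
  obtain c where c: "\<And>z. z \<notin> \<Lambda> \<Longrightarrow> wp (z + \<omega>) = wp z + c"
    using wp_periodic_diff[OF assms] by blast
  have "- z - \<omega> \<notin> \<Lambda>"
    using False lattice_add_iff[of "-\<omega>" "-z"] assms by simp
  from c[OF this] have "wp (-z) = wp (-(z + \<omega>)) + c"
    by (simp only: diff_add_cancel minus_add_distrib flip: diff_conv_add_uminus)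
  hence "wp z = wp (z + \<omega>) + c" by (simp only: wp_even)
  with c[OF False] show ?thesis by simp
qed

lemma wp_meromorphic: "wp meromorphic_on A"
proof -
  have "wp meromorphic_on {z}" for z
  proof (cases "z \<in> \<Lambda>")
    case False
    thus ?thesis by (intro analytic_on_imp_meromorphic_on wp_analytic)
  next
    case True
    have "filterlim (\<lambda>w. w - z) (at 0) (at z)"
      unfolding filterlim_at by (auto intro!: tendsto_eq_intros simp: eventually_at_filter)
    from eventually_compose_filterlim[OF wp_at_0 this]
    have "eventually (\<lambda>w. wp w = 1 / (w - z)\<^sup>2 + wp0 (w - z)) (at z)"
    proof eventually_elim
      case (elim w)
      thus ?case using wp_periodic[OF True, of "w - z"] by simp
    qed
    moreover have "(\<lambda>w. 1 / (w - z)\<^sup>2 + wp0 (w - z)) meromorphic_on {z}"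
    proof -
      have "(wp0 \<circ> (\<lambda>w. w - z)) analytic_on {z}"
        by (rule analytic_on_compose) (auto intro!: analytic_intros wp0_analytic')
      hence "(\<lambda>w. wp0 (w - z)) meromorphic_on {z}"
        by (intro analytic_on_imp_meromorphic_on) (simp add: o_def)
      thus ?thesis by (auto intro!: meromorphic_intros)
    qed
    ultimately show ?thesis
      using meromorphic_on_cong[of "{z}" wp "\<lambda>w. 1 / (w - z)\<^sup>2 + wp0 (w - z)" "{z}"] by auto
  qed
  thus ?thesis using meromorphic_on_meromorphic_at by blast
qed

lemma wp0_tendsto: "wp0 \<midarrow>0\<rightarrow> wp0 0" "deriv wp0 \<midarrow>0\<rightarrow> deriv wp0 0"
  by (rule isContD[OF analytic_at_imp_isCont[OF wp0_analytic'(2)]])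
     (rule isContD[OF analytic_at_imp_isCont[OF analytic_deriv[OF wp0_analytic'(2)]]])

lemma wp_tendsto_0: "(\<lambda>z. z\<^sup>2 * wp z) \<midarrow>0\<rightarrow> 1"
proof -
  have "(\<lambda>z. 1 + z\<^sup>2 * wp0 z) \<midarrow>0\<rightarrow> 1 + 0\<^sup>2 * wp0 0"
    by (intro tendsto_intros wp0_tendsto)
  moreover have "eventually (\<lambda>z. 1 + z\<^sup>2 * wp0 z = z\<^sup>2 * wp z) (at 0)"
    using wp_at_0 eventually_neq_at_within[of 0] 
    by eventually_elim (simp add: distrib_left)
  ultimately show ?thesis by (simp add: tendsto_cong)
qed

lemma deriv_wp_tendsto_0: "(\<lambda>z. z ^ 3 * deriv wp z) \<midarrow>0\<rightarrow> - 2"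
proof -
  have "(\<lambda>z. - 2 + z ^ 3 * deriv wp0 z) \<midarrow>0\<rightarrow> - 2 + 0 ^ 3 * deriv wp0 0"
    by (intro tendsto_intros wp0_tendsto)
  moreover have "eventually (\<lambda>z. - 2 + z ^ 3 * deriv wp0 z = z ^ 3 * deriv wp z) (at 0)"
    using eventually_not_lattice_at eventually_neq_at_within[of 0] 
    by eventually_elim (simp add: right_diff_distrib deriv_wp)
  ultimately show ?thesis by (simp add: tendsto_cong)
qed

lemma wp_shift_tendsto:
  assumes "\<omega> \<in> \<Lambda>"
  shows "(\<lambda>z. (z - \<omega>)\<^sup>2 * wp z) \<midarrow>\<omega>\<rightarrow> 1"
proof -
  have "(\<lambda>z. (z - \<omega>)\<^sup>2 * wp (z - \<omega>)) \<midarrow>\<omega>\<rightarrow> 1"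
    using LIM_offset[OF wp_tendsto_0, of "-\<omega>"] by simp
  thus ?thesis using wp_periodic[OF lattice_uminus[OF assms]] by simp
qed

text \<open>Otherwise \<wp> would be constant off a sparse set, against its pole at 0.\<close>

lemma wp_ae_neq: "eventually (\<lambda>z. wp z \<noteq> c) (cosparse UNIV)"
proof (rule ccontr)
  assume "\<not> ?thesis"
  hence "eventually (\<lambda>z. wp z = c) (cosparse UNIV)"
    using meromorphic_imp_constant_or_avoid[OF wp_meromorphic, of UNIV c] by auto
  hence "eventually (\<lambda>z. wp z = c) (at 0)"
    by (simp add: eventually_cosparse_open_eq)
  hence "eventually (\<lambda>z. z\<^sup>2 * wp z = z\<^sup>2 * c) (at 0)" by eventually_elim auto
  with wp_tendsto_0 have "(\<lambda>z. z\<^sup>2 * c) \<midarrow>0\<rightarrow> 1" by (rule Lim_transform_eventually)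
  moreover have "(\<lambda>z. z\<^sup>2 * c) \<midarrow>0\<rightarrow> 0\<^sup>2 * c" by (intro tendsto_intros)
  ultimately have "1 = 0\<^sup>2 * c" by (rule LIM_unique)
  thus False by simp
qed

lemma lattice_reduce:
  "\<exists>\<omega>\<in>\<Lambda>. \<exists>x\<in>{0..1}. \<exists>y\<in>{0..1}. z = of_real x + of_real y * \<tau> + \<omega>"
proof -
  define b where "b = Im z / Im \<tau>"
  define a where "a = Re z - b * Re \<tau>"
  have z: "z = of_real a + of_real b * \<tau>"
    using Im_pos by (simp add: complex_eq_iff a_def b_def)
  have "z = of_real (frac a) + of_real (frac b) * \<tau> + (of_int \<lfloor>a\<rfloor> + of_int \<lfloor>b\<rfloor> * \<tau>)"
    unfolding z by (simp add: frac_def algebra_simps)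
  moreover have "of_int \<lfloor>a\<rfloor> + of_int \<lfloor>b\<rfloor> * \<tau> \<in> \<Lambda>" by (rule lattice_memI)
  moreover have "frac a \<in> {0..1}" "frac b \<in> {0..1}" by (auto simp: frac_ge_0 less_imp_le[OF frac_lt_1])
  ultimately show ?thesis by blast
qed

text \<open>Hypothesis and conclusion speak of limits, not of values, because the functions below
  carry arbitrary values at removable singularities. Filling these in gives an entire function that
  takes all its values on a compact period parallelogram, and Liouville's theorem applies.\<close>

lemma elliptic_liouville:
  assumes mero: "f meromorphic_on UNIV"
    and per: "\<And>z \<omega>. \<omega> \<in> \<Lambda> \<Longrightarrow> f (z + \<omega>) = f z"
    and lim: "\<And>z. \<exists>L. f \<midarrow>z\<rightarrow> L"
  shows "\<exists>c. \<forall>z. f \<midarrow>z\<rightarrow> c"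
proof -
  define g where "g = remove_sings f"
  have fg: "f \<midarrow>z\<rightarrow> g z" for z
    using lim[of z] remove_sings_eqI[of f] by (auto simp: g_def)
  have "isolated_singularity_at f z" for z
    using mero by (meson UNIV_I meromorphic_on_isolated_singularity meromorphic_on_subset subset_UNIV)
  hence "g analytic_on {z}" for z
    unfolding g_def using fg remove_sings_analytic_at by blast
  hence holo: "g holomorphic_on UNIV"
    using analytic_on_analytic_at analytic_imp_holomorphic by blast
  have gper: "g (z + \<omega>) = g z" if "\<omega> \<in> \<Lambda>" for z \<omega>
  proof -
    have "(\<lambda>x. f (x + \<omega>)) \<midarrow>z\<rightarrow> g (z + \<omega>)"
      using LIM_offset[OF fg[of "z + \<omega>"], of \<omega>] by simp
    thus ?thesis using per[OF that] LIM_unique[OF fg[of z]] by simp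
  qed
  define K where "K = (\<lambda>(x,y). of_real x + of_real y * \<tau>) ` ({0..1::real} \<times> {0..1::real})"
  have "compact K"
    unfolding K_def by (intro compact_continuous_image compact_Times)
      (auto intro!: continuous_intros simp: case_prod_unfold)
  hence "bounded (g ` K)"
    by (intro compact_imp_bounded compact_continuous_image)
       (use holo holomorphic_on_imp_continuous_on holomorphic_on_subset in auto)
  moreover have "range g \<subseteq> g ` K"
  proof safe
    fix z
    obtain \<omega> x y where *: "\<omega> \<in> \<Lambda>" "x \<in> {0..1}" "y \<in> {0..1}" "z = of_real x + of_real y * \<tau> + \<omega>"
      using lattice_reduce by blast
    hence "g z = g (of_real x + of_real y * \<tau>)" using gper by simp
    moreover have "of_real x + of_real y * \<tau> \<in> K" using * by (force simp: K_def)
    ultimately show "g z \<in> g ` K" by auto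
  qed
  ultimately have "bounded (range g)" by (rule bounded_subset)
  from Liouville_theorem[OF holo this] obtain c where "\<And>z. g z = c" by (auto simp: constant_on_def)
  thus ?thesis using fg by metis
qed

text \<open>Induction on half the pole order. Subtracting \<open>L * wp z ^ Suc n\<close> removes
  the leading term, and evenness then lowers the order by two instead of one. \<open>L\<close> may
  be 0; it is recorded because it becomes the coefficient of index \<open>n\<close>.\<close>

lemma even_elliptic_poly:
  assumes "G meromorphic_on UNIV" "\<And>z. G (-z) = G z" "\<And>z \<omega>. \<omega> \<in> \<Lambda> \<Longrightarrow> G (z + \<omega>) = G z"
    and "\<And>z. z \<notin> \<Lambda> \<Longrightarrow> \<exists>L. G \<midarrow>z\<rightarrow> L" and "(\<lambda>z. z ^ (2 * n) * G z) \<midarrow>0\<rightarrow> L"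
  shows "\<exists>p. degree p \<le> n \<and> coeff p n = L \<and> (\<forall>z. z \<notin> \<Lambda> \<longrightarrow> G \<midarrow>z\<rightarrow> poly p (wp z))"
  using assms
proof (induction n arbitrary: G L)
  case 0
  have "\<exists>L. G \<midarrow>z\<rightarrow> L" for z
  proof (cases "z \<in> \<Lambda>")
    case True
    have "G \<midarrow>0\<rightarrow> L" using "0.prems"(5) by simp
    from LIM_offset[OF this, of "-z"] have "(\<lambda>w. G (w - z)) \<midarrow>z\<rightarrow> L" by simp
    thus ?thesis using "0.prems"(3)[OF lattice_uminus[OF True]] by auto
  qed (use 0 in auto)
  from elliptic_liouville[OF "0.prems"(1,3) this] obtain c where c: "\<And>z. G \<midarrow>z\<rightarrow> c" by blast
  hence "c = L" using "0.prems"(5) LIM_unique[of G c 0 L] by simp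
  thus ?case using c by (intro exI[of _ "[:L:]"]) auto
next
  case (Suc n)
  define H where "H = (\<lambda>z. G z - L * wp z ^ Suc n)"
  have Hm: "H meromorphic_on A" for A
    unfolding H_def by (intro meromorphic_intros wp_meromorphic meromorphic_on_subset[OF Suc.prems(1)]) auto
  have He: "H (-z) = H z" for z by (simp add: H_def Suc.prems)
  define k where "k = (\<lambda>z. z ^ (2 * Suc n) * H z)"
  have "(\<lambda>z. z ^ (2 * Suc n) * G z - L * (z\<^sup>2 * wp z) ^ Suc n) \<midarrow>0\<rightarrow> L - L * 1 ^ Suc n"
    by (intro tendsto_intros Suc.prems(5) wp_tendsto_0)
  moreover have "z ^ (2 * Suc n) * G z - L * (z\<^sup>2 * wp z) ^ Suc n = k z" for z
    unfolding k_def H_def power_mult_distrib power_mult[symmetric] right_diff_distrib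
    by (simp only: mult.left_commute)
  ultimately have k0: "k \<midarrow>0\<rightarrow> 0" by simp
  have km: "k meromorphic_on {0}" unfolding k_def by (intro meromorphic_intros Hm)
  hence iso: "isolated_singularity_at k 0" by (meson insertI1 meromorphic_on_isolated_singularity)
  \<comment> \<open>The analytic extension of \<open>k\<close> is even and vanishes at 0, so it has
    at least a double zero there; \<open>M\<close> below is the leading coefficient for the next
    stage.\<close>
  define g where "g = remove_sings k"
  have ga: "g analytic_on {0}" unfolding g_def by (rule remove_sings_analytic_at[OF iso k0])
  have g0: "g 0 = 0" unfolding g_def by (rule remove_sings_eqI[OF k0])
  have gk: "eventually (\<lambda>z. g z = k z) (at 0)" unfolding g_def by (rule eventually_remove_sings_eq_at[OF iso])
  have "filterlim uminus (at 0) (at (0::complex))"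
    unfolding filterlim_at by (auto intro!: tendsto_eq_intros simp: eventually_at_filter)
  from eventually_compose_filterlim[OF gk this] gk
  have "eventually (\<lambda>z. g (-z) = g z) (at 0)"
    by eventually_elim (simp add: k_def He)
  hence "eventually (\<lambda>z. g (-z) = g z) (nhds 0)"
    by (simp add: eventually_nhds_conv_at)
  from double_zero_limit[OF ga deriv_zero_if_even[OF ga this]]
  obtain M where "(\<lambda>z. g z / z\<^sup>2) \<midarrow>0\<rightarrow> M" by (auto simp: g0)
  moreover have "eventually (\<lambda>z. g z / z\<^sup>2 = z ^ (2 * n) * H z) (at 0)"
    using gk eventually_neq_at_within[of 0] by eventually_elim (auto simp: k_def power2_eq_square)
  ultimately have M: "(\<lambda>z. z ^ (2 * n) * H z) \<midarrow>0\<rightarrow> M" by (simp add: tendsto_cong)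
  have wl: "wp \<midarrow>z\<rightarrow> wp z" if "z \<notin> \<Lambda>" for z
    using wp_analytic[OF that] analytic_at_imp_isCont isContD by blast
  have "\<exists>p. degree p \<le> n \<and> coeff p n = M \<and> (\<forall>z. z \<notin> \<Lambda> \<longrightarrow> H \<midarrow>z\<rightarrow> poly p (wp z))"
  proof (rule Suc.IH[OF Hm He _ _ M])
    show "H (z + \<omega>) = H z" if "\<omega> \<in> \<Lambda>" for z \<omega>
      using that by (simp add: H_def Suc.prems(3) wp_periodic)
    show "\<exists>L. H \<midarrow>z\<rightarrow> L" if z: "z \<notin> \<Lambda>" for z
    proof -
      from Suc.prems(4)[OF z] obtain l where "G \<midarrow>z\<rightarrow> l" by blast
      hence "H \<midarrow>z\<rightarrow> l - L * wp z ^ Suc n"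
        unfolding H_def by (intro tendsto_intros wl z)
      thus ?thesis by blast
    qed
  qed
  then obtain p where p: "degree p \<le> n" "\<And>z. z \<notin> \<Lambda> \<Longrightarrow> H \<midarrow>z\<rightarrow> poly p (wp z)" by blast
  show ?case
  proof (intro exI[of _ "p + monom L (Suc n)"] conjI allI impI)
    show "degree (p + monom L (Suc n)) \<le> Suc n"
      by (rule degree_add_le) (use p degree_monom_le[of L "Suc n"] in auto)
    show "coeff (p + monom L (Suc n)) (Suc n) = L"
      using p(1) by (simp add: coeff_eq_0)
    fix z assume z: "z \<notin> \<Lambda>"
    have "(\<lambda>z. H z + L * wp z ^ Suc n) \<midarrow>z\<rightarrow> poly p (wp z) + L * wp z ^ Suc n"
      by (intro tendsto_intros p(2) z wl)
    thus "G \<midarrow>z\<rightarrow> poly (p + monom L (Suc n)) (wp z)"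
      by (simp add: H_def poly_monom)
  qed
qed

end

section \<open>The differential equation and the fibres of \<open>\<wp>\<close>\<close>

text \<open>If \<open>h\<close> did not vanish identically, \<open>\<kappa>\<close> would be its order of vanishing at \<open>a\<close>. This yields
  uniqueness of solutions of the differential equation of \<open>\<wp>\<close>, at regular points (\<open>\<kappa> = 0\<close>)
  and at the double pole (\<open>\<kappa> = -3\<close>).\<close>

lemma log_derivative_vanish:
  assumes ana: "h analytic_on {a}"
    and ode: "eventually (\<lambda>z. (z - a) * deriv h z = k z * h z) (at a)"
    and k: "k \<midarrow>a\<rightarrow> \<kappa>"
    and \<kappa>: "(\<forall>m::nat. \<kappa> \<noteq> of_nat m) \<or> h a = 0 \<and> \<kappa> = 0"
  shows "eventually (\<lambda>z. h z = 0) (nhds a)"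
proof (cases "h a = 0")
  case False
  have h: "h \<midarrow>a\<rightarrow> h a" "deriv h \<midarrow>a\<rightarrow> deriv h a"
    by (rule isContD[OF analytic_at_imp_isCont[OF ana]])
       (rule isContD[OF analytic_at_imp_isCont[OF analytic_deriv[OF ana]]])
  have "(\<lambda>z. (z - a) * deriv h z) \<midarrow>a\<rightarrow> (a - a) * deriv h a"
    by (intro tendsto_intros h)
  moreover have "(\<lambda>z. k z * h z) \<midarrow>a\<rightarrow> \<kappa> * h a"
    by (intro tendsto_intros h k)
  ultimately have "\<kappa> * h a = 0"
    using ode tendsto_cong[OF ode] LIM_unique by fastforce
  \<comment> \<open>Now \<open>\<kappa> = 0\<close>, which the first alternative excludes at
    \<open>m = 0\<close> and the second by \<open>h a = 0\<close>.\<close>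
  thus ?thesis using \<kappa> False by (metis mult_eq_0_iff of_nat_0)
next
  case True
  obtain r where r: "r > 0" "h holomorphic_on ball a r"
    using ana by (auto simp: analytic_at_ball)
  show ?thesis
  proof (cases "h constant_on ball a r")
    case True
    hence "h z = 0" if "z \<in> ball a r" for z
      using \<open>h a = 0\<close> that r(1) by (metis centre_in_ball constant_on_def)
    moreover have "eventually (\<lambda>z. z \<in> ball a r) (nhds a)"
      using r(1) by (intro eventually_nhds_in_open) auto
    ultimately show ?thesis by (auto elim: eventually_mono)
  next
    case False
    obtain g s n where g: "0 < n" "0 < s" "g holomorphic_on ball a s"
       "\<And>w. w \<in> ball a s \<Longrightarrow> h w = (w - a) ^ n * g w" "\<And>w. w \<in> ball a s \<Longrightarrow> g w \<noteq> 0"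
      using holomorphic_factor_zero_nonconstant[OF r(2) _ _ _ True False] r(1)
      by (metis centre_in_ball connected_ball open_ball)
    have gan: "g analytic_on {a}" using g(2,3) by (auto simp: analytic_at_ball)
    have gl: "g \<midarrow>a\<rightarrow> g a" "deriv g \<midarrow>a\<rightarrow> deriv g a"
      by (rule isContD[OF analytic_at_imp_isCont[OF gan]])
         (rule isContD[OF analytic_at_imp_isCont[OF analytic_deriv[OF gan]]])
    have ga: "g a \<noteq> 0" using g by auto
    have "eventually (\<lambda>z. z \<in> ball a s - {a}) (at a)"
      using g(2) by (intro eventually_at_in_open) auto
    \<comment> \<open>Inserting \<open>h z = (z - a) ^ n * g z\<close> and cancelling exhibits
      \<open>k\<close> as \<open>n\<close> plus a term tending to 0, so \<kappa> is the positive
      order of the zero.\<close>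
    with ode have "eventually (\<lambda>z. of_nat n + (z - a) * deriv g z / g z = k z) (at a)"
    proof eventually_elim
      case (elim z)
      hence z: "z \<in> ball a s" "z \<noteq> a" by auto
      have dg: "(g has_field_derivative deriv g z) (at z)"
        using g(3) z by (intro holomorphic_derivI[of _ "ball a s"]) auto
      have "((\<lambda>w. (w - a) ^ n * g w) has_field_derivative
               (of_nat n * (z - a) ^ (n - 1)) * g z + (z - a) ^ n * deriv g z) (at z)"
        by (auto intro!: derivative_eq_intros dg)
      moreover have hev: "eventually (\<lambda>w. h w = (w - a) ^ n * g w) (nhds z)"
        using eventually_nhds_in_open[of "ball a s" z] z g(4) by (auto elim: eventually_mono)
      ultimately have "(h has_field_derivative
               (of_nat n * (z - a) ^ (n - 1)) * g z + (z - a) ^ n * deriv g z) (at z)"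
        using DERIV_cong_ev[OF refl hev refl] by blast
      hence dh: "deriv h z = (of_nat n * (z - a) ^ (n - 1)) * g z + (z - a) ^ n * deriv g z"
        by (rule DERIV_imp_deriv)
      obtain m where "n = Suc m" using g(1) by (cases n) auto
      hence "(z - a) * deriv h z = (z - a) ^ n * (of_nat n * g z + (z - a) * deriv g z)"
        unfolding dh by (simp add: algebra_simps)
      hence "(z - a) ^ n * (of_nat n * g z + (z - a) * deriv g z) = (z - a) ^ n * (k z * g z)"
        using elim(1) g(4)[OF z(1)] by (simp add: mult_ac)
      hence "of_nat n * g z + (z - a) * deriv g z = k z * g z" using z by simp
      thus ?case using g(5)[OF z(1)] by (simp add: field_simps)
    qed
    moreover have "(\<lambda>z. of_nat n + (z - a) * deriv g z / g z) \<midarrow>a\<rightarrow> of_nat n + (a - a) * deriv g a / g a"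
      by (intro tendsto_intros gl ga)
    ultimately have "k \<midarrow>a\<rightarrow> of_nat n" by (simp add: tendsto_cong)
    hence "\<kappa> = of_nat n" using k LIM_unique by blast
    thus ?thesis using \<kappa> g(1) by auto
  qed
qed

text \<open>\<open>s\<close> and \<open>q\<close> are the first two elementary symmetric functions
  of \<open>E\<close>. The factor \<open>x - y\<close> makes the difference of two solutions of the
  differential equation of \<wp> satisfy a linear equation, as \<open>log_derivative_vanish\<close>
  requires.\<close>

lemma cubic_diff_factor:
  assumes "card (E :: complex set) = 3"
  obtains s q where
    "\<And>x y. 4 * (\<Prod>e\<in>E. x - e) - 4 * (\<Prod>e\<in>E. y - e) = (x - y) * (4 * (x\<^sup>2 + x * y + y\<^sup>2 - s * (x + y) + q))"
proof -
  obtain e1 e2 e3 where E: "E = {e1,e2,e3}" "e1 \<noteq> e2" "e1 \<noteq> e3" "e2 \<noteq> e3"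
    using assms by (auto simp: card_3_iff)
  show ?thesis
  proof (rule that[of "e1 + e2 + e3" "e1 * e2 + e1 * e3 + e2 * e3"])
    fix x y show "4 * (\<Prod>e\<in>E. x - e) - 4 * (\<Prod>e\<in>E. y - e) = (x - y) * (4 * (x\<^sup>2 + x * y + y\<^sup>2 - (e1 + e2 + e3) * (x + y) + (e1 * e2 + e1 * e3 + e2 * e3)))"
      using E by (simp add: power2_eq_square algebra_simps)
  qed
qed

section \<open>Surjectivity and half periods\<close>

context half_plane
begin

lemma wp_tendsto: "z \<notin> \<Lambda> \<Longrightarrow> wp \<midarrow>z\<rightarrow> wp z"
  by (rule isContD[OF analytic_at_imp_isCont[OF wp_analytic]])

lemma deriv_wp_tendsto: "z \<notin> \<Lambda> \<Longrightarrow> deriv wp \<midarrow>z\<rightarrow> deriv wp z"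
  by (rule isContD[OF analytic_at_imp_isCont[OF analytic_deriv[OF wp_analytic]]])

text \<open>If \<open>c\<close> were omitted, \<open>1 / (wp z - c)\<close> would be elliptic
  without poles, hence constant; but it tends to 0 at lattice points and not at
  \<open>1 / 2\<close>.\<close>

lemma wp_surj: "\<exists>z. z \<notin> \<Lambda> \<and> wp z = c"
proof (rule ccontr)
  assume *: "\<not> ?thesis"
  define f where "f = (\<lambda>z. 1 / (wp z - c))"
  have lim: "f \<midarrow>z\<rightarrow> (if z \<in> \<Lambda> then 0 else 1 / (wp z - c))" for z
  proof (cases "z \<in> \<Lambda>")
    case True
    have "(\<lambda>w. (w - z)\<^sup>2 / ((w - z)\<^sup>2 * wp w - (w - z)\<^sup>2 * c)) \<midarrow>z\<rightarrow> (z - z)\<^sup>2 / (1 - (z - z)\<^sup>2 * c)"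
      by (intro tendsto_intros wp_shift_tendsto True) auto
    moreover have "eventually (\<lambda>w. (w - z)\<^sup>2 / ((w - z)\<^sup>2 * wp w - (w - z)\<^sup>2 * c) = f w) (at z)"
      by (auto simp: eventually_at_filter f_def simp flip: right_diff_distrib)
    ultimately show ?thesis using True by (simp add: tendsto_cong)
  next
    case False
    hence "f \<midarrow>z\<rightarrow> 1 / (wp z - c)"
      unfolding f_def using * by (intro tendsto_intros wp_tendsto) auto
    thus ?thesis using False by simp
  qed
  have "f meromorphic_on UNIV" unfolding f_def by (intro meromorphic_intros wp_meromorphic)
  then obtain d where d: "\<And>z. f \<midarrow>z\<rightarrow> d"
    using elliptic_liouville[of f] lim by (auto simp: f_def wp_periodic)
  have "d = 0" using LIM_unique[OF d lim[of 0]] by simp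
  moreover have "d = 1 / (wp (1/2) - c)" using LIM_unique[OF d lim[of "1/2"]] lattice_half_1 by simp
  ultimately show False using * lattice_half_1 by auto
qed

lemma half_period_shift:
  assumes "2 * h \<in> \<Lambda>"
  shows "wp (h - z) = wp (h + z)"
proof -
  have "wp (h - z) = wp (z - h)" using wp_even[of "h - z"] by simp
  also have "\<dots> = wp (z - h + 2 * h)" by (rule wp_periodic[OF assms, symmetric])
  also have "z - h + 2 * h = h + z" by simp
  finally show ?thesis .
qed

lemma wp_shift_analytic:
  assumes "h \<notin> \<Lambda>"
  shows "(\<lambda>z. wp (z + h)) analytic_on {0}"
proof -
  have "(wp \<circ> (\<lambda>z. z + h)) analytic_on {0}"
    by (rule analytic_on_compose) (use assms in \<open>auto intro!: analytic_intros wp_analytic\<close>)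
  thus ?thesis by (simp add: o_def)
qed

lemma deriv_wp_shift: "deriv (\<lambda>z. wp (z + h)) x = deriv wp (x + h)"
  unfolding deriv_def by (simp add: DERIV_shift)

lemma half_period_deriv:
  assumes "2 * h \<in> \<Lambda>" "h \<notin> \<Lambda>"
  shows "deriv (\<lambda>z. wp (z + h)) 0 = 0"
  by (rule deriv_zero_if_even[OF wp_shift_analytic])
     (use half_period_shift[OF assms(1)] in \<open>auto simp: assms add.commute\<close>)

text \<open>At 0 the shifted factor has a double zero that cancels the double pole of the other;
  translation by \<open>h\<close> exchanges the factors, so the points congruent to \<open>h\<close>
  behave alike. By Liouville the product is constant, and a generic point shows that it is not
  0.\<close>

lemma half_period_product:
  assumes "2 * h \<in> \<Lambda>" "h \<notin> \<Lambda>"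
  shows "\<exists>C. C \<noteq> 0 \<and> (\<forall>z. z \<notin> \<Lambda> \<longrightarrow> z + h \<notin> \<Lambda> \<longrightarrow> (wp (z + h) - wp h) * (wp z - wp h) = C)"
proof -
  define f where "f = (\<lambda>z. (wp (z + h) - wp h) * (wp z - wp h))"
  obtain L where "(\<lambda>z. (wp (z + h) - wp h) / z\<^sup>2) \<midarrow>0\<rightarrow> L"
    using double_zero_limit[OF wp_shift_analytic[OF assms(2)] half_period_deriv[OF assms]] by auto
  moreover have "(\<lambda>z. z\<^sup>2 * wp z - z\<^sup>2 * wp h) \<midarrow>0\<rightarrow> 1 - 0\<^sup>2 * wp h"
    by (intro tendsto_intros wp_tendsto_0)
  ultimately have "(\<lambda>z. (wp (z + h) - wp h) / z\<^sup>2 * (z\<^sup>2 * wp z - z\<^sup>2 * wp h)) \<midarrow>0\<rightarrow> L * (1 - 0\<^sup>2 * wp h)"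
    by (rule tendsto_mult)
  moreover have "eventually (\<lambda>z. (wp (z + h) - wp h) / z\<^sup>2 * (z\<^sup>2 * wp z - z\<^sup>2 * wp h) = f z) (at 0)"
    by (auto simp: eventually_at_filter f_def simp flip: right_diff_distrib)
  ultimately have f0: "f \<midarrow>0\<rightarrow> L" by (simp add: tendsto_cong)
  have fp: "f (z + \<omega>) = f z" if "\<omega> \<in> \<Lambda>" for z \<omega>
    using wp_periodic[OF that, of "z + h"] wp_periodic[OF that, of z] by (simp add: f_def add_ac)
  have fh: "f (z + h) = f z" for z
    using wp_periodic[OF assms(1), of z] by (simp add: f_def add_ac mult.commute)
  have fL: "f \<midarrow>z\<rightarrow> L" if "z \<in> \<Lambda>" for z
    using LIM_offset[OF f0, of "-z"] fp[OF lattice_uminus[OF that]] by simp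
  have fcont: "f \<midarrow>z\<rightarrow> f z" if "z \<notin> \<Lambda>" "z + h \<notin> \<Lambda>" for z
    unfolding f_def
    using LIM_offset[OF wp_tendsto[OF that(2)], of h] by (intro tendsto_intros wp_tendsto that) simp
  have "\<exists>L. f \<midarrow>z\<rightarrow> L" for z
  proof (cases "z \<in> \<Lambda>")
    case False
    show ?thesis
    proof (cases "z + h \<in> \<Lambda>")
      case True
      thus ?thesis using LIM_offset[OF fL[OF True], of h] by (auto simp: fh)
    qed (use fcont False in blast)
  qed (use fL in blast)
  moreover have "f meromorphic_on UNIV"
  proof -
    have "(\<lambda>z. wp (z + h)) meromorphic_on UNIV"
      by (rule meromorphic_on_compose[OF wp_meromorphic[of UNIV]]) (auto intro!: analytic_intros)
    thus ?thesis unfolding f_def by (intro meromorphic_intros wp_meromorphic)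
  qed
  ultimately obtain C where C: "\<And>z. f \<midarrow>z\<rightarrow> C"
    using elliptic_liouville[of f] fp by blast
  have C2: "f z = C" if "z \<notin> \<Lambda>" "z + h \<notin> \<Lambda>" for z
    using LIM_unique[OF C fcont[OF that]] by simp
  have ev: "eventually (\<lambda>z. (wp (1 * z + h) \<noteq> wp h \<and> 1 * z + h \<notin> \<Lambda>) \<and> wp z \<noteq> wp h \<and> z \<notin> \<Lambda>) (cosparse UNIV)"
    by (intro eventually_conj ae_affine wp_ae_neq ae_not_lattice) 
       (use ae_affine[OF wp_ae_neq, of 1] ae_affine[OF ae_not_lattice, of 1] in auto)
  then obtain z where "wp (z + h) \<noteq> wp h" "z + h \<notin> \<Lambda>" "wp z \<noteq> wp h" "z \<notin> \<Lambda>"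
    using ae_imp_ex[OF ev] by auto
  with C2[of z] have "C \<noteq> 0" by (auto simp: f_def)
  thus ?thesis using C2 by (auto simp: f_def)
qed

text \<open>If neither argument were a lattice point, the nonzero product above would contain the
  factor \<open>wp z - wp h = 0\<close>.\<close>

lemma half_period_inj:
  assumes "2 * h \<in> \<Lambda>" "h \<notin> \<Lambda>" "z \<notin> \<Lambda>" "wp z = wp h"
  shows "z + h \<in> \<Lambda>"
  using half_period_product[OF assms(1,2)] assms(3,4) by fastforce

text \<open>With \<open>e = wp h\<close>, the product identity reads \<wp>(z + h) = e + C /
  (\<wp>(z) - e), a Moebius transformation of determinant \<open>- C\<close>. It serves to move a
  half point to infinity.\<close>

lemma half_period_translation:
  assumes "2 * h \<in> \<Lambda>"
  shows "\<exists>\<mu>\<in>mobius_transformations. \<forall>z. weierstrass_p \<tau> (z + h) = \<mu> (weierstrass_p \<tau> z)"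
proof (cases "h \<in> \<Lambda>")
  case True
  have "mobius_map 1 0 0 1 \<in> mobius_transformations"
    unfolding mobius_transformations_def by (force intro!: exI)
  moreover have "weierstrass_p \<tau> (z + h) = mobius_map 1 0 0 1 (weierstrass_p \<tau> z)" for z
    using True by (simp add: weierstrass_p_eq mobius_map_def wp_periodic lattice_add_iff)
  ultimately show ?thesis by blast
next
  case False
  obtain C where C: "C \<noteq> 0" "\<And>z. z \<notin> \<Lambda> \<Longrightarrow> z + h \<notin> \<Lambda> \<Longrightarrow> (wp (z + h) - wp h) * (wp z - wp h) = C"
    using half_period_product[OF assms False] by blast
  define e where "e = wp h"
  have "mobius_map e (C - e\<^sup>2) 1 (-e) \<in> mobius_transformations"
    unfolding mobius_transformations_def using C(1) by (force intro!: exI simp: power2_eq_square)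
  moreover have "weierstrass_p \<tau> (z + h) = mobius_map e (C - e\<^sup>2) 1 (-e) (weierstrass_p \<tau> z)" for z
  proof -
    consider "z \<in> \<Lambda>" | "z \<notin> \<Lambda>" "z + h \<in> \<Lambda>" | "z \<notin> \<Lambda>" "z + h \<notin> \<Lambda>" by blast
    thus ?thesis
    proof cases
      case 1
      hence "z + h \<notin> \<Lambda>" "wp (z + h) = e"
        using False lattice_add_iff[of z h] wp_periodic[of z h] by (auto simp: add.commute e_def)
      thus ?thesis using 1 by (simp add: weierstrass_p_eq mobius_map_def)
    next
      case 2
      have "wp z = wp (- z + (z + h))" using wp_periodic[OF 2(2), of "-z"] by simp
      hence "wp z = e" by (simp add: e_def)
      thus ?thesis using 2 by (simp add: weierstrass_p_eq mobius_map_def)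
    next
      case 3
      have *: "(wp (z + h) - e) * (wp z - e) = C" using C(2)[OF 3] by (simp add: e_def)
      hence "wp z - e \<noteq> 0" using C(1) by auto
      moreover have "wp (z + h) * (wp z - e) = e * wp z + (C - e\<^sup>2)"
        using * by (simp add: algebra_simps power2_eq_square)
      ultimately have "wp (z + h) = (e * wp z + (C - e\<^sup>2)) / (wp z - e)" by (simp add: eq_divide_eq)
      thus ?thesis using 3 \<open>wp z - e \<noteq> 0\<close> by (simp add: weierstrass_p_eq mobius_map_def)
    qed
  qed
  ultimately show ?thesis by blast
qed

text \<open>The classical e1, e2, e3; lattice points are left out since their value is
  infinity.\<close>

definition half_values :: "complex set" where
  "half_values = wp ` {h. 2 * h \<in> \<Lambda> \<and> h \<notin> \<Lambda>}"

section \<open>The cubic differential equation and injectivity up to sign\<close>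

lemma deriv_wp_even:
  assumes "z \<notin> \<Lambda>"
  shows "deriv wp (-z) = - deriv wp z"
proof -
  have "((\<lambda>x. wp (-x)) has_field_derivative - deriv wp (-z)) (at z)"
    using DERIV_chain'[of uminus "-1" z UNIV wp "deriv wp (-z)"] wp_has_deriv[of "-z"] assms
    by (simp add: DERIV_minus[OF DERIV_ident])
  hence "(wp has_field_derivative - deriv wp (-z)) (at z)" by simp
  from DERIV_unique[OF this wp_has_deriv[OF assms]] show ?thesis by (metis minus_minus)
qed

text \<open>The squared derivative is even with poles of order 6, hence a cubic in \<wp>; the limit
  \<open>- 2\<close> of \<open>z ^ 3 * deriv wp z\<close> gives the coefficient 4.\<close>

lemma wp_ode_aux:
  "\<exists>p. degree p \<le> 3 \<and> coeff p 3 = 4 \<and> (\<forall>z. z \<notin> \<Lambda> \<longrightarrow> (deriv wp z)\<^sup>2 = poly p (wp z))"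
proof -
  define G where "G = (\<lambda>z. if z \<in> \<Lambda> then 0 else (deriv wp z)\<^sup>2)"
  have ev: "eventually (\<lambda>z. G z = (deriv wp z)\<^sup>2) (at x)" for x
    using eventually_not_lattice_at[of x] by eventually_elim (auto simp: G_def)
  have "(\<lambda>z. (deriv wp z)\<^sup>2) meromorphic_on UNIV"
    by (intro meromorphic_intros wp_meromorphic)
  hence m: "G meromorphic_on UNIV"
    using meromorphic_on_cong[of UNIV G "\<lambda>z. (deriv wp z)\<^sup>2" UNIV] ev by auto
  have lim: "G \<midarrow>z\<rightarrow> (deriv wp z)\<^sup>2" if "z \<notin> \<Lambda>" for z
    using tendsto_power[OF deriv_wp_tendsto[OF that], of 2] tendsto_cong[OF ev] by blast
  have "(\<lambda>z. (z ^ 3 * deriv wp z)\<^sup>2) \<midarrow>0\<rightarrow> (-2)\<^sup>2"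
    by (intro tendsto_power deriv_wp_tendsto_0)
  moreover have "eventually (\<lambda>z. (z ^ 3 * deriv wp z)\<^sup>2 = z ^ (2 * 3) * G z) (at 0)"
    using ev[of 0] by eventually_elim (simp add: power_mult_distrib)
  ultimately have "(\<lambda>z. z ^ (2 * 3) * G z) \<midarrow>0\<rightarrow> 4" by (simp add: tendsto_cong)
  from even_elliptic_poly[OF m _ _ _ this] obtain p where
    p: "degree p \<le> 3" "coeff p 3 = 4" "\<And>z. z \<notin> \<Lambda> \<Longrightarrow> G \<midarrow>z\<rightarrow> poly p (wp z)"
    using lim by (fastforce simp: G_def deriv_wp_even deriv_wp_periodic lattice_add_iff)
  have "(deriv wp z)\<^sup>2 = poly p (wp z)" if "z \<notin> \<Lambda>" for z
    using LIM_unique[OF lim[OF that] p(3)[OF that]] .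
  thus ?thesis using p by blast
qed

text \<open>The two facts are linked: the derivative vanishes at half periods, so the half values
  are roots of the cubic and there are at most three of them; three distinct ones then determine the
  cubic.\<close>

lemma card_half_values: "card half_values = 3"
  and wp_ode: "z \<notin> \<Lambda> \<Longrightarrow> (deriv wp z)\<^sup>2 = 4 * (\<Prod>e\<in>half_values. wp z - e)"
proof -
  obtain p where p: "degree p \<le> 3" "coeff p 3 = 4" "\<And>z. z \<notin> \<Lambda> \<Longrightarrow> (deriv wp z)\<^sup>2 = poly p (wp z)"
    using wp_ode_aux by blast
  have "p \<noteq> 0" using p(2) by auto
  have roots: "half_values \<subseteq> {x. poly p x = 0}"
    unfolding half_values_def
  proof safe
    fix h assume h: "2 * h \<in> \<Lambda>" "h \<notin> \<Lambda>"
    have "deriv wp h = 0" using half_period_deriv[OF h] deriv_wp_shift[of h 0] by simp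
    thus "poly p (wp h) = 0" using p(3)[OF h(2)] by simp
  qed
  have fin: "finite {x. poly p x = 0}" using \<open>p \<noteq> 0\<close> by (rule poly_roots_finite)
  have le: "card {x. poly p x = 0} \<le> 3"
    using card_poly_roots_bound[OF \<open>p \<noteq> 0\<close>] p(1) by linarith
  \<comment> \<open>Equal values would put the sum of the two half periods into the lattice.\<close>
  have a: "wp (1/2) \<noteq> wp (\<tau>/2)"
    using half_period_inj[of "\<tau>/2" "1/2"] lattice_half_1 lattice_half_tau lattice_half_1_tau
    by (auto simp: add_divide_distrib)
  have b: "wp (1/2) \<noteq> wp ((1+\<tau>)/2)"
    using half_period_inj[of "1/2" "(1+\<tau>)/2"] lattice_half_1 lattice_half_tau lattice_half_1_tau
     lattice_add_iff[of 1 "\<tau>/2"] by (auto simp: add_divide_distrib add.commute)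
  have c: "wp (\<tau>/2) \<noteq> wp ((1+\<tau>)/2)"
    using half_period_inj[of "\<tau>/2" "(1+\<tau>)/2"] lattice_half_1 lattice_half_tau lattice_half_1_tau
     lattice_add_iff[of \<tau> "1/2"] by (auto simp: add_divide_distrib add.commute)
  have "{wp (1/2), wp (\<tau>/2), wp ((1+\<tau>)/2)} \<subseteq> half_values"
    using lattice_half_1 lattice_half_tau lattice_half_1_tau lattice_add[of 1 \<tau>]
    by (auto simp: half_values_def add_divide_distrib distrib_left intro!: imageI)
  hence "card {wp (1/2), wp (\<tau>/2), wp ((1+\<tau>)/2)} \<le> card half_values"
    using finite_subset[OF roots fin] by (intro card_mono) auto
  hence "card half_values \<ge> 3" using a b c by simp
  thus card: "card half_values = 3" using card_mono[OF fin roots] le by linarith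
  define q where "q = smult 4 (\<Prod>e\<in>half_values. [:-e, 1:])"
  have deg: "degree (\<Prod>e\<in>half_values. [:-e, 1:]) = 3"
    using card by (subst degree_prod_eq_sum_degree) auto
  have lc: "lead_coeff (\<Prod>e\<in>half_values. [:-e, 1:]) = 1"
    by (simp add: lead_coeff_prod)
  have "p = q"
  proof (rule poly_eqI_degree_lead_coeff[of _ 3 _ half_values])
    show "coeff p 3 = coeff q 3" using p(2) deg lc by (simp add: q_def)
    show "poly p z = poly q z" if "z \<in> half_values" for z
    proof -
      have "(\<Prod>e\<in>half_values. z - e) = 0"
        using that finite_subset[OF roots fin] by (auto intro!: prod_zero)
      thus ?thesis using that roots by (auto simp: q_def poly_prod)
    qed
  qed (use p(1) deg card in \<open>auto simp: q_def\<close>)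
  thus "(deriv wp z)\<^sup>2 = 4 * (\<Prod>e\<in>half_values. wp z - e)" if "z \<notin> \<Lambda>"
    using p(3)[OF that] by (simp add: q_def poly_prod)
qed

text \<open>Unless \<open>a\<close> is a lattice point, the shifted function has a finite limit at
  0, whereas \<wp> has a pole there.\<close>

lemma wp_ae_period:
  assumes "eventually (\<lambda>s. wp (s + a) = wp s) (cosparse UNIV)"
  shows "a \<in> \<Lambda>"
proof (rule ccontr)
  assume a: "a \<notin> \<Lambda>"
  have "(\<lambda>s. wp (s + a)) \<midarrow>0\<rightarrow> wp a"
    using LIM_offset[OF wp_tendsto[OF a], of a] by simp
  hence "(\<lambda>s. s\<^sup>2 * wp (s + a)) \<midarrow>0\<rightarrow> 0\<^sup>2 * wp a" by (intro tendsto_intros)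
  moreover have "eventually (\<lambda>s. wp (s + a) = wp s) (at 0)"
    using assms by (simp add: eventually_cosparse_open_eq)
  hence "eventually (\<lambda>s. s\<^sup>2 * wp (s + a) = s\<^sup>2 * wp s) (at 0)" by eventually_elim simp
  ultimately have "(\<lambda>s. s\<^sup>2 * wp s) \<midarrow>0\<rightarrow> 0\<^sup>2 * wp a" by (rule Lim_transform_eventually)
  from LIM_unique[OF this wp_tendsto_0] show False by simp
qed

text \<open>Uniqueness for the differential equation at a regular point: both shifts have the same
  value and the same nonzero slope at 0. Subtracting the two equations gives a linear equation for
  \<open>h\<close>, where the nonzero slope allows division; then \<open>z - w\<close> is a
  period.\<close>

lemma wp_inj_aux:
  assumes z: "z \<notin> \<Lambda>" "w \<notin> \<Lambda>" and eq: "wp z = wp w" and d: "deriv wp z = deriv wp w" "deriv wp z \<noteq> 0"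
  shows "z - w \<in> \<Lambda>"
proof -
  define F where "F = (\<lambda>t. wp (t + z))"
  define G where "G = (\<lambda>t. wp (t + w))"
  define h where "h = (\<lambda>t. F t - G t)"
  obtain s q where sq: "\<And>x y. 4 * (\<Prod>e\<in>half_values. x - e) - 4 * (\<Prod>e\<in>half_values. y - e) 
      = (x - y) * (4 * (x\<^sup>2 + x * y + y\<^sup>2 - s * (x + y) + q))"
    using cubic_diff_factor[OF card_half_values] by metis
  define Q where "Q = (\<lambda>x y. 4 * (x\<^sup>2 + x * y + y\<^sup>2 - s * (x + y) + q))"
  define k where "k = (\<lambda>t. t * Q (F t) (G t) / (deriv wp (t + z) + deriv wp (t + w)))"
  have an: "F analytic_on {0}" "G analytic_on {0}"
    unfolding F_def G_def by (intro wp_shift_analytic z)+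
  have lims: "F \<midarrow>0\<rightarrow> wp z" "G \<midarrow>0\<rightarrow> wp w" 
     "(\<lambda>t. deriv wp (t + z)) \<midarrow>0\<rightarrow> deriv wp z" "(\<lambda>t. deriv wp (t + w)) \<midarrow>0\<rightarrow> deriv wp w"
    unfolding F_def G_def
    using LIM_offset[OF wp_tendsto[OF z(1)], of z] LIM_offset[OF wp_tendsto[OF z(2)], of w]
      LIM_offset[OF deriv_wp_tendsto[OF z(1)], of z] LIM_offset[OF deriv_wp_tendsto[OF z(2)], of w] by auto
  have sumlim: "(\<lambda>t. deriv wp (t + z) + deriv wp (t + w)) \<midarrow>0\<rightarrow> 2 * deriv wp z"
    using tendsto_add[OF lims(3,4)] d(1) by simp
  have k0: "k \<midarrow>0\<rightarrow> 0 * Q (wp z) (wp w) / (2 * deriv wp z)"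
    unfolding k_def Q_def by (intro tendsto_intros lims sumlim) (use d in auto)
  have sn: "eventually (\<lambda>t. deriv wp (t + z) + deriv wp (t + w) \<noteq> 0) (at 0)"
    by (rule tendsto_imp_eventually_ne[OF sumlim]) (use d in auto)
  have e: "eventually (\<lambda>t. t + x \<notin> \<Lambda>) (at 0)" if "x \<notin> \<Lambda>" for x
    using ae_affine[OF ae_not_lattice, of 1 x] by (simp add: eventually_cosparse_open_eq add.commute)
  have "eventually (\<lambda>t. (t - 0) * deriv h t = k t * h t) (at 0)"
    using sn e[OF z(1)] e[OF z(2)]
  proof eventually_elim
    case (elim t)
    have "(F has_field_derivative deriv wp (t + z)) (at t)" "(G has_field_derivative deriv wp (t + w)) (at t)"
      unfolding F_def G_def using wp_has_deriv elim DERIV_shift by blast+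
    from DERIV_imp_deriv[OF DERIV_diff[OF this]] have dh: "deriv h t = deriv wp (t + z) - deriv wp (t + w)"
      by (simp add: h_def)
    have "deriv h t * (deriv wp (t + z) + deriv wp (t + w)) = (deriv wp (t + z))\<^sup>2 - (deriv wp (t + w))\<^sup>2"
      by (simp add: dh power2_eq_square algebra_simps)
    also have "\<dots> = h t * Q (F t) (G t)"
      using elim by (simp add: wp_ode sq Q_def h_def F_def G_def)
    finally show ?case using elim(1) by (simp add: k_def eq_divide_eq mult_ac)
  qed
  moreover have "h analytic_on {0}" unfolding h_def by (intro analytic_intros an)
  moreover have "(\<forall>m::nat. 0 * Q (wp z) (wp w) / (2 * deriv wp z) \<noteq> of_nat m) \<or>
      h 0 = 0 \<and> 0 * Q (wp z) (wp w) / (2 * deriv wp z) = 0"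
    using eq by (simp add: h_def F_def G_def)
  ultimately have "eventually (\<lambda>t. h t = 0) (nhds 0)"
    using log_derivative_vanish[OF _ _ k0] by blast
  hence "eventually (\<lambda>t. h t = 0) (at 0)" by (simp add: eventually_nhds_conv_at)
  hence "frequently (\<lambda>t. F t = G t) (at 0)" by (intro eventually_frequently) (auto simp: h_def elim: eventually_mono)
  hence "frequently (\<lambda>t. F t = G t) (cosparse UNIV)"
    by (auto simp: frequently_def eventually_cosparse_open_eq)
  moreover have "F meromorphic_on UNIV" "G meromorphic_on UNIV"
    unfolding F_def G_def
    by (rule meromorphic_on_compose[OF wp_meromorphic[of UNIV]]; auto intro!: analytic_intros)+
  ultimately have "eventually (\<lambda>t. F t = G t) (cosparse UNIV)" using meromorphic_identity by blast
  from ae_affine[OF this, of 1 "-w"] have "eventually (\<lambda>t. wp (t + (z - w)) = wp t) (cosparse UNIV)"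
    by (simp add: F_def G_def algebra_simps)
  thus ?thesis by (rule wp_ae_period)
qed

text \<open>By the differential equation a zero of the derivative takes a half value, and
  \<open>half_period_inj\<close> then makes it a half period.\<close>

lemma deriv_wp_nonzero:
  assumes "2 * z \<notin> \<Lambda>"
  shows "deriv wp z \<noteq> 0"
proof
  assume "deriv wp z = 0"
  have z: "z \<notin> \<Lambda>" using assms lattice_add[of z z] by auto
  have "finite half_values" by (rule card_ge_0_finite) (simp add: card_half_values)
  with wp_ode[OF z] \<open>deriv wp z = 0\<close> obtain h where h: "2 * h \<in> \<Lambda>" "h \<notin> \<Lambda>" "wp z = wp h"
    by (auto simp: half_values_def)
  have "z + h \<in> \<Lambda>" using half_period_inj[OF h(1,2) z h(3)] .
  hence "(z + h) + (z + h) - 2 * h \<in> \<Lambda>" using h lattice_add lattice_diff by blast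
  thus False using assms by simp
qed

text \<open>Equal values force equal slopes up to sign, and the sign is absorbed by replacing
  \<open>w\<close> with \<open>- w\<close>. At half periods the slope vanishes, so there the product
  identity decides instead.\<close>

lemma wp_eq_iff:
  assumes z: "z \<notin> \<Lambda>" "w \<notin> \<Lambda>"
  shows "wp z = wp w \<longleftrightarrow> z - w \<in> \<Lambda> \<or> z + w \<in> \<Lambda>"
proof
  assume "z - w \<in> \<Lambda> \<or> z + w \<in> \<Lambda>"
  thus "wp z = wp w"
    using wp_periodic[of "z - w" w] wp_periodic[of "z + w" "-w"] by auto
next
  assume eq: "wp z = wp w"
  consider "2 * z \<in> \<Lambda>" | "2 * w \<in> \<Lambda>" | "2 * z \<notin> \<Lambda>" "2 * w \<notin> \<Lambda>" by blast
  thus "z - w \<in> \<Lambda> \<or> z + w \<in> \<Lambda>"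
  proof cases
    case 1
    thus ?thesis using half_period_inj[of z w] z eq by (simp add: add.commute)
  next
    case 2
    thus ?thesis using half_period_inj[of w z] z eq by simp
  next
    case 3
    have "(deriv wp z)\<^sup>2 = (deriv wp w)\<^sup>2" using eq z by (simp add: wp_ode)
    hence "deriv wp z = deriv wp w \<or> deriv wp z = - deriv wp w" by (simp add: power2_eq_iff)
    thus ?thesis
    proof
      assume "deriv wp z = deriv wp w"
      thus ?thesis using wp_inj_aux[of z w] z eq deriv_wp_nonzero[OF 3(1)] by blast
    next
      assume "deriv wp z = - deriv wp w"
      thus ?thesis using wp_inj_aux[of z "-w"] z eq deriv_wp_nonzero[OF 3(1)] by (simp add: deriv_wp_even)
    qed
  qed
qed

lemma weierstrass_p_eq_iff:
  "weierstrass_p \<tau> z = weierstrass_p \<tau> w \<longleftrightarrow> z - w \<in> \<Lambda> \<or> z + w \<in> \<Lambda>"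
proof -
  have "z - w \<in> \<Lambda> \<Longrightarrow> z \<in> \<Lambda> \<longleftrightarrow> w \<in> \<Lambda>" using lattice_add_iff[of "z - w" w] by simp
  moreover have "z + w \<in> \<Lambda> \<Longrightarrow> z \<in> \<Lambda> \<longleftrightarrow> w \<in> \<Lambda>" using lattice_add_iff[of "z + w" "-w"] by simp
  ultimately show ?thesis using wp_eq_iff[of z w] by (auto simp: weierstrass_p_eq lattice_diff)
qed

lemma weierstrass_p_surj: "\<exists>z. weierstrass_p \<tau> z = x"
proof (cases x)
  case None
  thus ?thesis by (intro exI[of _ 0]) (simp add: weierstrass_p_eq)
next
  case (Some c)
  thus ?thesis using wp_surj[of c] by (auto simp: weierstrass_p_eq)
qed

end

section \<open>Lifting Moebius transformations\<close>

lemma mobius_map_comp: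
  assumes "a' * d' - b' * c' \<noteq> 0"
  shows "mobius_map a b c d \<circ> mobius_map a' b' c' d' =
     mobius_map (a * a' + b * c') (a * b' + b * d') (c * a' + d * c') (c * b' + d * d')"
proof
  fix x
  have frac: "u * (p / q) + v = (u * p + v * q) / q" if "q \<noteq> 0" for u v p q :: complex
    using that by (simp add: add_divide_distrib)
  have frac': "u * p / q + v = (u * p + v * q) / q" if "q \<noteq> 0" for u v p q :: complex
    using that by (simp add: add_divide_distrib)
  show "(mobius_map a b c d \<circ> mobius_map a' b' c' d') x =
     mobius_map (a * a' + b * c') (a * b' + b * d') (c * a' + d * c') (c * b' + d * d') x"
  proof (cases x)
    case None
    thus ?thesis using assms by (cases "c' = 0") (auto simp: mobius_map_def frac')
  next
    case (Some z)
    have num: "(a * a' + b * c') * z + (a * b' + b * d') = a * (a' * z + b') + b * (c' * z + d')"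
     and den: "(c * a' + d * c') * z + (c * b' + d * d') = c * (a' * z + b') + d * (c' * z + d')"
      by (simp_all add: algebra_simps)
    show ?thesis
    proof (cases "c' * z + d' = 0")
      case True
      \<comment> \<open>The determinant forbids a common zero, so the factor
        \<open>a' * z + b'\<close> cancels and leaves the value of the outer map at
        infinity.\<close>
      have "a' * z + b' \<noteq> 0"
      proof
        assume "a' * z + b' = 0"
        hence "b' = - a' * z" "d' = - c' * z" using True by (simp_all add: eq_neg_iff_add_eq_0 add.commute)
        thus False using assms by simp
      qed
      thus ?thesis using True Some by (simp add: mobius_map_def num den)
    next
      case False
      have "c * ((a' * z + b') / (c' * z + d')) + d = (c * (a' * z + b') + d * (c' * z + d')) / (c' * z + d')"
           "a * ((a' * z + b') / (c' * z + d')) + b = (a * (a' * z + b') + b * (c' * z + d')) / (c' * z + d')"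
        by (rule frac[OF False])+
      thus ?thesis using False Some by (simp add: mobius_map_def num den)
    qed
  qed
qed

lemma mobius_scalar: "k \<noteq> 0 \<Longrightarrow> mobius_map k 0 0 k = id"
  by (rule ext) (auto simp: mobius_map_def split: option.splits)

lemma mobius_compI:
  assumes "f \<in> mobius_transformations" "g \<in> mobius_transformations"
  shows "f \<circ> g \<in> mobius_transformations"
proof -
  obtain a b c d a' b' c' d' where fg: "f = mobius_map a b c d" "g = mobius_map a' b' c' d'"
    "a * d - b * c \<noteq> 0" "a' * d' - b' * c' \<noteq> 0"
    using assms by (auto simp: mobius_transformations_def)
  have "(a * a' + b * c') * (c * b' + d * d') - (a * b' + b * d') * (c * a' + d * c') 
      = (a * d - b * c) * (a' * d' - b' * c')" by (simp add: algebra_simps)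
  hence "(a * a' + b * c') * (c * b' + d * d') - (a * b' + b * d') * (c * a' + d * c') \<noteq> 0"
    using fg by simp
  thus ?thesis unfolding fg(1,2) mobius_map_comp[OF fg(4)] mobius_transformations_def by blast
qed

lemma mobius_inverse:
  assumes "f \<in> mobius_transformations"
  shows "\<exists>g\<in>mobius_transformations. g \<circ> f = id \<and> f \<circ> g = id"
proof -
  obtain a b c d where f: "f = mobius_map a b c d" "a * d - b * c \<noteq> 0"
    using assms by (auto simp: mobius_transformations_def)
  have det: "d * a - (-b) * (-c) \<noteq> 0" using f(2) by (simp add: mult.commute)
  \<comment> \<open>The adjugate matrix; its product with the matrix of \<open>f\<close> is the
    determinant times the identity.\<close>
  have "mobius_map d (-b) (-c) a \<circ> f = mobius_map (a * d - b * c) 0 0 (a * d - b * c)"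
       "f \<circ> mobius_map d (-b) (-c) a = mobius_map (a * d - b * c) 0 0 (a * d - b * c)"
    unfolding f(1) mobius_map_comp[OF f(2)] mobius_map_comp[OF det] by (simp_all add: mult.commute)
  moreover have "mobius_map d (-b) (-c) a \<in> mobius_transformations"
    unfolding mobius_transformations_def using det by blast
  ultimately show ?thesis using mobius_scalar[OF f(2)] by auto
qed

lemma mobius_inj: "f \<in> mobius_transformations \<Longrightarrow> inj f"
  using mobius_inverse[of f] by (metis inj_on_id inj_on_imageI2)

lemma mobius_surj:
  assumes "f \<in> mobius_transformations"
  shows "surj f"
proof -
  obtain g where "f \<circ> g = id" using mobius_inverse[OF assms] by blast
  hence "f (g x) = x" for x by (metis comp_apply id_apply)
  thus ?thesis by (rule surjI)
qed

lemma mobius_fixing_infinity: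
  assumes "f \<in> mobius_transformations" "f None = None"
  obtains A B where "A \<noteq> 0" "\<And>x. f (Some x) = Some (A * x + B)"
proof -
  obtain a b c d where f: "f = mobius_map a b c d" "a * d - b * c \<noteq> 0"
    using assms by (auto simp: mobius_transformations_def)
  have c: "c = 0" using assms(2) f(1) by (auto simp: mobius_map_def split: if_splits)
  hence d: "d \<noteq> 0" "a \<noteq> 0" using f(2) by auto
  show ?thesis
    by (rule that[of "a / d" "b / d"]) (use c d in \<open>auto simp: f(1) mobius_map_def add_divide_distrib\<close>)
qed

lemma (in half_plane) weierstrass_p_ae_period:
  assumes "eventually (\<lambda>s. weierstrass_p \<tau> (s + a) = weierstrass_p \<tau> s) (cosparse UNIV)"
  shows "a \<in> \<Lambda>"
proof (rule wp_ae_period)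
  show "eventually (\<lambda>s. wp (s + a) = wp s) (cosparse UNIV)"
    using assms ae_not_lattice by eventually_elim (auto simp: weierstrass_p_eq split: if_splits)
qed

text \<open>\<open>F\<close> and \<open>G\<close> below satisfy the same differential equation and
  have the same principal part at 0. Their difference extends analytically and solves a linear
  equation with \<kappa> = -3, which is no order of vanishing; so it is 0 near 0 and hence off a
  sparse set.\<close>

lemma affine_lift:
  fixes \<tau> \<sigma> A B :: complex
  assumes "half_plane \<tau>" "half_plane \<sigma>" and A: "A \<noteq> 0"
    and E: "(\<lambda>x. A * x + B) ` half_plane.half_values \<tau> = half_plane.half_values \<sigma>"
  shows "\<exists>\<alpha>. \<alpha> \<noteq> 0 \<and> eventually (\<lambda>z. A * half_plane.wp \<tau> z + B = half_plane.wp \<sigma> (\<alpha> * z)) (cosparse UNIV)"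
proof -
  interpret t: half_plane \<tau> by fact
  interpret s: half_plane \<sigma> by fact
  \<comment> \<open>Chosen so that \<open>A / z\<^sup>2\<close> is the principal part of both
    sides.\<close>
  define \<alpha> where "\<alpha> = 1 / csqrt A"
  have \<alpha>: "\<alpha> \<noteq> 0" and \<alpha>2: "\<alpha>\<^sup>2 = 1 / A" "A = 1 / \<alpha>\<^sup>2" using A by (auto simp: \<alpha>_def power_divide)
  define F where "F = (\<lambda>z. A * t.wp z + B)"
  define G where "G = (\<lambda>z. s.wp (\<alpha> * z))"
  define F' where "F' = (\<lambda>z. A * deriv t.wp z)"
  define G' where "G' = (\<lambda>z. \<alpha> * deriv s.wp (\<alpha> * z))"
  \<comment> \<open>The difference of \<open>F\<close> and \<open>G\<close> with the equal principal
    parts left out, which makes it analytic at 0.\<close>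
  define h where "h = (\<lambda>z. A * t.wp0 z + B - s.wp0 (\<alpha> * z))"
  obtain S q where sq: "\<And>x y. 4 * (\<Prod>e\<in>s.half_values. x - e) - 4 * (\<Prod>e\<in>s.half_values. y - e) 
      = (x - y) * (4 * (x\<^sup>2 + x * y + y\<^sup>2 - S * (x + y) + q))"
    using cubic_diff_factor[OF s.card_half_values] by metis
  define Q where "Q = (\<lambda>x y. 4 * (x\<^sup>2 + x * y + y\<^sup>2 - S * (x + y) + q))"
  \<comment> \<open>This is \<open>z * \<alpha>\<^sup>2 * Q / (F' + G')\<close>, expanded by
    \<open>z ^ 3\<close> so that numerator and denominator have finite limits at 0.\<close>
  define k where "k = (\<lambda>z. z ^ 4 * (\<alpha>\<^sup>2 * Q (F z) (G z)) / (z ^ 3 * F' z + z ^ 3 * G' z))"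
  have fl: "filterlim (\<lambda>z. \<alpha> * z) (at 0) (at 0)"
    using filterlim_affine_at[OF \<alpha>, of 0 0] by simp
  have evs: "eventually (\<lambda>z. \<alpha> * z \<notin> s.\<Lambda>) (at 0)"
    using eventually_compose_filterlim[OF s.eventually_not_lattice_at fl] .
  have Fl: "(\<lambda>z. z\<^sup>2 * F z) \<midarrow>0\<rightarrow> A"
  proof -
    have "(\<lambda>z. A * (z\<^sup>2 * t.wp z) + z\<^sup>2 * B) \<midarrow>0\<rightarrow> A * 1 + 0\<^sup>2 * B"
      by (intro tendsto_intros t.wp_tendsto_0)
    thus ?thesis by (simp add: F_def algebra_simps)
  qed
  have Gl: "(\<lambda>z. z\<^sup>2 * G z) \<midarrow>0\<rightarrow> A"
  proof -
    have "(\<lambda>z. A * ((\<alpha> * z)\<^sup>2 * s.wp (\<alpha> * z))) \<midarrow>0\<rightarrow> A * 1"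
      by (intro tendsto_mult tendsto_const filterlim_compose[OF s.wp_tendsto_0 fl])
    moreover have "A * ((\<alpha> * z)\<^sup>2 * s.wp (\<alpha> * z)) = z\<^sup>2 * G z" for z
      using A by (simp add: G_def power_mult_distrib \<alpha>2(1))
    ultimately show ?thesis by simp
  qed
  have F'l: "(\<lambda>z. z ^ 3 * F' z) \<midarrow>0\<rightarrow> -2 * A"
  proof -
    have "(\<lambda>z. A * (z ^ 3 * deriv t.wp z)) \<midarrow>0\<rightarrow> A * -2"
      by (intro tendsto_mult tendsto_const t.deriv_wp_tendsto_0)
    thus ?thesis by (simp add: F'_def mult_ac)
  qed
  have G'l: "(\<lambda>z. z ^ 3 * G' z) \<midarrow>0\<rightarrow> -2 * A"
  proof -
    have "(\<lambda>z. A * ((\<alpha> * z) ^ 3 * deriv s.wp (\<alpha> * z))) \<midarrow>0\<rightarrow> A * -2"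
      by (intro tendsto_mult tendsto_const filterlim_compose[OF s.deriv_wp_tendsto_0 fl])
    moreover have "A * ((\<alpha> * z) ^ 3 * deriv s.wp (\<alpha> * z)) = z ^ 3 * G' z" for z
    proof -
      have "A * ((\<alpha> * z) ^ 3 * deriv s.wp (\<alpha> * z)) = (A * \<alpha>\<^sup>2) * (z ^ 3 * G' z)"
        by (simp add: G'_def power3_eq_cube power2_eq_square)
      thus ?thesis using A by (simp add: \<alpha>2(1))
    qed
    ultimately show ?thesis by (simp add: mult.commute)
  qed
  have sumlim: "(\<lambda>z. z ^ 3 * F' z + z ^ 3 * G' z) \<midarrow>0\<rightarrow> -4 * A"
    using tendsto_add[OF F'l G'l] by simp
  have "(\<lambda>z. \<alpha>\<^sup>2 * (4 * ((z\<^sup>2 * F z)\<^sup>2 + (z\<^sup>2 * F z) * (z\<^sup>2 * G z) + (z\<^sup>2 * G z)\<^sup>2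
            - S * z\<^sup>2 * (z\<^sup>2 * F z + z\<^sup>2 * G z) + z ^ 4 * q))) \<midarrow>0\<rightarrow>
          \<alpha>\<^sup>2 * (4 * (A\<^sup>2 + A * A + A\<^sup>2 - S * 0\<^sup>2 * (A + A) + 0 ^ 4 * q))"
    by (intro tendsto_intros Fl Gl)
  moreover have "\<alpha>\<^sup>2 * (4 * ((z\<^sup>2 * F z)\<^sup>2 + (z\<^sup>2 * F z) * (z\<^sup>2 * G z) + (z\<^sup>2 * G z)\<^sup>2
            - S * z\<^sup>2 * (z\<^sup>2 * F z + z\<^sup>2 * G z) + z ^ 4 * q)) = z ^ 4 * (\<alpha>\<^sup>2 * Q (F z) (G z))" for z
    unfolding Q_def by algebra
  moreover have "\<alpha>\<^sup>2 * (4 * (A\<^sup>2 + A * A + A\<^sup>2 - S * 0\<^sup>2 * (A + A) + 0 ^ 4 * q)) = 12 * A"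
  proof -
    have "\<alpha>\<^sup>2 * (4 * (A\<^sup>2 + A * A + A\<^sup>2 - S * 0\<^sup>2 * (A + A) + 0 ^ 4 * q)) = 12 * (\<alpha>\<^sup>2 * A) * A"
      by (simp add: power2_eq_square)
    thus ?thesis using A by (simp add: \<alpha>2(1))
  qed
  ultimately have Ql: "(\<lambda>z. z ^ 4 * (\<alpha>\<^sup>2 * Q (F z) (G z))) \<midarrow>0\<rightarrow> 12 * A" by (simp only:)
  \<comment> \<open>Three equal leading terms of \<open>Q\<close> contribute
    \<open>12 * A\<^sup>2 * \<alpha>\<^sup>2 = 12 * A\<close>, and the two derivatives together
    \<open>-4 * A\<close>.\<close>
  have "k \<midarrow>0\<rightarrow> 12 * A / (-4 * A)"
    unfolding k_def by (intro tendsto_divide Ql sumlim) (use A in auto)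
  moreover have "12 * A / (-4 * A) = -3" using A by simp
  ultimately have k: "k \<midarrow>0\<rightarrow> -3" by simp
  have sn: "eventually (\<lambda>z. z ^ 3 * F' z + z ^ 3 * G' z \<noteq> 0) (at 0)"
    by (rule tendsto_imp_eventually_ne[OF sumlim]) (use A in auto)
  have inv: "A / z\<^sup>2 = 1 / (\<alpha> * z)\<^sup>2" for z using A by (simp add: \<alpha>2(1) power_mult_distrib)
  have hev: "eventually (\<lambda>z. h z = F z - G z) (at 0)"
    using t.wp_at_0 eventually_compose_filterlim[OF s.wp_at_0 fl]
    by eventually_elim (simp add: h_def F_def G_def distrib_left inv)
  have an0: "t.wp0 analytic_on {0}" "(\<lambda>z. s.wp0 (\<alpha> * z)) analytic_on {0}"
  proof -
    have "(s.wp0 \<circ> (\<lambda>z. \<alpha> * z)) analytic_on {0}"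
      by (rule analytic_on_compose) (auto intro!: analytic_intros s.wp0_analytic')
    thus "(\<lambda>z. s.wp0 (\<alpha> * z)) analytic_on {0}" by (simp add: o_def)
  qed (rule t.wp0_analytic')
  have han: "h analytic_on {0}" unfolding h_def by (intro analytic_intros an0)
  have "eventually (\<lambda>z. (z - 0) * deriv h z = k z * h z) (at 0)"
    using sn hev evs t.eventually_not_lattice_at eventually_neq_at_within[of 0]
  proof eventually_elim
    case (elim z)
    have d1: "(t.wp0 has_field_derivative deriv t.wp0 z) (at z)"
      using t.wp0_analytic'(1)[OF elim(4)] analytic_on_imp_differentiable_at DERIV_deriv_iff_field_differentiable by blast
    have d2: "(s.wp0 has_field_derivative deriv s.wp0 (\<alpha> * z)) (at (\<alpha> * z))"
      using s.wp0_analytic'(1)[OF elim(3)] analytic_on_imp_differentiable_at DERIV_deriv_iff_field_differentiable by blast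
    have d3: "((\<lambda>z. s.wp0 (\<alpha> * z)) has_field_derivative deriv s.wp0 (\<alpha> * z) * \<alpha>) (at z)"
      by (rule DERIV_chain2[where f = s.wp0 and g = "\<lambda>z. \<alpha> * z"])
         (use d2 in \<open>auto intro!: derivative_eq_intros\<close>)
    have "(h has_field_derivative A * deriv t.wp0 z - \<alpha> * deriv s.wp0 (\<alpha> * z)) (at z)"
      unfolding h_def by (auto intro!: derivative_eq_intros d1 d3)
    hence dh: "deriv h z = A * deriv t.wp0 z - \<alpha> * deriv s.wp0 (\<alpha> * z)" by (rule DERIV_imp_deriv)
    \<comment> \<open>The polar parts of the two derivatives agree, so \<open>deriv h\<close> is the
      difference of the full derivatives.\<close>
    have "A * (2 / z ^ 3) = \<alpha> * (2 / (\<alpha> * z) ^ 3)"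
      using \<alpha> elim(5) by (simp add: \<alpha>2(2) power_mult_distrib power3_eq_cube power2_eq_square)
    hence dFG: "deriv h z = F' z - G' z"
      by (simp add: dh F'_def G'_def t.deriv_wp elim s.deriv_wp right_diff_distrib)
    have "(F' z)\<^sup>2 = \<alpha>\<^sup>2 * (4 * (\<Prod>e\<in>s.half_values. F z - e))"
    proof -
      \<comment> \<open>The affine map matches the roots, and three factors \<open>A\<close> against
        one \<open>\<alpha>\<^sup>2\<close> leave the \<open>A\<^sup>2\<close> coming from
        \<open>F'\<close>.\<close>
      have inj: "inj_on (\<lambda>x. A * x + B) t.half_values" using A by (auto simp: inj_on_def)
      have "(\<Prod>e\<in>s.half_values. F z - e) = (\<Prod>e\<in>t.half_values. F z - (A * e + B))"
        unfolding E[symmetric] by (subst prod.reindex[OF inj]) simp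
      also have "\<dots> = (\<Prod>e\<in>t.half_values. A * (t.wp z - e))"
        by (simp add: F_def algebra_simps)
      also have "\<dots> = A ^ 3 * (\<Prod>e\<in>t.half_values. t.wp z - e)"
        by (simp add: prod.distrib t.card_half_values)
      finally have "\<alpha>\<^sup>2 * (4 * (\<Prod>e\<in>s.half_values. F z - e)) =
          (\<alpha>\<^sup>2 * A) * (A\<^sup>2 * (4 * (\<Prod>e\<in>t.half_values. t.wp z - e)))"
        by (simp add: power3_eq_cube power2_eq_square)
      also have "\<alpha>\<^sup>2 * A = 1" using A by (simp add: \<alpha>2(1))
      finally show ?thesis by (simp add: F'_def power_mult_distrib t.wp_ode elim)
    qed
    moreover have "(G' z)\<^sup>2 = \<alpha>\<^sup>2 * (4 * (\<Prod>e\<in>s.half_values. G z - e))"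
      by (simp add: G'_def G_def power_mult_distrib s.wp_ode elim)
    ultimately have "(F' z)\<^sup>2 - (G' z)\<^sup>2 = \<alpha>\<^sup>2 * ((F z - G z) * Q (F z) (G z))"
      by (simp only: Q_def sq[symmetric] right_diff_distrib)
    hence "deriv h z * (F' z + G' z) = h z * (\<alpha>\<^sup>2 * Q (F z) (G z))"
      by (simp add: dFG elim(2) power2_eq_square algebra_simps)
    moreover have "z * deriv h z * (z ^ 3 * F' z + z ^ 3 * G' z) = z ^ 4 * (deriv h z * (F' z + G' z))"
      by (simp add: algebra_simps power3_eq_cube power4_eq_xxxx)
    ultimately have "z * deriv h z * (z ^ 3 * F' z + z ^ 3 * G' z) = z ^ 4 * (\<alpha>\<^sup>2 * Q (F z) (G z)) * h z"
      by (simp only: mult_ac)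
    hence "z * deriv h z = z ^ 4 * (\<alpha>\<^sup>2 * Q (F z) (G z)) * h z / (z ^ 3 * F' z + z ^ 3 * G' z)"
      using elim(1) by (simp only: eq_divide_eq) simp
    thus ?case by (simp add: k_def)
  qed
  moreover have "\<forall>m::nat. (-3 :: complex) \<noteq> of_nat m"
  proof safe
    fix m :: nat assume "(-3 :: complex) = of_nat m"
    hence "Re (-3) = Re (of_nat m)" by simp
    thus False by simp
  qed
  ultimately have "eventually (\<lambda>z. h z = 0) (nhds 0)"
    using log_derivative_vanish[OF han _ k] by blast
  hence "eventually (\<lambda>z. h z = 0) (at 0)" by (simp add: eventually_nhds_conv_at)
  with hev have "eventually (\<lambda>z. F z = G z) (at 0)" by eventually_elim simp
  hence "frequently (\<lambda>z. F z = G z) (at 0)" by (intro eventually_frequently) auto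
  hence "frequently (\<lambda>z. F z = G z) (cosparse UNIV)"
    by (auto simp: frequently_def eventually_cosparse_open_eq)
  moreover have "F meromorphic_on UNIV"
    unfolding F_def by (intro meromorphic_intros t.wp_meromorphic)
  moreover have "G meromorphic_on UNIV"
    unfolding G_def by (rule meromorphic_on_compose[OF s.wp_meromorphic[of UNIV]]) (auto intro!: analytic_intros)
  ultimately have "eventually (\<lambda>z. F z = G z) (cosparse UNIV)" using meromorphic_identity by blast
  thus ?thesis using \<alpha> by (auto simp: F_def G_def)
qed

text \<open>Lattice points are included, so infinity belongs to this set: these are the four branch
  values of \<wp>.\<close>

definition half_points :: "complex \<Rightarrow> P1 set" where
  "half_points \<tau> = weierstrass_p \<tau> ` {h. 2 * h \<in> lattice_of \<tau>}"

lemma (in half_plane) half_points_eq: "half_points \<tau> = insert None (Some ` half_values)"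
proof (intro equalityI subsetI)
  fix x assume "x \<in> half_points \<tau>"
  thus "x \<in> insert None (Some ` half_values)"
    by (auto simp: half_points_def half_values_def weierstrass_p_eq)
next
  fix x assume "x \<in> insert None (Some ` half_values)"
  then consider "x = None" | h where "2 * h \<in> \<Lambda>" "h \<notin> \<Lambda>" "x = Some (wp h)"
    by (auto simp: half_values_def)
  thus "x \<in> half_points \<tau>"
  proof cases
    case 1
    hence "x = weierstrass_p \<tau> 0" by (simp add: weierstrass_p_eq)
    thus ?thesis by (auto simp: half_points_def)
  next
    case 2
    hence "x = weierstrass_p \<tau> h" by (simp add: weierstrass_p_eq)
    thus ?thesis using 2 by (auto simp: half_points_def)
  qed
qed

text \<open>A half-period translation of the target brings the image of infinity back to infinity.
  What remains is affine and matches the half values, so \<open>affine_lift\<close> applies; undoing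
  the translation contributes \<beta>.\<close>

lemma mobius_lift:
  fixes \<tau> \<sigma> :: complex
  assumes "half_plane \<tau>" "half_plane \<sigma>" and \<epsilon>: "\<epsilon> \<in> mobius_transformations"
    and H: "\<epsilon> ` half_points \<tau> = half_points \<sigma>"
  shows "\<exists>\<alpha> \<beta>. \<alpha> \<noteq> 0 \<and> eventually (\<lambda>z. \<epsilon> (weierstrass_p \<tau> z) = weierstrass_p \<sigma> (\<alpha> * z + \<beta>)) (cosparse UNIV)"
proof -
  interpret t: half_plane \<tau> by fact
  interpret s: half_plane \<sigma> by fact
  have "\<epsilon> None \<in> half_points \<sigma>" using H t.half_points_eq by auto
  then obtain h where h: "2 * h \<in> s.\<Lambda>" "\<epsilon> None = weierstrass_p \<sigma> h" by (auto simp: half_points_def)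
  have h': "2 * (-h) \<in> s.\<Lambda>" using h(1) by simp
  obtain \<nu> where \<nu>: "\<nu> \<in> mobius_transformations" "\<And>z. weierstrass_p \<sigma> (z - h) = \<nu> (weierstrass_p \<sigma> z)"
    using s.half_period_translation[OF h'] by auto
  \<comment> \<open>Translation by \<open>h\<close> permutes the half periods.\<close>
  have \<nu>H: "\<nu> ` half_points \<sigma> = half_points \<sigma>"
  proof (intro equalityI subsetI)
    fix x assume "x \<in> \<nu> ` half_points \<sigma>"
    then obtain k where k: "2 * k \<in> s.\<Lambda>" "x = \<nu> (weierstrass_p \<sigma> k)" by (auto simp: half_points_def)
    have "2 * (k - h) \<in> s.\<Lambda>" using s.lattice_diff[OF k(1) h(1)] by (simp add: right_diff_distrib)
    thus "x \<in> half_points \<sigma>" using k(2) \<nu>(2)[of k] unfolding half_points_def by (metis imageI mem_Collect_eq)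
  next
    fix x assume "x \<in> half_points \<sigma>"
    then obtain k where k: "2 * k \<in> s.\<Lambda>" "x = weierstrass_p \<sigma> k" by (auto simp: half_points_def)
    have "2 * (k + h) \<in> s.\<Lambda>" using s.lattice_add[OF k(1) h(1)] by (simp add: distrib_left)
    moreover have "x = \<nu> (weierstrass_p \<sigma> (k + h))" using k(2) \<nu>(2)[of "k + h"] by simp
    ultimately show "x \<in> \<nu> ` half_points \<sigma>" by (auto simp: half_points_def)
  qed
  have "\<nu> \<circ> \<epsilon> \<in> mobius_transformations" by (intro mobius_compI \<nu> \<epsilon>)
  moreover have "(\<nu> \<circ> \<epsilon>) None = None"
    using \<nu>(2)[of h] h(2) by (simp add: s.weierstrass_p_eq)
  ultimately obtain A B where AB: "A \<noteq> 0" "\<And>x. (\<nu> \<circ> \<epsilon>) (Some x) = Some (A * x + B)"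
    using mobius_fixing_infinity by blast
  have "(\<nu> \<circ> \<epsilon>) ` half_points \<tau> = half_points \<sigma>"
    using H \<nu>H by (simp only: image_comp[symmetric])
  hence "insert None (Some ` (\<lambda>x. A * x + B) ` t.half_values) = insert None (Some ` s.half_values)"
    using AB(2) \<open>(\<nu> \<circ> \<epsilon>) None = None\<close>
    unfolding t.half_points_eq s.half_points_eq image_insert image_image by simp
  hence "(\<lambda>x. A * x + B) ` t.half_values = s.half_values"
    by (subst (asm) insert_ident) (simp_all add: inj_image_eq_iff)
  from affine_lift[OF assms(1,2) AB(1) this]
  obtain \<alpha> where \<alpha>: "\<alpha> \<noteq> 0" "eventually (\<lambda>z. A * t.wp z + B = s.wp (\<alpha> * z)) (cosparse UNIV)"
    by blast
  have "eventually (\<lambda>z. \<alpha> * z + 0 \<notin> s.\<Lambda>) (cosparse UNIV)"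
    by (rule ae_affine[OF s.ae_not_lattice \<alpha>(1)])
  with \<alpha>(2) t.ae_not_lattice
  have "eventually (\<lambda>z. \<epsilon> (weierstrass_p \<tau> z) = weierstrass_p \<sigma> (\<alpha> * z + h)) (cosparse UNIV)"
  proof eventually_elim
    case (elim z)
    have "\<nu> (\<epsilon> (weierstrass_p \<tau> z)) = Some (A * t.wp z + B)"
      using AB(2) elim by (simp add: t.weierstrass_p_eq)
    also have "\<dots> = weierstrass_p \<sigma> (\<alpha> * z + h - h)"
      using elim by (simp add: s.weierstrass_p_eq)
    also have "\<dots> = \<nu> (weierstrass_p \<sigma> (\<alpha> * z + h))" by (rule \<nu>)
    finally show ?case using mobius_inj[OF \<nu>(1)] by (simp add: inj_eq)
  qed
  thus ?thesis using \<alpha>(1) by blast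
qed

text \<open>Through the lift, translation by \<omega> becomes translation by
  \<open>\<alpha> * \<omega>\<close>; injectivity of \<open>M\<close> carries periods back.\<close>

lemma period_transfer:
  fixes \<tau> \<sigma> :: complex
  assumes "half_plane \<tau>" "half_plane \<sigma>" and M: "inj M" and \<alpha>: "\<alpha> \<noteq> 0"
    and ev: "eventually (\<lambda>z. M (weierstrass_p \<tau> z) = weierstrass_p \<sigma> (\<alpha> * z + \<beta>)) (cosparse UNIV)"
  shows "\<omega> \<in> lattice_of \<tau> \<longleftrightarrow> \<alpha> * \<omega> \<in> lattice_of \<sigma>"
proof -
  interpret t: half_plane \<tau> by fact
  interpret s: half_plane \<sigma> by fact
  have ev': "eventually (\<lambda>z. M (weierstrass_p \<tau> (z + \<omega>)) = weierstrass_p \<sigma> (\<alpha> * z + \<beta> + \<alpha> * \<omega>)) (cosparse UNIV)"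
    using ae_affine[OF ev, of 1 \<omega>] by (simp add: algebra_simps)
  show ?thesis
  proof
    assume l: "\<omega> \<in> t.\<Lambda>"
    have "eventually (\<lambda>z. weierstrass_p \<sigma> (\<alpha> * z + \<beta> + \<alpha> * \<omega>) = weierstrass_p \<sigma> (\<alpha> * z + \<beta>)) (cosparse UNIV)"
      using ev ev'
    proof eventually_elim
      case (elim z)
      have "weierstrass_p \<tau> (z + \<omega>) = weierstrass_p \<tau> z"
        using l by (simp add: t.weierstrass_p_eq_iff)
      thus ?case using elim by simp
    qed
    from ae_affine[OF this, of "1 / \<alpha>" "- \<beta> / \<alpha>"] \<alpha>
    have "eventually (\<lambda>z. weierstrass_p \<sigma> (z + \<alpha> * \<omega>) = weierstrass_p \<sigma> z) (cosparse UNIV)"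
      by (simp add: right_diff_distrib)
    thus "\<alpha> * \<omega> \<in> s.\<Lambda>" by (rule s.weierstrass_p_ae_period)
  next
    assume l: "\<alpha> * \<omega> \<in> s.\<Lambda>"
    have "eventually (\<lambda>z. weierstrass_p \<tau> (z + \<omega>) = weierstrass_p \<tau> z) (cosparse UNIV)"
      using ev ev'
    proof eventually_elim
      case (elim z)
      have "weierstrass_p \<sigma> (\<alpha> * z + \<beta> + \<alpha> * \<omega>) = weierstrass_p \<sigma> (\<alpha> * z + \<beta>)"
        using l by (simp add: s.weierstrass_p_eq_iff)
      hence "M (weierstrass_p \<tau> (z + \<omega>)) = M (weierstrass_p \<tau> z)" using elim by simp
      thus ?case using M by (simp add: inj_eq)
    qed
    thus "\<omega> \<in> t.\<Lambda>" by (rule t.weierstrass_p_ae_period)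
  qed
qed

section \<open>The rational function \<open>n\<^sub>\<tau>\<close>\<close>

lemma dvd_less_double_imp_eq:
  fixes a n :: int
  assumes "n dvd a" "0 < a" "a < 2 * n"
  shows "a = n"
proof -
  obtain m where m: "a = n * m" using assms(1) by auto
  have n: "n > 0" using assms by linarith
  have "m > 0" using m assms(2) n by (simp add: zero_less_mult_iff)
  moreover have "m < 2" using m assms(3) n by (simp add: mult.commute)
  ultimately have "m = 1" by linarith
  thus ?thesis using m by simp
qed

section \<open>The kernel of the isogeny and the rational function\<close>

locale isogeny_lattice = half_plane +
  fixes n :: nat
  assumes n_pos: "n \<ge> 1"
begin

text \<open>The target lattice: every fact on \<wp> becomes available for it under the prefix
  \<open>N\<close>.\<close>

sublocale N: half_plane "of_nat n * \<tau>"
  using Im_pos n_pos by unfold_locales simp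

lemma n_nonzero: "(of_nat n :: complex) \<noteq> 0"
  using n_pos by simp

lemma int_div_in_lattice: "of_int m / of_nat n \<in> \<Lambda> \<longleftrightarrow> int n dvd m"
proof
  assume "of_int m / of_nat n \<in> \<Lambda>"
  then obtain a b where "of_int m / of_nat n = of_int a + of_int b * \<tau>" by (auto simp: lattice_of_def)
  hence "of_int m = of_nat n * (of_int a + of_int b * \<tau>)" using n_nonzero by (simp add: field_simps)
  hence "of_int m + of_int 0 * \<tau> = of_int (int n * a) + of_int (int n * b) * \<tau>"
    by (simp add: algebra_simps)
  from lattice_repr_unique[OF this] show "int n dvd m" by simp
next
  assume "int n dvd m"
  then obtain a where "m = int n * a" by auto
  thus "of_int m / of_nat n \<in> \<Lambda>" using lattice_memI[of a 0] n_nonzero by simp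
qed

text \<open>Only the coordinate along 1 matters, and \<open>k\<close> is its residue modulo
  \<open>n\<close>: the kernel of the isogeny is cyclic, generated by \<open>1 / n\<close>.\<close>

lemma mult_in_lattice_iff: "of_nat n * u \<in> N.\<Lambda> \<longleftrightarrow> (\<exists>k<n. u - of_nat k / of_nat n \<in> \<Lambda>)"
proof
  assume "of_nat n * u \<in> N.\<Lambda>"
  then obtain a b where ab: "of_nat n * u = of_int a + of_int b * (of_nat n * \<tau>)" by (auto simp: lattice_of_def)
  define k where "k = nat (a mod int n)"
  have k: "k < n" using n_pos by (simp add: k_def nat_less_iff)
  have "a = int n * (a div int n) + int k" using n_pos by (simp add: k_def)
  hence "(of_int a :: complex) = of_int (int n * (a div int n) + int k)" by metis
  hence "of_nat n * u = of_nat n * (of_nat k / of_nat n + (of_int (a div int n) + of_int b * \<tau>))"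
    using ab n_nonzero by (simp add: algebra_simps)
  hence "u - of_nat k / of_nat n = of_int (a div int n) + of_int b * \<tau>" using n_nonzero by simp
  thus "\<exists>k<n. u - of_nat k / of_nat n \<in> \<Lambda>" using k lattice_memI by metis
next
  assume "\<exists>k<n. u - of_nat k / of_nat n \<in> \<Lambda>"
  then obtain k a b where "u - of_nat k / of_nat n = of_int a + of_int b * \<tau>" by (auto simp: lattice_of_def)
  hence "u = of_nat k / of_nat n + (of_int a + of_int b * \<tau>)" by (simp add: algebra_simps)
  hence "of_nat n * u = of_int (int k + int n * a) + of_int b * (of_nat n * \<tau>)"
    using n_nonzero by (simp add: algebra_simps)
  thus "of_nat n * u \<in> N.\<Lambda>" using N.lattice_memI by metis
qed

lemma mult_in_lattice: "u \<in> \<Lambda> \<Longrightarrow> of_nat n * u \<in> N.\<Lambda>"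
  using mult_in_lattice_iff[of u] n_pos by (intro iffD2[OF mult_in_lattice_iff] exI[of _ 0]) auto

text \<open>The finite values of \<wp> on the kernel, meant for 0 < k < n; at \<open>k = 0\<close>
  the default value of \<open>wp\<close> appears in place of infinity.\<close>

definition torsion_value :: "nat \<Rightarrow> complex" where "torsion_value k = wp (of_nat k / of_nat n)"

lemma frac_notin_lattice: "0 < k \<Longrightarrow> k < n \<Longrightarrow> of_nat k / of_nat n \<notin> \<Lambda>"
  using int_div_in_lattice[of "int k"] zdvd_imp_le[of "int n" "int k"] by auto

text \<open>By evenness \<open>k\<close> and \<open>n - k\<close> share a value; the index bounds
  leave no multiple of \<open>n\<close> for \<open>k + j\<close> other than \<open>n\<close>, and
  none for \<open>k - j\<close> other than 0.\<close>

lemma torsion_value_eq_iff: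
  assumes z: "z - of_nat k / of_nat n \<in> \<Lambda>" and kj: "0 < k" "k < n" "0 < j" "j < n"
  shows "wp z = torsion_value j \<longleftrightarrow> j = k \<or> j = n - k"
proof -
  have "wp z = torsion_value k" using wp_periodic[OF z, of "of_nat k / of_nat n"] by (simp add: torsion_value_def)
  also have "torsion_value k = torsion_value j \<longleftrightarrow> of_int (int k - int j) / of_nat n \<in> \<Lambda> \<or> of_int (int k + int j) / of_nat n \<in> \<Lambda>"
    unfolding torsion_value_def using wp_eq_iff[OF frac_notin_lattice frac_notin_lattice, of k j] kj
    by (simp add: add_divide_distrib diff_divide_distrib)
  also have "\<dots> \<longleftrightarrow> int n dvd (int k - int j) \<or> int n dvd (int k + int j)"
    by (simp only: int_div_in_lattice)
  also have "int n dvd (int k - int j) \<longleftrightarrow> j = k"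
  proof
    assume "int n dvd (int k - int j)"
    thus "j = k" using dvd_imp_le_int[of "int k - int j" "int n"] kj by (cases "int k - int j = 0") auto
  qed auto
  also have "int n dvd (int k + int j) \<longleftrightarrow> j = n - k"
  proof
    assume "int n dvd (int k + int j)"
    hence "int k + int j = int n" by (rule dvd_less_double_imp_eq) (use kj in auto)
    thus "j = n - k" using kj by linarith
  next
    assume "j = n - k"
    thus "int n dvd (int k + int j)" using kj by simp
  qed
  finally show ?thesis .
qed

text \<open>The zero of the product has order exactly two: either two different indices contribute a
  simple zero each, or \<open>2 * k = n\<close> and a single factor has a double zero. That the
  limit is nonzero will give coprimality.\<close>

lemma pole_cancel:
  assumes z: "z - of_nat k / of_nat n \<in> \<Lambda>" and k: "0 < k" "k < n"
  shows "\<exists>M. M \<noteq> 0 \<and> (\<lambda>w. (\<Prod>j\<in>{1..<n}. wp w - torsion_value j) / (w - z)\<^sup>2) \<midarrow>z\<rightarrow> M"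
proof -
  have zL: "z \<notin> \<Lambda>"
    using frac_notin_lattice[OF k] lattice_diff[OF _ z, of z] by auto
  \<comment> \<open>The indices of the factors vanishing at \<open>z\<close>; being a set, it has
    one element when \<open>2 * k = n\<close>.\<close>
  define B where "B = {k, n - k}"
  have B: "B \<subseteq> {1..<n}" using k by (auto simp: B_def)
  have Bc: "j \<in> B \<longleftrightarrow> wp z = torsion_value j" if "j \<in> {1..<n}" for j
    using torsion_value_eq_iff[OF z k, of j] that by (auto simp: B_def)
  have split: "(\<Prod>j\<in>{1..<n}. wp w - torsion_value j) = (\<Prod>j\<in>{1..<n} - B. wp w - torsion_value j) * (wp w - wp z) ^ card B" for w
  proof -
    have "(\<Prod>j\<in>B. wp w - torsion_value j) = (\<Prod>j\<in>B. wp w - wp z)"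
      using Bc B by (intro prod.cong) auto
    thus ?thesis using prod.subset_diff[OF B, of "\<lambda>j. wp w - torsion_value j"] by simp
  qed
  have R: "(\<lambda>w. \<Prod>j\<in>{1..<n} - B. wp w - torsion_value j) \<midarrow>z\<rightarrow> (\<Prod>j\<in>{1..<n} - B. wp z - torsion_value j)"
    by (intro tendsto_intros wp_tendsto zL)
  have R0: "(\<Prod>j\<in>{1..<n} - B. wp z - torsion_value j) \<noteq> 0" using Bc by auto
  have "\<exists>M. M \<noteq> 0 \<and> (\<lambda>w. (wp w - wp z) ^ card B / (w - z)\<^sup>2) \<midarrow>z\<rightarrow> M"
  proof (cases "2 * k = n")
    case False
    hence cB: "card B = 2" using k by (auto simp: B_def card_insert_if)
    have "2 * z \<notin> \<Lambda>"
    proof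
      assume "2 * z \<in> \<Lambda>"
      hence "2 * z - (z - of_nat k / of_nat n) - (z - of_nat k / of_nat n) \<in> \<Lambda>"
        by (intro lattice_diff z)
      hence "of_int (2 * int k) / of_nat n \<in> \<Lambda>" by (simp add: algebra_simps)
      hence "int n dvd 2 * int k" by (simp only: int_div_in_lattice)
      hence "2 * int k = int n" by (rule dvd_less_double_imp_eq) (use k in auto)
      thus False using False by linarith
    qed
    hence d: "deriv wp z \<noteq> 0" by (rule deriv_wp_nonzero)
    have "(\<lambda>w. (wp w - wp z) / (w - z)) \<midarrow>z\<rightarrow> deriv wp z"
      using wp_has_deriv[OF zL] by (simp add: has_field_derivative_iff)
    from tendsto_power[OF this, of 2] show ?thesis
      using d by (intro exI[of _ "(deriv wp z)\<^sup>2"]) (simp add: cB power_divide)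
  next
    case True
    hence "n - k = k" by simp
    hence cB: "card B = 1" by (simp add: B_def)
    have "2 * (of_nat k / of_nat n) = (1 :: complex)"
      using True n_nonzero by (simp add: field_simps) (metis of_nat_mult of_nat_numeral)
    hence "2 * z = (z - of_nat k / of_nat n) + (z - of_nat k / of_nat n) + 1"
      by (simp add: algebra_simps)
    hence "2 * z \<in> \<Lambda>" using lattice_add[OF lattice_add[OF z z] lattice_1] by simp
    \<comment> \<open>At a half period the product identity writes the factor as \<open>C\<close>
      over a double pole, so its zero has order exactly two.\<close>
    from half_period_product[OF this zL] obtain C where
      C: "C \<noteq> 0" "\<And>t. t \<notin> \<Lambda> \<Longrightarrow> t + z \<notin> \<Lambda> \<Longrightarrow> (wp (t + z) - wp z) * (wp t - wp z) = C" by blast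
    have l: "(\<lambda>t. t\<^sup>2 * wp t - t\<^sup>2 * wp z) \<midarrow>0\<rightarrow> 1 - 0\<^sup>2 * wp z"
      by (intro tendsto_intros wp_tendsto_0)
    have "(\<lambda>t. C / (t\<^sup>2 * wp t - t\<^sup>2 * wp z)) \<midarrow>0\<rightarrow> C / (1 - 0\<^sup>2 * wp z)"
      by (intro tendsto_divide tendsto_const l) auto
    moreover have "eventually (\<lambda>t. C / (t\<^sup>2 * wp t - t\<^sup>2 * wp z) = (wp (t + z) - wp z) / t\<^sup>2) (at 0)"
    proof -
      have "eventually (\<lambda>t. t + z \<notin> \<Lambda>) (at 0)"
        using ae_affine[OF ae_not_lattice, of 1 z] by (simp add: eventually_cosparse_open_eq)
      moreover have "eventually (\<lambda>t. t\<^sup>2 * wp t - t\<^sup>2 * wp z \<noteq> 0) (at 0)"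
        by (rule tendsto_imp_eventually_ne[OF l]) auto
      ultimately show ?thesis using eventually_not_lattice_at eventually_neq_at_within[of 0]
      proof eventually_elim
        case (elim t)
        have "wp t - wp z \<noteq> 0" using elim(2) by auto
        have "C / (t\<^sup>2 * wp t - t\<^sup>2 * wp z) = ((wp (t + z) - wp z) * (wp t - wp z)) / (t\<^sup>2 * (wp t - wp z))"
          using C(2)[OF elim(3,1)] by (simp add: right_diff_distrib)
        thus ?case using \<open>wp t - wp z \<noteq> 0\<close> by simp
      qed
    qed
    ultimately have "(\<lambda>t. (wp (t + z) - wp z) / t\<^sup>2) \<midarrow>0\<rightarrow> C" by (simp add: tendsto_cong)
    from LIM_offset[OF this, of "-z"] have "(\<lambda>w. (wp w - wp z) / (w - z)\<^sup>2) \<midarrow>z\<rightarrow> C" by simp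
    thus ?thesis using C(1) cB by auto
  qed
  then obtain M where M: "M \<noteq> 0" "(\<lambda>w. (wp w - wp z) ^ card B / (w - z)\<^sup>2) \<midarrow>z\<rightarrow> M" by blast
  from tendsto_mult[OF R M(2)]
  have "(\<lambda>w. (\<Prod>j\<in>{1..<n}. wp w - torsion_value j) / (w - z)\<^sup>2) \<midarrow>z\<rightarrow> (\<Prod>j\<in>{1..<n} - B. wp z - torsion_value j) * M"
    by (simp only: split times_divide_eq_right)
  thus ?thesis using R0 M(1) by (meson mult_eq_0_iff)
qed

lemma N_wp_pole:
  assumes "of_nat n * z \<in> N.\<Lambda>"
  shows "(\<lambda>w. (w - z)\<^sup>2 * N.wp (of_nat n * w)) \<midarrow>z\<rightarrow> 1 / (of_nat n)\<^sup>2"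
proof -
  have fl: "filterlim (\<lambda>w. of_nat n * w) (at (of_nat n * z)) (at z)"
    using filterlim_affine_at[OF n_nonzero, of 0 z] by simp
  have "(\<lambda>w. (1 / (of_nat n)\<^sup>2) * ((of_nat n * w - of_nat n * z)\<^sup>2 * N.wp (of_nat n * w))) \<midarrow>z\<rightarrow> (1 / (of_nat n)\<^sup>2) * 1"
    by (intro tendsto_mult tendsto_const filterlim_compose[OF N.wp_shift_tendsto[OF assms] fl])
  moreover have "(1 / (of_nat n)\<^sup>2) * ((of_nat n * w - of_nat n * z)\<^sup>2 * N.wp (of_nat n * w)) = (w - z)\<^sup>2 * N.wp (of_nat n * w)" for w
    using n_nonzero by (simp add: power_mult_distrib flip: right_diff_distrib)
  ultimately show ?thesis by simp
qed

text \<open>The denominator \<open>q\<close> has the torsion values as roots. Multiplied by it,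
  \<wp> of the target lattice loses its poles off \<Lambda> and becomes a polynomial
  \<open>p\<close> in \<wp>, of degree \<open>n\<close> by its growth at 0. It does not vanish at
  the torsion points, so \<open>p\<close> and \<open>q\<close> are coprime.\<close>

lemma isogeny_rational:
  "\<exists>p q. coprime p q \<and> max (degree p) (degree q) = n \<and>
     (\<forall>z. rat_map p q (weierstrass_p \<tau> z) = weierstrass_p (of_nat n * \<tau>) (of_nat n * z))"
proof -
  define F where "F = (\<lambda>z. N.wp (of_nat n * z))"
  \<comment> \<open>Running over all \<open>j\<close> rather than up to sign gives each double pole of \<open>F\<close> outside \<open>\<Lambda>\<close>
    a zero of exact order two: the zeros from \<open>j\<close> and \<open>n - j\<close> pair up, and that from
    \<open>j = n / 2\<close> is already double.\<close>
  define G where "G = (\<lambda>z. F z * (\<Prod>j\<in>{1..<n}. wp z - torsion_value j))"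
  have Fm: "F meromorphic_on UNIV"
    unfolding F_def by (rule meromorphic_on_compose[OF N.wp_meromorphic[of UNIV]]) (auto intro!: analytic_intros)
  have Gm: "G meromorphic_on UNIV"
    unfolding G_def by (intro meromorphic_intros wp_meromorphic Fm)
  have Ge: "G (-z) = G z" for z by (simp add: G_def F_def)
  have Gp: "G (z + \<omega>) = G z" if "\<omega> \<in> \<Lambda>" for z \<omega>
    using N.wp_periodic[OF mult_in_lattice[OF that], of "of_nat n * z"] wp_periodic[OF that]
    by (simp add: G_def F_def distrib_left)
  have fl: "filterlim (\<lambda>w. of_nat n * w) (at (of_nat n * z)) (at z)" for z :: complex
    using filterlim_affine_at[OF n_nonzero, of 0 z] by simp
  have Greg: "G \<midarrow>z\<rightarrow> G z" if "z \<notin> \<Lambda>" "of_nat n * z \<notin> N.\<Lambda>" for z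
    unfolding G_def F_def
    by (intro tendsto_intros wp_tendsto that filterlim_compose[OF N.wp_tendsto[OF that(2)] fl])
  have Gpole: "\<exists>M. M \<noteq> 0 \<and> G \<midarrow>z\<rightarrow> M" if z: "z - of_nat k / of_nat n \<in> \<Lambda>" "0 < k" "k < n" for z k
  proof -
    obtain M where M: "M \<noteq> 0" "(\<lambda>w. (\<Prod>j\<in>{1..<n}. wp w - torsion_value j) / (w - z)\<^sup>2) \<midarrow>z\<rightarrow> M"
      using pole_cancel[OF z] by blast
    have nz: "of_nat n * z \<in> N.\<Lambda>" using mult_in_lattice_iff z by blast
    from tendsto_mult[OF N_wp_pole[OF nz] M(2)]
    have "(\<lambda>w. (w - z)\<^sup>2 * N.wp (of_nat n * w) * ((\<Prod>j\<in>{1..<n}. wp w - torsion_value j) / (w - z)\<^sup>2)) \<midarrow>z\<rightarrow> 1 / (of_nat n)\<^sup>2 * M" .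
    moreover have "eventually (\<lambda>w. (w - z)\<^sup>2 * N.wp (of_nat n * w) * ((\<Prod>j\<in>{1..<n}. wp w - torsion_value j) / (w - z)\<^sup>2) = G w) (at z)"
      by (auto simp: eventually_at_filter G_def F_def)
    ultimately have "G \<midarrow>z\<rightarrow> 1 / (of_nat n)\<^sup>2 * M" using tendsto_cong by fast
    thus ?thesis using M(1) n_nonzero by (intro exI[of _ "1 / (of_nat n)\<^sup>2 * M"]) auto
  qed
  have Glim: "\<exists>L. G \<midarrow>z\<rightarrow> L" if z: "z \<notin> \<Lambda>" for z
  proof (cases "of_nat n * z \<in> N.\<Lambda>")
    case True
    then obtain k where k: "k < n" "z - of_nat k / of_nat n \<in> \<Lambda>" using mult_in_lattice_iff by blast
    have "k \<noteq> 0" using k z by (intro notI) simp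
    thus ?thesis using Gpole[OF k(2) _ k(1)] by blast
  next
    case False
    thus ?thesis using Greg z by blast
  qed
  \<comment> \<open>One double pole from \<open>F\<close> and one from each of the
    \<open>n - 1\<close> factors.\<close>
  have G0: "(\<lambda>z. z ^ (2 * n) * G z) \<midarrow>0\<rightarrow> 1 / (of_nat n)\<^sup>2"
  proof -
    have "(\<lambda>z. ((z - 0)\<^sup>2 * F z) * (\<Prod>j\<in>{1..<n}. z\<^sup>2 * wp z - z\<^sup>2 * torsion_value j)) \<midarrow>0\<rightarrow>
            1 / (of_nat n)\<^sup>2 * (\<Prod>j\<in>{1..<n}. 1 - 0\<^sup>2 * torsion_value j)"
      unfolding F_def by (intro tendsto_mult N_wp_pole tendsto_prod tendsto_diff wp_tendsto_0 tendsto_intros) simp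
    moreover have "((z - 0)\<^sup>2 * F z) * (\<Prod>j\<in>{1..<n}. z\<^sup>2 * wp z - z\<^sup>2 * torsion_value j) = z ^ (2 * n) * G z" for z
    proof -
      have "(\<Prod>j\<in>{1..<n}. z\<^sup>2 * wp z - z\<^sup>2 * torsion_value j) = (z\<^sup>2) ^ (n - 1) * (\<Prod>j\<in>{1..<n}. wp z - torsion_value j)"
        by (simp add: prod.distrib flip: right_diff_distrib)
      moreover have "z ^ (2 * n) = z\<^sup>2 * (z\<^sup>2) ^ (n - 1)"
        using n_pos by (cases n) (auto simp: power_mult power2_eq_square)
      ultimately show ?thesis by (simp add: G_def)
    qed
    ultimately show ?thesis by simp
  qed
  from even_elliptic_poly[OF Gm Ge Gp Glim G0] obtain p where
    p: "degree p \<le> n" "coeff p n = 1 / (of_nat n)\<^sup>2" "\<And>z. z \<notin> \<Lambda> \<Longrightarrow> G \<midarrow>z\<rightarrow> poly p (wp z)" by blast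
  have dp: "degree p = n"
    using p(1,2) n_nonzero le_degree[of p n] by fastforce
  define q where "q = (\<Prod>j\<in>{1..<n}. [:- torsion_value j, 1:])"
  have dq: "degree q = n - 1" unfolding q_def by (subst degree_prod_eq_sum_degree) auto
  have qx: "poly q x = (\<Prod>j\<in>{1..<n}. x - torsion_value j)" for x by (simp add: q_def poly_prod)
  have "coprime p q"
  proof (rule coprimeI)
    fix r assume r: "r dvd p" "r dvd q"
    have "r \<noteq> 0" using r(1) p(2) n_nonzero by auto
    have "degree r = 0"
    proof (rule ccontr)
      assume "degree r \<noteq> 0"
      then obtain x where x: "poly r x = 0" using alg_closed_imp_poly_has_root[of r] by auto
      hence "poly q x = 0" "poly p x = 0" using r by (auto elim!: dvdE)
      then obtain j where j: "j \<in> {1..<n}" "x = torsion_value j" unfolding qx by auto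
      obtain M where M: "M \<noteq> 0" "G \<midarrow>(of_nat j / of_nat n)\<rightarrow> M"
        using Gpole[of "of_nat j / of_nat n" j] j by auto
      have "of_nat j / of_nat n \<notin> \<Lambda>" using frac_notin_lattice j by simp
      from LIM_unique[OF M(2) p(3)[OF this]] have "poly p (torsion_value j) \<noteq> 0" using M(1) by (simp add: torsion_value_def)
      thus False using \<open>poly p x = 0\<close> j by simp
    qed
    thus "is_unit r" using \<open>r \<noteq> 0\<close> is_unit_iff_degree by blast
  qed
  moreover have "max (degree p) (degree q) = n" using dp dq by simp
  moreover have "rat_map p q (weierstrass_p \<tau> z) = weierstrass_p (of_nat n * \<tau>) (of_nat n * z)" for z
  proof (cases "z \<in> \<Lambda>")
    case True
    \<comment> \<open>The degree of \<open>q\<close> is \<open>n - 1\<close>, so infinity goes to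
      infinity, as lattice points require.\<close>
    have "coeff q n = 0" using dq n_pos by (intro coeff_eq_0) auto
    thus ?thesis using True mult_in_lattice[OF True] dp dq
      by (simp add: rat_map_def weierstrass_p_eq N.weierstrass_p_eq)
  next
    case False
    show ?thesis
    proof (cases "of_nat n * z \<in> N.\<Lambda>")
      case True
      then obtain k where k: "k < n" "z - of_nat k / of_nat n \<in> \<Lambda>" using mult_in_lattice_iff by blast
      have "k \<noteq> 0" using k False by (intro notI) simp
      hence "wp z = torsion_value k" "k \<in> {1..<n}" using torsion_value_eq_iff[OF k(2) _ k(1), of k] k by auto
      hence "poly q (wp z) = 0" unfolding qx by (intro prod_zero) auto
      thus ?thesis using True False by (simp add: rat_map_def weierstrass_p_eq N.weierstrass_p_eq)
    next
      case nz: False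
      have ne: "wp z \<noteq> torsion_value j" if j: "j \<in> {1..<n}" for j
      proof
        assume "wp z = torsion_value j"
        hence "z - of_nat j / of_nat n \<in> \<Lambda> \<or> z + of_nat j / of_nat n \<in> \<Lambda>"
          using wp_eq_iff[OF False frac_notin_lattice, of j] j by (auto simp: torsion_value_def)
        hence "of_nat n * z - of_nat n * (of_nat j / of_nat n) \<in> N.\<Lambda> \<or> of_nat n * z + of_nat n * (of_nat j / of_nat n) \<in> N.\<Lambda>"
          using mult_in_lattice by (metis distrib_left right_diff_distrib)
        moreover have "of_nat n * (of_nat j / of_nat n) \<in> N.\<Lambda>"
          using n_nonzero N.lattice_memI[of "int j" 0] by simp
        ultimately show False using nz N.lattice_add N.lattice_diff by (metis add_diff_cancel diff_add_cancel)
      qed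
      have q0: "poly q (wp z) \<noteq> 0" unfolding qx using ne by auto
      have "G z = poly p (wp z)" using LIM_unique[OF Greg[OF False nz] p(3)[OF False]] .
      hence "F z = poly p (wp z) / poly q (wp z)" using q0 by (simp add: G_def qx eq_divide_eq)
      thus ?thesis using False nz q0 by (simp add: rat_map_def weierstrass_p_eq N.weierstrass_p_eq F_def)
    qed
  qed
  ultimately show ?thesis by blast
qed

end

section \<open>The map on the quotient and its fibres\<close>

context half_plane
begin

lemma elliptic_curve_iff: "X \<in> elliptic_curve \<tau> \<longleftrightarrow> (\<exists>z. X = lattice_rel \<tau> `` {z})"
  by (auto simp: elliptic_curve_def quotient_def)

lemma wp_curve_class: "wp_curve \<tau> (lattice_rel \<tau> `` {z}) = weierstrass_p \<tau> z"
proof -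
  have "weierstrass_p \<tau> ` (lattice_rel \<tau> `` {z}) = {weierstrass_p \<tau> z}"
  proof (intro equalityI subsetI)
    fix x assume "x \<in> weierstrass_p \<tau> ` (lattice_rel \<tau> `` {z})"
    then obtain w where "z - w \<in> \<Lambda>" "x = weierstrass_p \<tau> w" by (auto simp: lattice_rel_def)
    thus "x \<in> {weierstrass_p \<tau> z}" using weierstrass_p_eq_iff[of z w] by simp
  next
    fix x assume "x \<in> {weierstrass_p \<tau> z}"
    thus "x \<in> weierstrass_p \<tau> ` (lattice_rel \<tau> `` {z})" by (auto simp: lattice_rel_def)
  qed
  thus ?thesis by (simp add: wp_curve_def)
qed

end

context isogeny_lattice
begin

lemma isogeny_class:
  "isogeny n \<tau> (lattice_rel \<tau> `` {z}) = lattice_rel (of_nat n * \<tau>) `` {of_nat n * z}"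
proof (intro equalityI subsetI)
  fix v assume "v \<in> isogeny n \<tau> (lattice_rel \<tau> `` {z})"
  then obtain w where "z - w \<in> \<Lambda>" "of_nat n * w - v \<in> N.\<Lambda>"
    by (auto simp: isogeny_def lattice_rel_def)
  hence "of_nat n * z - v \<in> N.\<Lambda>"
    using N.lattice_add[OF mult_in_lattice] by (fastforce simp: algebra_simps)
  thus "v \<in> lattice_rel (of_nat n * \<tau>) `` {of_nat n * z}" by (simp add: lattice_rel_def)
next
  fix v assume "v \<in> lattice_rel (of_nat n * \<tau>) `` {of_nat n * z}"
  moreover have "z \<in> lattice_rel \<tau> `` {z}" by (simp add: lattice_rel_def)
  ultimately show "v \<in> isogeny n \<tau> (lattice_rel \<tau> `` {z})" unfolding isogeny_def by blast
qed

text \<open>This discharges the definite description: existence is \<open>isogeny_rational\<close>,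
  and uniqueness holds because \<wp> is surjective, so the functional equation prescribes every
  value.\<close>

lemma n_map_weierstrass_p:
  "n_map n \<tau> (weierstrass_p \<tau> z) = weierstrass_p (of_nat n * \<tau>) (of_nat n * z)"
proof -
  define P where "P = (\<lambda>f. rational_function_of_degree n f \<and>
        (\<forall>X\<in>elliptic_curve \<tau>. f (wp_curve \<tau> X) = wp_curve (of_nat n * \<tau>) (isogeny n \<tau> X)))"
  have classes: "elliptic_curve \<tau> = range (\<lambda>z. lattice_rel \<tau> `` {z})"
    by (auto simp: elliptic_curve_iff)
  have P: "P f \<longleftrightarrow> rational_function_of_degree n f \<and>
      (\<forall>z. f (weierstrass_p \<tau> z) = weierstrass_p (of_nat n * \<tau>) (of_nat n * z))" for f
    unfolding P_def classes by (simp add: wp_curve_class isogeny_class N.wp_curve_class)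
  obtain p q where pq: "coprime p q" "max (degree p) (degree q) = n"
     "\<And>z. rat_map p q (weierstrass_p \<tau> z) = weierstrass_p (of_nat n * \<tau>) (of_nat n * z)"
    using isogeny_rational by blast
  have "P (rat_map p q)" unfolding P rational_function_of_degree_def using pq by blast
  moreover have "f = g" if "P f" "P g" for f g
  proof
    fix x
    obtain z where "weierstrass_p \<tau> z = x" using weierstrass_p_surj by blast
    thus "f x = g x" using that unfolding P by metis
  qed
  ultimately have "P (THE f. P f)" by (metis theI)
  hence "P (n_map n \<tau>)" by (simp add: n_map_def P_def)
  thus ?thesis unfolding P by blast
qed

text \<open>By evenness a preimage \<open>w\<close> of \<open>x\<close> may be replaced by
  \<open>- w\<close>, which merges the two sign cases into one list of \<open>n\<close>
  translates.\<close>

lemma n_map_eq_iff: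
  "n_map n \<tau> x = n_map n \<tau> (weierstrass_p \<tau> z) \<longleftrightarrow> (\<exists>k<n. x = weierstrass_p \<tau> (z + of_nat k / of_nat n))"
proof -
  obtain w where w: "weierstrass_p \<tau> w = x" using weierstrass_p_surj by blast
  have "n_map n \<tau> x = n_map n \<tau> (weierstrass_p \<tau> z) \<longleftrightarrow>
      of_nat n * (w - z) \<in> N.\<Lambda> \<or> of_nat n * (- w - z) \<in> N.\<Lambda>"
  proof -
    have "of_nat n * (- w - z) = - (of_nat n * w + of_nat n * z)" by (simp add: algebra_simps)
    thus ?thesis
      unfolding w[symmetric] n_map_weierstrass_p N.weierstrass_p_eq_iff
      by (simp only: N.lattice_uminus_iff right_diff_distrib)
  qed
  also have "\<dots> \<longleftrightarrow> (\<exists>k<n. w - z - of_nat k / of_nat n \<in> \<Lambda> \<or> - w - z - of_nat k / of_nat n \<in> \<Lambda>)"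
    unfolding mult_in_lattice_iff by blast
  also have "\<dots> \<longleftrightarrow> (\<exists>k<n. x = weierstrass_p \<tau> (z + of_nat k / of_nat n))"
  proof -
    have "- w - z - of_nat k / of_nat n \<in> \<Lambda> \<longleftrightarrow> w + (z + of_nat k / of_nat n) \<in> \<Lambda>" for k
      using lattice_uminus_iff[of "w + (z + of_nat k / of_nat n)"] by (simp add: algebra_simps)
    thus ?thesis unfolding w[symmetric] weierstrass_p_eq_iff by (simp add: algebra_simps)
  qed
  finally show ?thesis .
qed

text \<open>This describes the half points through fibre sizes alone, which Moebius equivalence
  preserves. Translates with distinct indices \<open>j\<close>, \<open>k\<close> coincide only if
  \<open>2 * z + (j + k) / n\<close> is a period; for \<open>n \<ge> 3\<close> such indices exist as
  soon as \<open>2 * z\<close> lies in the kernel.\<close>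

lemma card_fibre_less_iff:
  assumes n3: "n \<ge> 3"
  shows "card {x. n_map n \<tau> x = y} < n \<longleftrightarrow> y \<in> half_points (of_nat n * \<tau>)"
proof -
  obtain v where "weierstrass_p (of_nat n * \<tau>) v = y" using N.weierstrass_p_surj by blast
  moreover define z where "z = v / of_nat n"
  ultimately have y: "y = n_map n \<tau> (weierstrass_p \<tau> z)" 
    using n_nonzero by (simp add: n_map_weierstrass_p)
  define f where "f = (\<lambda>k::nat. weierstrass_p \<tau> (z + of_nat k / of_nat n))"
  have fib: "{x. n_map n \<tau> x = y} = f ` {..<n}"
    by (auto simp: y n_map_eq_iff f_def)
  have feq: "f j = f k \<longleftrightarrow> j = k \<or> 2 * z + of_nat (j + k) / of_nat n \<in> \<Lambda>" if "j < n" "k < n" for j k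
  proof -
    have "f j = f k \<longleftrightarrow> of_int (int j - int k) / of_nat n \<in> \<Lambda> \<or> 2 * z + of_nat (j + k) / of_nat n \<in> \<Lambda>"
      unfolding f_def weierstrass_p_eq_iff by (simp add: algebra_simps add_divide_distrib diff_divide_distrib)
    also have "of_int (int j - int k) / of_nat n \<in> \<Lambda> \<longleftrightarrow> int n dvd (int j - int k)"
      by (rule int_div_in_lattice)
    also have "\<dots> \<longleftrightarrow> j = k"
      using that dvd_imp_le_int[of "int j - int k" "int n"] by (cases "int j - int k = 0") auto
    finally show ?thesis .
  qed
  have "y \<in> half_points (of_nat n * \<tau>) \<longleftrightarrow> of_nat n * (2 * z) \<in> N.\<Lambda>"
  proof
    assume "y \<in> half_points (of_nat n * \<tau>)"
    then obtain h where h: "2 * h \<in> N.\<Lambda>" "weierstrass_p (of_nat n * \<tau>) (of_nat n * z) = weierstrass_p (of_nat n * \<tau>) h"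
      by (auto simp: half_points_def y n_map_weierstrass_p)
    hence "of_nat n * z - h \<in> N.\<Lambda> \<or> of_nat n * z + h \<in> N.\<Lambda>" by (simp add: N.weierstrass_p_eq_iff)
    thus "of_nat n * (2 * z) \<in> N.\<Lambda>"
    proof
      assume "of_nat n * z - h \<in> N.\<Lambda>"
      from N.lattice_add[OF N.lattice_add[OF this this] h(1)] show ?thesis by (simp add: algebra_simps)
    next
      assume "of_nat n * z + h \<in> N.\<Lambda>"
      from N.lattice_diff[OF N.lattice_add[OF this this] h(1)] show ?thesis by (simp add: algebra_simps)
    qed
  next
    assume "of_nat n * (2 * z) \<in> N.\<Lambda>"
    thus "y \<in> half_points (of_nat n * \<tau>)"
      by (auto simp: half_points_def y n_map_weierstrass_p mult_ac)
  qed
  also have "\<dots> \<longleftrightarrow> \<not> inj_on f {..<n}"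
  proof
    assume "of_nat n * (2 * z) \<in> N.\<Lambda>"
    \<comment> \<open>Negated so that \<open>m\<close> enters with a plus sign below.\<close>
    hence "of_nat n * (- (2 * z)) \<in> N.\<Lambda>" by simp
    then obtain m where m: "m < n" "- (2 * z) - of_nat m / of_nat n \<in> \<Lambda>"
      using mult_in_lattice_iff by blast
    hence m': "2 * z + of_nat m / of_nat n \<in> \<Lambda>"
      using lattice_uminus_iff[of "2 * z + of_nat m / of_nat n"] by simp
    have "2 * z + of_nat (m + n) / of_nat n \<in> \<Lambda>"
      using lattice_add[OF m' lattice_1] n_nonzero by (simp add: add_divide_distrib add_ac)
    \<comment> \<open>The involution \<open>j \<mapsto> m - j\<close> of \<open>\<int>/n\<close> has at most two fixed points.\<close>
    have "\<exists>j<n. \<exists>k<n. j \<noteq> k \<and> (j + k = m \<or> j + k = m + n)"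
    proof (cases "m = 0")
      case True
      \<comment> \<open>The sum is \<open>m + n\<close>; the two indices differ because
        \<open>n \<ge> 3\<close>.\<close>
      thus ?thesis using n3 by (intro exI[of _ 1] exI[of _ "n - 1"] conjI) auto
    next
      case False
      thus ?thesis using m(1) n3 by (intro exI[of _ 0] exI[of _ m] conjI) auto
    qed
    then obtain j k where "j < n" "k < n" "j \<noteq> k" "j + k = m \<or> j + k = m + n" by blast
    hence "f j = f k" using feq m' \<open>2 * z + of_nat (m + n) / of_nat n \<in> \<Lambda>\<close> by metis
    thus "\<not> inj_on f {..<n}" using \<open>j < n\<close> \<open>k < n\<close> \<open>j \<noteq> k\<close> by (auto simp: inj_on_def)
  next
    assume "\<not> inj_on f {..<n}"
    then obtain j k where "j < n" "k < n" "j \<noteq> k" "f j = f k" by (auto simp: inj_on_def)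
    hence "2 * z + of_nat (j + k) / of_nat n \<in> \<Lambda>" using feq by blast
    from mult_in_lattice[OF this] have "of_nat n * (2 * z) + of_nat (j + k) \<in> N.\<Lambda>"
      by (simp only: distrib_left times_divide_eq_right nonzero_mult_div_cancel_left[OF n_nonzero])
    moreover have "of_nat (j + k) \<in> N.\<Lambda>" using N.lattice_memI[of "int (j + k)" 0] by simp
    ultimately show "of_nat n * (2 * z) \<in> N.\<Lambda>" using N.lattice_add_iff by blast
  qed
  also have "\<dots> \<longleftrightarrow> card (f ` {..<n}) < n"
    using card_image_le[of "{..<n}" f] inj_on_iff_eq_card[of "{..<n}" f] by auto
  finally show ?thesis by (simp add: fib)
qed

end

section \<open>The action of \<open>\<Gamma>\<^sub>0(n)\<close>\<close>

lemma Gamma0_orbit_iff: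
  "x \<in> Gamma0_orbit n \<tau> \<longleftrightarrow> (\<exists>a b c d :: int. a * d - b * c = 1 \<and> int n dvd c \<and>
     x = (of_int a * \<tau> + of_int b) / (of_int c * \<tau> + of_int d))"
proof
  assume "x \<in> Gamma0_orbit n \<tau>"
  then obtain A where "A \<in> Gamma0 n" "x = modular_action A \<tau>" by (auto simp: Gamma0_orbit_def)
  thus "\<exists>a b c d :: int. a * d - b * c = 1 \<and> int n dvd c \<and>
     x = (of_int a * \<tau> + of_int b) / (of_int c * \<tau> + of_int d)"
    by (intro exI[of _ "A $ 1 $ 1"] exI[of _ "A $ 1 $ 2"] exI[of _ "A $ 2 $ 1"] exI[of _ "A $ 2 $ 2"])
       (auto simp: Gamma0_def modular_action_def det_2)
next
  assume "\<exists>a b c d :: int. a * d - b * c = 1 \<and> int n dvd c \<and>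
     x = (of_int a * \<tau> + of_int b) / (of_int c * \<tau> + of_int d)"
  then obtain a b c d :: int where *: "a * d - b * c = 1" "int n dvd c"
     "x = (of_int a * \<tau> + of_int b) / (of_int c * \<tau> + of_int d)" by blast
  define A :: "int^2^2" where "A = vector [vector [a, b], vector [c, d]]"
  have "A \<in> Gamma0 n" "x = modular_action A \<tau>"
    using * by (auto simp: A_def Gamma0_def modular_action_def det_2)
  thus "x \<in> Gamma0_orbit n \<tau>" by (auto simp: Gamma0_orbit_def)
qed

lemma (in half_plane) modular_denominator_nonzero:
  assumes "a * d - b * c = (1 :: int)"
  shows "of_int c * \<tau> + of_int d \<noteq> 0"
proof
  assume "of_int c * \<tau> + of_int d = 0"
  hence "of_int d + of_int c * \<tau> = of_int 0 + of_int 0 * \<tau>" by (simp add: add.commute)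
  from lattice_repr_unique[OF this] assms show False by simp
qed

lemma Gamma0_orbit_self: "\<tau> \<in> Gamma0_orbit n \<tau>"
  unfolding Gamma0_orbit_iff by (rule exI[of _ 1], rule exI[of _ 0], rule exI[of _ 0], rule exI[of _ 1]) simp

text \<open>The matrices are multiplied; the new lower left entry \<open>c * a' + d * c'\<close> is
  again divisible by \<open>n\<close>.\<close>

lemma Gamma0_orbit_mono:
  assumes "half_plane \<sigma>" "\<tau> \<in> Gamma0_orbit n \<sigma>"
  shows "Gamma0_orbit n \<tau> \<subseteq> Gamma0_orbit n \<sigma>"
proof
  interpret s: half_plane \<sigma> by fact
  fix x assume "x \<in> Gamma0_orbit n \<tau>"
  then obtain a b c d :: int where 1: "a * d - b * c = 1" "int n dvd c"
     "x = (of_int a * \<tau> + of_int b) / (of_int c * \<tau> + of_int d)" unfolding Gamma0_orbit_iff by blast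
  obtain a' b' c' d' :: int where 2: "a' * d' - b' * c' = 1" "int n dvd c'"
     "\<tau> = (of_int a' * \<sigma> + of_int b') / (of_int c' * \<sigma> + of_int d')"
    using assms(2) unfolding Gamma0_orbit_iff by blast
  define D where "D = of_int c' * \<sigma> + of_int d'"
  have D: "D \<noteq> 0" unfolding D_def using s.modular_denominator_nonzero[OF 2(1)] .
  have num: "of_int a * \<tau> + of_int b = (of_int (a * a' + b * c') * \<sigma> + of_int (a * b' + b * d')) / D"
   and den: "of_int c * \<tau> + of_int d = (of_int (c * a' + d * c') * \<sigma> + of_int (c * b' + d * d')) / D"
    using D unfolding 2(3) D_def[symmetric] by (simp_all add: eq_divide_eq distrib_right) (simp_all add: D_def algebra_simps)
  have "(a * a' + b * c') * (c * b' + d * d') - (a * b' + b * d') * (c * a' + d * c') 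
      = (a * d - b * c) * (a' * d' - b' * c')" by (simp add: algebra_simps)
  moreover have "int n dvd c * a' + d * c'" using 1(2) 2(2) by simp
  moreover have "x = (of_int (a * a' + b * c') * \<sigma> + of_int (a * b' + b * d')) / 
      (of_int (c * a' + d * c') * \<sigma> + of_int (c * b' + d * d'))"
    using D unfolding 1(3) num den by simp
  ultimately show "x \<in> Gamma0_orbit n \<sigma>" unfolding Gamma0_orbit_iff 1(1) 2(1) by fastforce
qed

lemma Gamma0_orbit_sym:
  assumes "half_plane \<sigma>" "\<tau> \<in> Gamma0_orbit n \<sigma>"
  shows "\<sigma> \<in> Gamma0_orbit n \<tau>"
proof -
  interpret s: half_plane \<sigma> by fact
  obtain a b c d :: int where 1: "a * d - b * c = 1" "int n dvd c"
     "\<tau> = (of_int a * \<sigma> + of_int b) / (of_int c * \<sigma> + of_int d)"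
    using assms(2) unfolding Gamma0_orbit_iff by blast
  define D where "D = of_int c * \<sigma> + of_int d"
  have D: "D \<noteq> 0" unfolding D_def using s.modular_denominator_nonzero[OF 1(1)] .
  have det: "(of_int a * of_int d - of_int b * of_int c :: complex) = 1"
    using arg_cong[OF 1(1), of of_int] by simp
  have t: "\<tau> = (of_int a * \<sigma> + of_int b) / D" by (simp add: 1(3) D_def)
  have "of_int d * \<tau> + of_int (-b) = (of_int d * (of_int a * \<sigma> + of_int b) - of_int b * D) / D"
    unfolding t using D by (simp add: diff_divide_distrib)
  also have "of_int d * (of_int a * \<sigma> + of_int b) - of_int b * D = (of_int a * of_int d - of_int b * of_int c) * \<sigma>"
    by (simp add: D_def algebra_simps)
  finally have num: "of_int d * \<tau> + of_int (-b) = \<sigma> / D" by (simp add: det)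
  have "of_int (-c) * \<tau> + of_int a = (of_int a * D - of_int c * (of_int a * \<sigma> + of_int b)) / D"
    unfolding t using D by (simp add: diff_divide_distrib)
  also have "of_int a * D - of_int c * (of_int a * \<sigma> + of_int b) = of_int a * of_int d - of_int b * of_int c"
    by (simp add: D_def algebra_simps)
  finally have den: "of_int (-c) * \<tau> + of_int a = 1 / D" by (simp add: det)
  \<comment> \<open>The inverse matrix, with lower left entry \<open>- c\<close>.\<close>
  have "\<sigma> = (of_int d * \<tau> + of_int (-b)) / (of_int (-c) * \<tau> + of_int a)"
    unfolding num den using D by simp
  moreover have "d * a - (-b) * (-c) = 1" using 1(1) by (simp add: mult.commute)
  ultimately show ?thesis unfolding Gamma0_orbit_iff using 1(2) by (metis dvd_minus_iff)
qed

lemma Gamma0_orbit_eq_iff: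
  assumes "half_plane \<tau>" "half_plane \<sigma>"
  shows "Gamma0_orbit n \<sigma> = Gamma0_orbit n \<tau> \<longleftrightarrow> \<tau> \<in> Gamma0_orbit n \<sigma>"
  using Gamma0_orbit_self Gamma0_orbit_mono[OF assms(2)] Gamma0_orbit_mono[OF assms(1)]
    Gamma0_orbit_sym[OF assms(2)] by (metis subset_antisym)

text \<open>Multiplication by \<alpha> takes the basis 1, \<tau> to another basis of the lattice of
  \<sigma>, because the determinant is 1; the converse direction inverts the matrix.\<close>

lemma lattice_transform:
  fixes a b c d :: int
  assumes "a * d - b * c = 1" "\<alpha> \<noteq> 0"
    and \<alpha>: "\<alpha> = of_int c * \<sigma> + of_int d" "\<alpha> * \<tau> = of_int a * \<sigma> + of_int b"
  shows "\<omega> \<in> lattice_of \<tau> \<longleftrightarrow> \<alpha> * \<omega> \<in> lattice_of \<sigma>"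
proof
  assume "\<omega> \<in> lattice_of \<tau>"
  then obtain k l where "\<omega> = of_int k + of_int l * \<tau>" by (auto simp: lattice_of_def)
  hence "\<alpha> * \<omega> = of_int k * \<alpha> + of_int l * (\<alpha> * \<tau>)" by (simp add: algebra_simps)
  also have "\<dots> = of_int k * (of_int c * \<sigma> + of_int d) + of_int l * (of_int a * \<sigma> + of_int b)"
    using \<alpha> by simp
  also have "\<dots> = of_int (k * d + l * b) + of_int (k * c + l * a) * \<sigma>" by (simp add: algebra_simps)
  finally show "\<alpha> * \<omega> \<in> lattice_of \<sigma>" unfolding lattice_of_def by blast
next
  assume "\<alpha> * \<omega> \<in> lattice_of \<sigma>"
  then obtain k l where kl: "\<alpha> * \<omega> = of_int k + of_int l * \<sigma>" by (auto simp: lattice_of_def)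
  have det: "(of_int a * of_int d - of_int b * of_int c :: complex) = 1"
    using arg_cong[OF assms(1), of of_int] by simp
  have "of_int a * \<alpha> - of_int c * (\<alpha> * \<tau>) = of_int a * of_int d - of_int b * of_int c"
    unfolding \<alpha>(2) by (simp add: \<alpha>(1) algebra_simps)
  hence one: "1 = of_int a * \<alpha> - of_int c * (\<alpha> * \<tau>)" by (simp add: det)
  have "of_int d * (\<alpha> * \<tau>) - of_int b * \<alpha> = (of_int a * of_int d - of_int b * of_int c) * \<sigma>"
    unfolding \<alpha>(2) by (simp add: \<alpha>(1) algebra_simps)
  hence sig: "\<sigma> = of_int d * (\<alpha> * \<tau>) - of_int b * \<alpha>" by (simp add: det)
  have "\<alpha> * \<omega> = of_int k * 1 + of_int l * \<sigma>" using kl by simp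
  also have "\<dots> = of_int k * (of_int a * \<alpha> - of_int c * (\<alpha> * \<tau>)) + of_int l * (of_int d * (\<alpha> * \<tau>) - of_int b * \<alpha>)"
    using one sig by metis
  also have "\<dots> = \<alpha> * (of_int (k * a - l * b) + of_int (l * d - k * c) * \<tau>)" by (simp add: algebra_simps)
  finally have "\<omega> = of_int (k * a - l * b) + of_int (l * d - k * c) * \<tau>" using \<open>\<alpha> \<noteq> 0\<close> by simp
  thus "\<omega> \<in> lattice_of \<tau>" unfolding lattice_of_def by blast
qed

section \<open>From a common orbit to equivalent maps\<close>

lemma weierstrass_p_scale:
  assumes "\<alpha> \<noteq> 0" and L: "\<And>\<omega>. \<omega> \<in> lattice_of \<tau> \<longleftrightarrow> \<alpha> * \<omega> \<in> lattice_of \<sigma>"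
  shows "weierstrass_p \<tau> z = mobius_map (\<alpha>\<^sup>2) 0 0 1 (weierstrass_p \<sigma> (\<alpha> * z))"
proof -
  have "(\<Sum>\<^sub>\<infinity>\<omega>\<in>lattice_of \<tau> - {0}. 1 / (z - \<omega>)\<^sup>2 - 1 / \<omega>\<^sup>2) =
        (\<Sum>\<^sub>\<infinity>\<omega>\<in>lattice_of \<sigma> - {0}. \<alpha>\<^sup>2 * (1 / (\<alpha> * z - \<omega>)\<^sup>2 - 1 / \<omega>\<^sup>2))"
  \<comment> \<open>\<wp> is homogeneous of degree -2, and each term of the series already
    is.\<close>
  proof (rule infsum_reindex_bij_witness[of _ "\<lambda>\<omega>. \<omega> / \<alpha>" "\<lambda>\<omega>. \<alpha> * \<omega>"])
    fix \<omega>
    have "\<alpha> * z - \<alpha> * \<omega> = \<alpha> * (z - \<omega>)" by (simp add: algebra_simps)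
    thus "\<alpha>\<^sup>2 * (1 / (\<alpha> * z - \<alpha> * \<omega>)\<^sup>2 - 1 / (\<alpha> * \<omega>)\<^sup>2) = 1 / (z - \<omega>)\<^sup>2 - 1 / \<omega>\<^sup>2"
      using assms(1) by (simp only: power_mult_distrib) (simp add: right_diff_distrib)
  qed (use assms in auto)
  also have "\<dots> = \<alpha>\<^sup>2 * (\<Sum>\<^sub>\<infinity>\<omega>\<in>lattice_of \<sigma> - {0}. 1 / (\<alpha> * z - \<omega>)\<^sup>2 - 1 / \<omega>\<^sup>2)"
    using assms(1) by (simp add: infsum_cmult_right')
  finally show ?thesis
    using assms(1) L[of z] by (simp add: weierstrass_p_def mobius_map_def power_mult_distrib distrib_left)
qed

text \<open>One scalar serves both lattices: divisibility of \<open>c\<close> by \<open>n\<close>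
  lets a conjugated matrix act on \<open>n * \<sigma>\<close> with the same \<alpha>. Hence the same
  Moebius map \<open>M\<close> appears on the source and on the target.\<close>

lemma equivalent_if_orbit:
  assumes "isogeny_lattice \<tau> n" "isogeny_lattice \<sigma> n" "\<tau> \<in> Gamma0_orbit n \<sigma>"
  shows "mobius_equivalent (n_map n \<tau>) (n_map n \<sigma>)"
proof -
  interpret t: isogeny_lattice \<tau> n by fact
  interpret s: isogeny_lattice \<sigma> n by fact
  obtain a b c d :: int where 1: "a * d - b * c = 1" "int n dvd c"
     "\<tau> = (of_int a * \<sigma> + of_int b) / (of_int c * \<sigma> + of_int d)"
    using assms(3) unfolding Gamma0_orbit_iff by blast
  define \<alpha> where "\<alpha> = of_int c * \<sigma> + of_int d"
  have \<alpha>: "\<alpha> \<noteq> 0" unfolding \<alpha>_def using s.modular_denominator_nonzero[OF 1(1)] .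
  have \<alpha>\<tau>: "\<alpha> * \<tau> = of_int a * \<sigma> + of_int b" using \<alpha> by (simp add: 1(3) \<alpha>_def)
  obtain c' where c': "c = int n * c'" using 1(2) by auto
  define M where "M = mobius_map (\<alpha>\<^sup>2) 0 0 1"
  have M: "M \<in> mobius_transformations"
    unfolding M_def mobius_transformations_def using \<alpha> by (force intro!: exI)
  have s1: "weierstrass_p \<tau> z = M (weierstrass_p \<sigma> (\<alpha> * z))" for z
    unfolding M_def
    by (rule weierstrass_p_scale[OF \<alpha>], rule lattice_transform[OF 1(1) \<alpha> \<alpha>_def \<alpha>\<tau>])
  have s2: "weierstrass_p (of_nat n * \<tau>) z = M (weierstrass_p (of_nat n * \<sigma>) (\<alpha> * z))" for z
    unfolding M_def
  proof (rule weierstrass_p_scale[OF \<alpha>], rule lattice_transform[OF _ \<alpha>])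
    \<comment> \<open>The matrix conjugated by diag(n, 1): its entries are \<open>a\<close>,
      \<open>b * n\<close>, \<open>c / n\<close>, \<open>d\<close>.\<close>
    show "a * d - (b * int n) * c' = 1" using 1(1) by (simp add: c' mult_ac)
    show "\<alpha> = of_int c' * (of_nat n * \<sigma>) + of_int d" by (simp add: \<alpha>_def c' mult_ac)
    show "\<alpha> * (of_nat n * \<tau>) = of_int a * (of_nat n * \<sigma>) + of_int (b * int n)"
      using arg_cong[OF \<alpha>\<tau>, of "\<lambda>x. of_nat n * x"] by (simp add: algebra_simps)
  qed
  have "n_map n \<tau> (M x) = M (n_map n \<sigma> x)" for x
  proof -
    obtain v where v: "weierstrass_p \<sigma> v = x" using s.weierstrass_p_surj by blast
    define z where "z = v / \<alpha>"
    have z: "weierstrass_p \<sigma> (\<alpha> * z) = x" using v \<alpha> by (simp add: z_def)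
    have "n_map n \<tau> (M x) = n_map n \<tau> (weierstrass_p \<tau> z)" by (simp add: s1 z)
    also have "\<dots> = M (weierstrass_p (of_nat n * \<sigma>) (of_nat n * (\<alpha> * z)))"
      unfolding t.n_map_weierstrass_p s2 by (simp only: mult.left_commute)
    also have "\<dots> = M (n_map n \<sigma> x)" unfolding s.n_map_weierstrass_p[symmetric] z ..
    finally show ?thesis .
  qed
  hence eq: "n_map n \<tau> \<circ> M = M \<circ> n_map n \<sigma>" by auto
  obtain M' where M': "M' \<in> mobius_transformations" "M' \<circ> M = id" using mobius_inverse[OF M] by blast
  have "n_map n \<sigma> = M' \<circ> n_map n \<tau> \<circ> M"
    using arg_cong[OF eq, of "\<lambda>f. M' \<circ> f"] M'(2) by (simp add: o_assoc)
  thus ?thesis unfolding mobius_equivalent_def using M M'(1) by blast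
qed

section \<open>From equivalent maps back to a common orbit\<close>

lemma orbit_if_lattices:
  assumes "half_plane \<tau>" "half_plane \<sigma>" "\<alpha> \<noteq> 0"
    and L: "\<And>\<omega>. \<omega> \<in> lattice_of \<tau> \<longleftrightarrow> \<alpha> * \<omega> \<in> lattice_of \<sigma>"
    and L1: "\<alpha> \<in> lattice_of (of_nat n * \<sigma>)"
  shows "\<tau> \<in> Gamma0_orbit n \<sigma>"
proof -
  interpret t: half_plane \<tau> by fact
  interpret s: half_plane \<sigma> by fact
  \<comment> \<open>That \<alpha> lies in the smaller lattice is what makes the entry
    \<open>c\<close> divisible by \<open>n\<close>.\<close>
  obtain d c' where \<alpha>: "\<alpha> = of_int d + of_int c' * (of_nat n * \<sigma>)"
    using L1 by (auto simp: lattice_of_def)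
  define c where "c = c' * int n"
  have \<alpha>c: "\<alpha> = of_int d + of_int c * \<sigma>" by (simp add: \<alpha> c_def)
  have "\<alpha> * \<tau> \<in> s.\<Lambda>" using L[of \<tau>] by simp
  then obtain b a where ab: "\<alpha> * \<tau> = of_int b + of_int a * \<sigma>" by (auto simp: lattice_of_def)
  have "1 / \<alpha> \<in> t.\<Lambda>" using L[of "1 / \<alpha>"] assms(3) by simp
  then obtain r u where ru: "1 / \<alpha> = of_int r + of_int u * \<tau>" by (auto simp: lattice_of_def)
  have "\<sigma> / \<alpha> \<in> t.\<Lambda>" using L[of "\<sigma> / \<alpha>"] assms(3) by simp
  then obtain p q where pq: "\<sigma> / \<alpha> = of_int p + of_int q * \<tau>" by (auto simp: lattice_of_def)
  have "1 = of_int r * \<alpha> + of_int u * (\<alpha> * \<tau>)"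
    using arg_cong[OF ru, of "\<lambda>x. \<alpha> * x"] assms(3) by (simp add: algebra_simps)
  hence "of_int (r * d + u * b) + of_int (r * c + u * a) * \<sigma> = of_int 1 + of_int 0 * \<sigma>"
    by (simp only: ab) (simp add: \<alpha>c algebra_simps)
  hence e1: "r * d + u * b = 1 \<and> r * c + u * a = 0" by (rule s.lattice_repr_unique)
  have "\<sigma> = of_int p * \<alpha> + of_int q * (\<alpha> * \<tau>)"
    using arg_cong[OF pq, of "\<lambda>x. \<alpha> * x"] assms(3) by (simp add: algebra_simps)
  hence "of_int (p * d + q * b) + of_int (p * c + q * a) * \<sigma> = of_int 0 + of_int 1 * \<sigma>"
    by (simp only: ab) (simp add: \<alpha>c algebra_simps)
  hence e2: "p * d + q * b = 0 \<and> p * c + q * a = 1" by (rule s.lattice_repr_unique)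
  \<comment> \<open>The basis change is invertible over the integers, so its determinant is 1 or
    -1.\<close>
  have "(r * q - u * p) * (a * d - b * c) = (r * d + u * b) * (p * c + q * a) - (r * c + u * a) * (p * d + q * b)"
    by (simp add: algebra_simps)
  also have "\<dots> = 1" using e1 e2 by simp
  finally have "a * d - b * c = 1 \<or> a * d - b * c = -1"
    by (metis pos_zmult_eq_1_iff_lemma mult.commute)
  moreover have "a * d - b * c > 0"
  proof -
    \<comment> \<open>Both \<tau> and \<sigma> have positive imaginary part, so the basis change
      preserves orientation.\<close>
    have "Im (\<alpha> * \<tau> * cnj \<alpha>) = (norm \<alpha>)\<^sup>2 * Im \<tau>"
      by (simp only: mult.commute[of "\<alpha> * \<tau>"] mult.assoc[symmetric])
         (simp add: complex_mult_cnj cmod_power2 mult.commute[of "cnj \<alpha>"])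
    hence "Im (\<alpha> * \<tau> * cnj \<alpha>) > 0" using assms(3) t.Im_pos by simp
    moreover have "Im (\<alpha> * \<tau> * cnj \<alpha>) = of_int (a * d - b * c) * Im \<sigma>"
      unfolding ab by (simp add: \<alpha>c algebra_simps)
    ultimately have "0 < of_int (a * d - b * c) * Im \<sigma>" by simp
    hence "0 < real_of_int (a * d - b * c)" using s.Im_pos by (simp only: zero_less_mult_iff) simp
    thus ?thesis by (simp only: of_int_0_less_iff)
  qed
  ultimately have "a * d - b * c = 1" by linarith
  moreover have "int n dvd c" by (simp add: c_def)
  moreover have "\<tau> = (of_int a * \<sigma> + of_int b) / (of_int c * \<sigma> + of_int d)"
  proof -
    have "\<tau> = (\<alpha> * \<tau>) / \<alpha>" using assms(3) by simp
    also have "\<dots> = (of_int a * \<sigma> + of_int b) / (of_int c * \<sigma> + of_int d)"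
      by (simp only: ab) (simp add: \<alpha>c add.commute)
    finally show ?thesis .
  qed
  ultimately show ?thesis unfolding Gamma0_orbit_iff by blast
qed

text \<open>The identity theorem selects a single branch from finitely many candidates.\<close>

lemma mobius_branch:
  fixes \<tau> \<sigma> \<alpha> \<beta> :: complex
  assumes "half_plane \<tau>" "half_plane \<sigma>" and \<epsilon>: "\<epsilon> \<in> mobius_transformations" and \<alpha>: "\<alpha> \<noteq> 0"
    and ev: "eventually (\<lambda>w. \<exists>k\<in>K. \<epsilon> (weierstrass_p \<sigma> (\<alpha> * w + \<beta>)) = weierstrass_p \<tau> (w + g k)) (cosparse UNIV)"
    and "finite K"
  shows "\<exists>k\<in>K. eventually (\<lambda>w. \<epsilon> (weierstrass_p \<sigma> (\<alpha> * w + \<beta>)) = weierstrass_p \<tau> (w + g k)) (cosparse UNIV)"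
proof -
  interpret t: half_plane \<tau> by fact
  interpret s: half_plane \<sigma> by fact
  obtain a b c d where e: "\<epsilon> = mobius_map a b c d" "a * d - b * c \<noteq> 0"
    using \<epsilon> by (auto simp: mobius_transformations_def)
  \<comment> \<open>Among finitely many candidates that together hold generically, one must hold
    frequently.\<close>
  have "frequently (\<lambda>w. \<exists>k\<in>K. \<epsilon> (weierstrass_p \<sigma> (\<alpha> * w + \<beta>)) = weierstrass_p \<tau> (w + g k)) (cosparse UNIV)"
    using ev by (intro eventually_frequently) auto
  from frequently_bex_finite[OF \<open>finite K\<close> this] obtain k where k: "k \<in> K"
    "frequently (\<lambda>w. \<epsilon> (weierstrass_p \<sigma> (\<alpha> * w + \<beta>)) = weierstrass_p \<tau> (w + g k)) (cosparse UNIV)"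
    by blast
  define F where "F = (\<lambda>w. (a * s.wp (\<alpha> * w + \<beta>) + b) / (c * s.wp (\<alpha> * w + \<beta>) + d))"
  define G where "G = (\<lambda>w. t.wp (w + g k))"
  \<comment> \<open>Off a sparse set no value is infinite, so equality on the sphere becomes
    equality of the meromorphic functions \<open>F\<close> and \<open>G\<close>.\<close>
  have "eventually (\<lambda>w. c * s.wp (\<alpha> * w + \<beta>) + d \<noteq> 0) (cosparse UNIV)"
  proof (cases "c = 0")
    case True
    thus ?thesis using e(2) by auto
  next
    case False
    have "x = - d / c" if "c * x + d = 0" for x
    proof -
      have "c * x = - d" using that by (simp add: eq_neg_iff_add_eq_0)
      thus ?thesis using False by (metis nonzero_mult_div_cancel_left)
    qed
    with ae_affine[OF s.wp_ae_neq[of "- d / c"] \<alpha>, of \<beta>] show ?thesis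
      by (auto elim!: eventually_mono)
  qed
  moreover have "eventually (\<lambda>w. w + g k \<notin> t.\<Lambda>) (cosparse UNIV)"
    using ae_affine[OF t.ae_not_lattice, of 1 "g k"] by simp
  ultimately have iff: "eventually (\<lambda>w. \<epsilon> (weierstrass_p \<sigma> (\<alpha> * w + \<beta>)) = weierstrass_p \<tau> (w + g k)
      \<longleftrightarrow> F w = G w) (cosparse UNIV)"
    using ae_affine[OF s.ae_not_lattice \<alpha>, of \<beta>]
    by eventually_elim (simp add: e(1) mobius_map_def s.weierstrass_p_eq t.weierstrass_p_eq F_def G_def)
  have "(\<lambda>w. s.wp (\<alpha> * w + \<beta>)) meromorphic_on UNIV"
    by (rule meromorphic_on_compose[OF s.wp_meromorphic[of UNIV]]) (auto intro!: analytic_intros)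
  hence "F meromorphic_on UNIV" unfolding F_def by (intro meromorphic_intros)
  moreover have "G meromorphic_on UNIV" unfolding G_def
    by (rule meromorphic_on_compose[OF t.wp_meromorphic[of UNIV]]) (auto intro!: analytic_intros)
  moreover have "frequently (\<lambda>w. F w = G w) (cosparse UNIV)"
    using frequently_eventually_frequently[OF k(2) iff] by (rule frequently_elim1) auto
  ultimately have "eventually (\<lambda>w. F w = G w) (cosparse UNIV)" by (rule meromorphic_identity)
  with iff have "eventually (\<lambda>w. \<epsilon> (weierstrass_p \<sigma> (\<alpha> * w + \<beta>)) = weierstrass_p \<tau> (w + g k)) (cosparse UNIV)"
    by eventually_elim simp
  thus ?thesis using k(1) by blast
qed

lemma orbit_if_equivalent:
  assumes "isogeny_lattice \<tau> n" "isogeny_lattice \<sigma> n" "n \<ge> 3"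
    and "mobius_equivalent (n_map n \<tau>) (n_map n \<sigma>)"
  shows "\<tau> \<in> Gamma0_orbit n \<sigma>"
proof -
  interpret t: isogeny_lattice \<tau> n by fact
  interpret s: isogeny_lattice \<sigma> n by fact
  obtain \<epsilon> \<epsilon>' where e: "\<epsilon> \<in> mobius_transformations" "\<epsilon>' \<in> mobius_transformations"
      "n_map n \<sigma> = \<epsilon> \<circ> n_map n \<tau> \<circ> \<epsilon>'"
    using assms(4) by (auto simp: mobius_equivalent_def)
  have inj: "inj \<epsilon>" "inj \<epsilon>'" using e mobius_inj by auto
  have surj: "surj \<epsilon>" "surj \<epsilon>'" using e mobius_surj by auto
  have "y \<in> half_points (of_nat n * \<tau>) \<longleftrightarrow> \<epsilon> y \<in> half_points (of_nat n * \<sigma>)" for y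
  proof -
    \<comment> \<open>\<open>\<epsilon>'\<close> maps the fibre over \<open>\<epsilon> y\<close>
      bijectively onto the fibre over \<open>y\<close>, so their sizes agree.\<close>
    have "{x. n_map n \<sigma> x = \<epsilon> y} = \<epsilon>' -` {x. n_map n \<tau> x = y}"
      using inj(1) by (auto simp: e(3) inj_eq)
    moreover have "card (\<epsilon>' -` {x. n_map n \<tau> x = y}) = card {x. n_map n \<tau> x = y}"
      by (rule card_vimage_inj[OF inj(2)]) (simp add: surj(2))
    ultimately have "card {x. n_map n \<sigma> x = \<epsilon> y} = card {x. n_map n \<tau> x = y}"
      by (simp only:)
    thus ?thesis using t.card_fibre_less_iff[OF assms(3)] s.card_fibre_less_iff[OF assms(3)] by metis
  qed
  hence "\<epsilon> ` half_points (of_nat n * \<tau>) = half_points (of_nat n * \<sigma>)"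
    using surj(1) by (auto simp: image_iff) (metis surj_def)
  from mobius_lift[OF t.N.half_plane_axioms s.N.half_plane_axioms e(1) this]
  obtain \<alpha> \<beta> where \<alpha>: "\<alpha> \<noteq> 0" and lift: "eventually (\<lambda>z. \<epsilon> (weierstrass_p (of_nat n * \<tau>) z) =
       weierstrass_p (of_nat n * \<sigma>) (\<alpha> * z + \<beta>)) (cosparse UNIV)" by blast
  \<comment> \<open>The lift of \<open>\<epsilon>\<close> lives on the target curves; at the
    argument \<open>of_nat n * w\<close> its translation part becomes \<open>\<beta> / n\<close> on
    the source.\<close>
  define \<beta>' where "\<beta>' = \<beta> / of_nat n"
  have "eventually (\<lambda>w. \<exists>k\<in>{..<n}. \<epsilon>' (weierstrass_p \<sigma> (\<alpha> * w + \<beta>')) =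
      weierstrass_p \<tau> (w + of_nat k / of_nat n)) (cosparse UNIV)"
    using ae_affine[OF lift t.n_nonzero, of 0]
  proof eventually_elim
    case (elim w)
    have "\<epsilon> (n_map n \<tau> (weierstrass_p \<tau> w)) = weierstrass_p (of_nat n * \<sigma>) (of_nat n * (\<alpha> * w + \<beta>'))"
      using elim t.n_nonzero by (simp add: t.n_map_weierstrass_p \<beta>'_def algebra_simps)
    also have "\<dots> = \<epsilon> (n_map n \<tau> (\<epsilon>' (weierstrass_p \<sigma> (\<alpha> * w + \<beta>'))))"
      unfolding s.n_map_weierstrass_p[symmetric] by (simp add: e(3))
    finally have "n_map n \<tau> (\<epsilon>' (weierstrass_p \<sigma> (\<alpha> * w + \<beta>'))) = n_map n \<tau> (weierstrass_p \<tau> w)"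
      using inj(1) by (simp add: inj_eq)
    thus ?case by (auto simp: t.n_map_eq_iff)
  qed
  \<comment> \<open>So far \<open>k\<close> may depend on \<open>w\<close>; a single index now works
    off a sparse set.\<close>
  from mobius_branch[OF t.half_plane_axioms s.half_plane_axioms e(2) \<alpha> this]
  obtain k where k: "eventually (\<lambda>w. \<epsilon>' (weierstrass_p \<sigma> (\<alpha> * w + \<beta>')) =
      weierstrass_p \<tau> (w + of_nat k / of_nat n)) (cosparse UNIV)" by blast
  have \<alpha>': "1 / \<alpha> \<noteq> 0" using \<alpha> by simp
  \<comment> \<open>Solving for the argument shows that \<open>\<epsilon>'\<close> lifts to an
    affine map of slope \<open>1 / \<alpha>\<close>, so \<alpha> relates the lattices of the source
    curves as well.\<close>
  have "eventually (\<lambda>z. \<epsilon>' (weierstrass_p \<sigma> z) =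
      weierstrass_p \<tau> (1 / \<alpha> * z + (of_nat k / of_nat n - \<beta>' / \<alpha>))) (cosparse UNIV)"
    using ae_affine[OF k \<alpha>', of "- \<beta>' / \<alpha>"] \<alpha> by (simp add: algebra_simps)
  from period_transfer[OF s.half_plane_axioms t.half_plane_axioms inj(2) \<alpha>' this]
  have L: "\<omega> \<in> lattice_of \<tau> \<longleftrightarrow> \<alpha> * \<omega> \<in> lattice_of \<sigma>" for \<omega>
    using \<alpha> by simp
  \<comment> \<open>The period 1 of the target curve supplies the congruence condition modulo
    \<open>n\<close>.\<close>
  have "\<alpha> * 1 \<in> s.N.\<Lambda>"
    using period_transfer[OF t.N.half_plane_axioms s.N.half_plane_axioms inj(1) \<alpha> lift] t.N.lattice_1 by blast
  thus ?thesis
    using orbit_if_lattices[OF t.half_plane_axioms s.half_plane_axioms \<alpha> L] by simp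
qed

theorem theorem4p2:
  fixes \<tau>\<^sub>1 \<tau>\<^sub>2 :: complex and n :: nat
  assumes "\<tau>\<^sub>1 \<in> upper_half_plane" and "\<tau>\<^sub>2 \<in> upper_half_plane" and "n \<ge> 3"
  shows "mobius_equivalent (n_map n \<tau>\<^sub>1) (n_map n \<tau>\<^sub>2) \<longleftrightarrow>
    Gamma0_orbit n \<tau>\<^sub>2 = Gamma0_orbit n \<tau>\<^sub>1"
proof -
  interpret t: isogeny_lattice \<tau>\<^sub>1 n
    using assms by unfold_locales (auto simp: upper_half_plane_def)
  interpret s: isogeny_lattice \<tau>\<^sub>2 n
    using assms by unfold_locales (auto simp: upper_half_plane_def)
  show ?thesis
    unfolding Gamma0_orbit_eq_iff[OF t.half_plane_axioms s.half_plane_axioms]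
    using equivalent_if_orbit orbit_if_equivalent t.isogeny_lattice_axioms s.isogeny_lattice_axioms assms(3)
    by blast
qed

end
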